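(* Let $A\in\mathbb{C}^{r\times r}$, $B\in\mathbb{C}^{s\times t}$, $S\in\mathbb{C}^{s\times r}$, $T\in\mathbb{C}^{t\times r}$, and consider the coupled Sylvester equations $$XA-BY=S,\qquad YA^{H}-B^{H}X=T .$$ If $\mathrm{sv}(A)\cap\mathrm{sv}_{\mathrm{ext}}(B)=\emptyset$, then these equations have a unique solution pair $(X,Y)\in\mathbb{C}^{s\times r}\times\mathbb{C}^{t\times r}$. Furthermore: (a) with $\delta:=\min_{\omega\in\mathrm{sv}(A),\,\gamma\in\mathrm{sv}_{\mathrm{ext}}(B)}|\omega-\gamma|$, $$\sqrt{\|X\|_F^2+\|Y\|_F^2}\le\frac1\delta\sqrt{\|S\|_F^2+\|T\|_F^2};$$ (b) if $\delta:=\sigma_{\min}(A)-\sigma_{\max}(B)>0$, then for any unitarily invariant norm $\|\cdot\|_{\mathrm{ui}}$, $$\left\|\begin{bmatrix} 0 & X \\ Y & 0 \end{bmatrix}\right\|_{\mathrm{ui}}\le\frac1\delta\left\|\begin{bmatrix} S & 0 \\ 0 & T \end{bmatrix}\right\|_{\mathrm{ui}},\qquad \max\{\|X\|_{\mathrm{ui}},\|Y\|_{\mathrm{ui}}\}\le\frac1\delta\max\{\|S\|_{\mathrm{ui}},\|T\|_{\mathrm{ui}}\},$$ and in particular $\max\{\|X\|_2,\|Y\|_2\}\le\frac1\delta\max\{\|S\|_2,\|T\|_2\}$; (c) with $\delta$ as in (a), for any unitarily invariant norm $\|\cdot\|_{\mathrm{ui}}$, $$\left\|\begin{bmatrix} 0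 & X \\ Y & 0 \end{bmatrix}\right\|_{\mathrm{ui}}\le\frac{\pi}{2}\,\frac1\delta\left\|\begin{bmatrix} S & 0 \\ 0 & T \end{bmatrix}\right\|_{\mathrm{ui}},\qquad \max\{\|X\|_{\mathrm{ui}},\|Y\|_{\mathrm{ui}}\}\le\pi\,\frac1\delta\max\{\|S\|_{\mathrm{ui}},\|T\|_{\mathrm{ui}}\},$$ and in particular $\max\{\|X\|_2,\|Y\|_2\}\le\frac{\pi}{2}\,\frac1\delta\max\{\|S\|_2,\|T\|_2\}$.
   Context: $X^H$ is the conjugate transpose; $\|\cdot\|_2$ and $\|\cdot\|_F$ are the spectral and Frobenius norms. A matrix $B\in\mathbb{C}^{p\times q}$ has $\min\{p,q\}$ singular values $\sigma_1(B)\ge\dots\ge\sigma_{\min\{p,q\}}(B)$; $\sigma_{\max}(B)=\sigma_1(B)$, $\sigma_{\min}(B)=\sigma_{\min\{p,q\}}(B)$; $\mathrm{sv}(B)$ is the multiset of these singular values and $\mathrm{sv}_{\mathrm{ext}}(B)$ is $\mathrm{sv}(B)$ together with $|p-q|$ additional copies of $0$. A unitarily invariant norm $\|\cdot\|_{\mathrm{ui}}$ is a norm defined on complex matrices of all sizes such that $\|P^HBQ\|_{\mathrm{ui}}=\|B\|_{\mathrm{ui}}$ for all unitary $P,Q$ of fitting sizes, $\|B\|_{\mathrm{ui}}=\|B\|_2$ whenever $\mathrm{rank}(B)=1$, and appending zero rows or columns to $B$ does not change $\|B\|_{\mathrm{ui}}$. Such norms satisfy $\|XYZ\|_{\mathrm{ui}}\le\|X\|_2\|Y\|_{\mathrm{ui}}\|Z\|_2$.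 *)

theory Defs
  imports
    "HOL-Analysis.L2_Norm"
    "HOL-Computational_Algebra.Fundamental_Theorem_Algebra"
    "Jordan_Normal_Form.Schur_Decomposition"
    "Jordan_Normal_Form.DL_Rank"
begin

text \<open>
  The singular values of a \<open>p \<times> q\<close> matrix \<open>B\<close>, with multiplicity, are the square roots of the
  \<open>min p q\<close> largest eigenvalues of \<open>B\<^sup>H B\<close>. These are the eigenvalues of the smaller of the
  two Gram matrices \<open>B\<^sup>H B\<close> and \<open>B B\<^sup>H\<close>, whose nonzero eigenvalues agree. \<^const>\<open>Re\<close> only changes
  the type, because the eigenvalues of a Gram matrix are nonnegative reals.
\<close>
definition sv :: "complex mat \<Rightarrow> real multiset" where
  "sv B = image_mset (\<lambda>z. sqrt (Re z))
     (proots (char_poly (if dim_col B \<le> dim_row B then mat_adjoint B * B else B * mat_adjoint B)))"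

text \<open>With truncated subtraction the number of added zeros is \<open>\<bar>p - q\<bar>\<close>.\<close>
definition sv_ext :: "complex mat \<Rightarrow> real multiset" where
  "sv_ext B = sv B + replicate_mset ((dim_row B - dim_col B) + (dim_col B - dim_row B)) 0"

text \<open>The following three are meaningful for matrices with at least one row and one column only.\<close>
definition sigma_max :: "complex mat \<Rightarrow> real" where
  "sigma_max B = Max (set_mset (sv B))"

definition sigma_min :: "complex mat \<Rightarrow> real" where
  "sigma_min B = Min (set_mset (sv B))"

definition sv_gap :: "complex mat \<Rightarrow> complex mat \<Rightarrow> real" where
  "sv_gap A B = Min {\<bar>\<omega> - \<gamma>\<bar> | \<omega> \<gamma>. \<omega> \<in># sv A \<and> \<gamma> \<in># sv_ext B}"

definition vec_norm2 :: "complex vec \<Rightarrow> real" where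
  "vec_norm2 v = L2_set (\<lambda>i. cmod (v $ i)) {..<dim_vec v}"

definition spectral_norm :: "complex mat \<Rightarrow> real" where
  "spectral_norm B = (SUP v \<in> {v \<in> carrier_vec (dim_col B). vec_norm2 v \<le> 1}. vec_norm2 (B *\<^sub>v v))"

definition frobenius_norm :: "complex mat \<Rightarrow> real" where
  "frobenius_norm B = sqrt (\<Sum>i<dim_row B. \<Sum>j<dim_col B. (cmod (B $$ (i, j)))\<^sup>2)"

definition unitary_mat :: "complex mat \<Rightarrow> bool" where
  "unitary_mat U \<longleftrightarrow> square_mat U \<and> mat_adjoint U * U = 1\<^sub>m (dim_row U)"

text \<open>
  A unitarily invariant norm is a single function on complex matrices of all sizes, which
  restricts to a norm on each space of \<open>p \<times> q\<close> matrices. Empty matrices are included; the only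
  possible norm of an empty matrix is \<open>0\<close>, so this does not restrict the norm on the others.
\<close>
definition unitarily_invariant_norm :: "(complex mat \<Rightarrow> real) \<Rightarrow> bool" where
  "unitarily_invariant_norm N \<longleftrightarrow>
     (\<forall>p q. \<forall>B \<in> carrier_mat p q.
        0 \<le> N B \<and> (N B = 0 \<longleftrightarrow> B = 0\<^sub>m p q) \<and>
        (\<forall>c. N (c \<cdot>\<^sub>m B) = cmod c * N B) \<and>
        (\<forall>C \<in> carrier_mat p q. N (B + C) \<le> N B + N C)) \<and>
     (\<forall>p q. \<forall>B \<in> carrier_mat p q. \<forall>P \<in> carrier_mat p p. \<forall>Q \<in> carrier_mat q q.
        unitary_mat P \<longrightarrow> unitary_mat Q \<longrightarrow> N (mat_adjoint P * B * Q) = N B) \<and>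
     (\<forall>p q. \<forall>B \<in> carrier_mat p q. vec_space.rank p B = 1 \<longrightarrow> N B = spectral_norm B) \<and>
     (\<forall>p q k l. \<forall>B \<in> carrier_mat p q.
        N (four_block_mat B (0\<^sub>m p l) (0\<^sub>m k q) (0\<^sub>m k l)) = N B)"

end

theory Submission
  imports Defs
begin

text \<open>
  With \<open>A'\<close> and \<open>B'\<close> the Hermitian dilations \<open>[[0, A], [A\<^sup>H, 0]]\<close> and \<open>[[0, B], [B\<^sup>H, 0]]\<close>, the pair
  of equations says that \<open>Z = [[X, 0], [0, Y]]\<close> solves \<open>Z A' - B' Z = [[0, S], [T, 0]]\<close>. The
  eigenvalues of the dilations are, up to sign, in \<open>sv A\<close> and in \<open>sv_ext B\<close>, so they are \<open>\<delta>\<close> apart.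
  After diagonalization the equation is entrywise, which gives existence, uniqueness and (a).
  Part (b) follows from \<open>Z A' = B' Z + R\<close>, because multiplication by a Hermitian matrix with
  eigenvalues in \<open>[-\<tau>, \<tau>]\<close> increases a unitarily invariant norm at most by the factor \<open>\<tau>\<close>.

  The constant \<open>\<pi>/2\<close> in (c) is that of Bohr's inequality \<open>\<parallel>F\<parallel> \<le> (\<pi>/2\<delta>) \<parallel>F'\<parallel>\<close> for trigonometric sums
  without frequencies in \<open>(-\<delta>, \<delta>)\<close>, applied to \<open>F(x) = e\<^sup>-\<^sup>i\<^sup>x\<^sup>B\<^sup>' Z e\<^sup>i\<^sup>x\<^sup>A\<^sup>'\<close>, whose derivative has the norm of
  \<open>Z A' - B' Z\<close> everywhere. Here the eigenvalues are rounded to multiples of \<open>1/k\<close>, \<open>F\<close> is sampled on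
  a cyclic group, a discrete form of Bohr's inequality is used, and \<open>k\<close> tends to infinity. A norming
  functional reduces the discrete inequality to real sequences, which are compared with the
  triangle wave: if the sequence exceeded its bound, then the difference would be orthogonal to all
  trigonometric polynomials of degree less than \<open>n\<close> and yet have at most \<open>2n - 2\<close> sign changes.
\<close>

section \<open>Sublinear functionals and the discrete Bohr inequality\<close>

text \<open>In (b) an interval around 0 separates the two spectra, and multiplication by the smaller
  matrix is a perturbation. In (c) the spectra may interlace, and in eigenbases the task is to bound
  the Schur multiplier \<open>1 / (a j - b i)\<close>. The classical proof integrates
  \<open>F\<close> against a kernel of minimal L1 norm. Here the dual extremal object, the triangle
  wave, takes the place of that kernel, so that finite sums suffice, and Hahn-Banach is applied only
  to real coefficient sequences of length \<open>M\<close>.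

  The constant arises as follows. A wave with unit steps and half period \<open>p\<close> has the
  maximum \<open>p / 2\<close>. On \<open>M = 2 * n * p\<close> points its lowest frequency is
  \<open>n\<close>, and a frequency \<open>h\<close> advances by the angle
  \<open>2 * pi * h / M\<close> per step. The product of \<open>p / 2\<close> and this angle is
  \<open>pi / 2 * h / n\<close>, where \<open>h / n\<close> approximates
  \<open>(a j - b i) / \<delta>\<close>.

  The constant \<open>pi\<close> for the maximum of two block norms reflects that joining two blocks
  can double a general norm. In (b) this loss is avoided by treating the blocks separately.\<close>

lemma finite_hahn_banach:
  fixes q :: "(nat \<Rightarrow> real) \<Rightarrow> real"
  assumes sub: "\<And>a b. q (\<lambda>k. a k + b k) \<le> q a + q b"
    and hom: "\<And>c a. c \<ge> 0 \<Longrightarrow> q (\<lambda>k. c * a k) = c * q a"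
  shows "\<exists>x. x 0 = q (\<lambda>k. if k = 0 then 1 else 0) \<and>
    (\<forall>a. (\<forall>k>m. a k = 0) \<longrightarrow> (\<Sum>k\<le>m. a k * x k) \<le> q a)"
\<comment> \<open>The classical extension argument, one coordinate per step. Coordinate 0 comes
  first, so that the functional attains \<open>q\<close> there; a bound for \<open>x 0\<close> is
  then a bound for \<open>q\<close>. As \<open>q\<close> may be neither even nor nonnegative,
  negative multiples of the unit sequence are handled by subadditivity and \<open>z\<close>.\<close>
proof (induction m)
  case 0
  let ?e = "\<lambda>k::nat. if k = 0 then 1 else (0::real)"
  have z: "q (\<lambda>k. 0) = 0" using hom[of 0 "\<lambda>k. 0"] by simp
  have "a 0 * q ?e \<le> q a" if a: "\<forall>k>0. a k = 0" for a
  proof (cases "a 0 \<ge> 0")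
    case True
    have "a = (\<lambda>k. a 0 * ?e k)" using a by auto
    then show ?thesis using hom[OF True, of ?e] by simp
  next
    case False
    have "(\<lambda>k. a k + (- a 0) * ?e k) = (\<lambda>k. 0)" using a by auto
    then have "0 \<le> q a + q (\<lambda>k. (- a 0) * ?e k)" using sub[of a "\<lambda>k. (- a 0) * ?e k"] z by simp
    then show ?thesis using hom[of "- a 0" ?e] False by simp
  qed
  then show ?case by (intro exI[of _ "\<lambda>_. q ?e"]) simp
next
  case (Suc m)
  then obtain x where x0: "x 0 = q (\<lambda>k. if k = 0 then 1 else 0)"
    and x: "\<And>a. \<forall>k>m. a k = 0 \<Longrightarrow> (\<Sum>k\<le>m. a k * x k) \<le> q a" by blast
  let ?e = "\<lambda>k. if k = Suc m then 1 else (0::real)"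
  let ?L = "\<lambda>a. \<Sum>k\<le>m. a k * x k"
  define S where "S = {a :: nat \<Rightarrow> real. \<forall>k>m. a k = 0}"
  let ?f = "\<lambda>a. ?L a - q (\<lambda>k. a k - ?e k)"
  have le: "?f a \<le> q (\<lambda>k. b k + ?e k) - ?L b" if "a \<in> S" "b \<in> S" for a b
  proof -
    have "?L a + ?L b = ?L (\<lambda>k. a k + b k)" by (simp add: sum.distrib algebra_simps)
    also have "\<dots> \<le> q (\<lambda>k. a k + b k)" using that by (intro x) (auto simp: S_def)
    also have "\<dots> = q (\<lambda>k. (a k - ?e k) + (b k + ?e k))" by (simp add: algebra_simps)
    also have "\<dots> \<le> q (\<lambda>k. a k - ?e k) + q (\<lambda>k. b k + ?e k)" by (rule sub)
    finally show ?thesis by linarith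
  qed
  \<comment> \<open>By \<open>le\<close>, any number between the supremum of the left sides and the
    infimum of the right sides is an admissible value on the new coordinate.\<close>
  define y where "y = (SUP a\<in>S. ?f a)"
  have S0: "(\<lambda>k. 0) \<in> S" by (simp add: S_def)
  have bdd: "bdd_above (?f ` S)" using le[OF _ S0] by (intro bdd_aboveI) blast
  have y1: "?f a \<le> y" if "a \<in> S" for a
    unfolding y_def by (rule cSUP_upper[OF that bdd])
  have y2: "y \<le> q (\<lambda>k. b k + ?e k) - ?L b" if "b \<in> S" for b
    unfolding y_def
  proof (rule cSUP_least)
    show "S \<noteq> {}" using S0 by blast
  next
    fix a assume "a \<in> S"
    then show "?f a \<le> q (\<lambda>k. b k + ?e k) - ?L b" using le[of a b] that by blast
  qed
  have "?L c + c (Suc m) * y \<le> q c" if c: "\<forall>k>Suc m. c k = 0" for c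
  proof -
    define t where "t = c (Suc m)"
    define c' where "c' = (\<lambda>k. if k \<le> m then c k else 0)"
    have cS: "(\<lambda>k. u * c' k) \<in> S" for u by (simp add: c'_def S_def)
    have cL: "?L (\<lambda>k. u * c' k) = u * ?L c" for u
      by (simp add: c'_def sum_distrib_left mult_ac)
    have cc: "c k = c' k + t * ?e k" for k
      using c by (auto simp: c'_def t_def not_le) 
    \<comment> \<open>Homogeneity is available for nonnegative factors only, so the sign of
      \<open>t\<close> decides which of the bounds \<open>y1\<close> and \<open>y2\<close> is scaled
      by \<open>\<bar>t\<bar>\<close>.\<close>
    consider "t = 0" | "t > 0" | "t < 0" by linarith
    then have "?L c + t * y \<le> q c"
    proof cases
      case 1
      then show ?thesis using x[of c] c by (metis Suc_lessI add_0_right mult_zero_left t_def)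
    next
      case 2
      have "t * (?L (\<lambda>k. (1/t) * c' k) + y) \<le> t * q (\<lambda>k. (1/t) * c' k + ?e k)"
        using y2[OF cS[of "1/t"]] 2 by (intro mult_left_mono) auto
      also have "\<dots> = q (\<lambda>k. t * ((1/t) * c' k + ?e k))" using 2 by (subst hom) auto
      also have "(\<lambda>k. t * ((1/t) * c' k + ?e k)) = c"
        using 2 by (auto simp: cc algebra_simps)
      finally show ?thesis unfolding cL using 2 by (simp add: algebra_simps)
    next
      case 3
      have "(-t) * (?L (\<lambda>k. (-1/t) * c' k) - y) \<le> (-t) * q (\<lambda>k. (-1/t) * c' k - ?e k)"
        using y1[OF cS[of "-1/t"]] 3 by (intro mult_left_mono) auto
      also have "\<dots> = q (\<lambda>k. (-t) * ((-1/t) * c' k - ?e k))" using 3 by (subst hom) auto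
      also have "(\<lambda>k. (-t) * ((-1/t) * c' k - ?e k)) = c"
        using 3 by (auto simp: cc algebra_simps)
      finally show ?thesis unfolding cL using 3 by (simp add: algebra_simps)
    qed
    then show ?thesis by (simp add: t_def)
  qed
  then show ?case using x0
    by (intro exI[of _ "x(Suc m := y)"]) (simp add: mult.commute)
qed

text \<open>
  The product of two of the sine factors is a trigonometric polynomial of degree one in \<open>\<theta>\<close>, so
  moving it into \<open>y\<close> lowers the degree up to which \<open>y\<close> is orthogonal by one.
\<close>
lemma sum_trig_orthogonal_prod_sin:
  fixes y \<theta> z :: "nat \<Rightarrow> real"
  assumes "\<And>m a. m \<le> l \<Longrightarrow> (\<Sum>k<M. y k * cos (real m * \<theta> k + a)) = 0"
  shows "(\<Sum>k<M. y k * (\<Prod>j<2*l. sin (\<theta> k / 2 - z j))) = 0"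
  using assms
proof (induction l arbitrary: y)
  case 0
  from 0[of 0 0] show ?case by simp
next
  case (Suc l)
  let ?u = "z (2*l)" and ?v = "z (2*l+1)"
  define y' where "y' k = y k * (sin (\<theta> k / 2 - ?u) * sin (\<theta> k / 2 - ?v))" for k
  have "(\<Sum>k<M. y' k * cos (real m * \<theta> k + a)) = 0" if m: "m \<le> l" for m a
  proof -
    have lower: "(\<Sum>k<M. y k * cos (real m * \<theta> k + a - \<theta> k + ?u + ?v)) = 0"
    \<comment> \<open>For \<open>m = 0\<close> the lowered frequency is -1. Evenness of the cosine
      turns it into frequency 1 with another phase.\<close>
    proof (cases m)
      case 0
      have "cos (real m * \<theta> k + a - \<theta> k + ?u + ?v) = cos (real 1 * \<theta> k + (- a - ?u - ?v))" for k
        using 0 cos_minus[of "a - \<theta> k + ?u + ?v"] by (simp add: algebra_simps)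
      then show ?thesis using Suc.prems[of 1 "- a - ?u - ?v"] by simp
    next
      case (Suc m')
      have "real m * \<theta> k + a - \<theta> k + ?u + ?v = real m' * \<theta> k + (a + ?u + ?v)" for k
        using Suc by (simp add: algebra_simps)
      then show ?thesis using Suc.prems[of m' "a + ?u + ?v"] Suc m by (simp only: Suc_leD le_SucI)
    qed
    have upper: "(\<Sum>k<M. y k * cos (real m * \<theta> k + a + \<theta> k - ?u - ?v)) = 0"
    proof -
      have "real m * \<theta> k + a + \<theta> k - ?u - ?v = real (Suc m) * \<theta> k + (a - ?u - ?v)" for k
        by (simp add: algebra_simps)
      then show ?thesis using Suc.prems[of "Suc m" "a - ?u - ?v"] m by (simp only: Suc_le_mono)
    qed
    have "y' k * cos (real m * \<theta> k + a) = cos (?v - ?u) / 2 * (y k * cos (real m * \<theta> k + a))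
        - 1/4 * (y k * cos (real m * \<theta> k + a + \<theta> k - ?u - ?v))
        - 1/4 * (y k * cos (real m * \<theta> k + a - \<theta> k + ?u + ?v))" for k
    proof -
      let ?C = "real m * \<theta> k + a"
      have 1: "sin (\<theta> k / 2 - ?u) * sin (\<theta> k / 2 - ?v) = (cos (?v - ?u) - cos (\<theta> k - ?u - ?v)) / 2"
        unfolding sin_times_sin by (simp add: algebra_simps)
      have 2: "cos ?C * cos (\<theta> k - ?u - ?v) = (cos (?C - (\<theta> k - ?u - ?v)) + cos (?C + (\<theta> k - ?u - ?v))) / 2"
        by (rule cos_times_cos)
      have "y' k * cos ?C = y k * (cos (?v - ?u) * cos ?C - cos ?C * cos (\<theta> k - ?u - ?v)) / 2"
        unfolding y'_def 1 by (simp add: algebra_simps)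
      then show ?thesis unfolding 2 by (simp add: algebra_simps add_divide_distrib diff_divide_distrib)
    qed
    then have "(\<Sum>k<M. y' k * cos (real m * \<theta> k + a)) =
        cos (?v - ?u) / 2 * (\<Sum>k<M. y k * cos (real m * \<theta> k + a))
        - 1/4 * (\<Sum>k<M. y k * cos (real m * \<theta> k + a + \<theta> k - ?u - ?v))
        - 1/4 * (\<Sum>k<M. y k * cos (real m * \<theta> k + a - \<theta> k + ?u + ?v))"
      by (simp only: sum_subtractf sum_distrib_left)
    also have "\<dots> = 0" using Suc.prems[of m a] m upper lower by simp
    finally show ?thesis .
  qed
  from Suc.IH[OF this] show ?case
    by (simp add: y'_def mult_ac)
qed

text \<open>The sampled triangle wave of period \<open>2 * p\<close>, falling from
  \<open>p / 2\<close> at 0 with slope -1 and then rising back with slope 1. It is extremal for the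
  inequality below: its steps have size 1 and its maximum is \<open>p / 2\<close>.\<close>

definition triangle_wave :: "nat \<Rightarrow> nat \<Rightarrow> real" where
  "triangle_wave p k = (-1) ^ (k div p) * (real p / 2 - real (k mod p))"

lemma triangle_wave_shift: "p > 0 \<Longrightarrow> triangle_wave p (k + p) = - triangle_wave p k"
  by (simp add: triangle_wave_def)

lemma triangle_wave_Suc:
  assumes "p > 0"
  shows "triangle_wave p (Suc k) = triangle_wave p k - (-1) ^ (k div p)"
proof (cases "Suc (k mod p) = p")
  case True
  then have "Suc k mod p = 0" "Suc k div p = Suc (k div p)"
    by (simp_all add: mod_Suc div_Suc)
  moreover have "real p = real (k mod p) + 1" using True by linarith
  ultimately show ?thesis by (simp add: triangle_wave_def field_simps)
next
  case False
  then have "Suc k mod p = Suc (k mod p)" "Suc k div p = k div p"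
    by (simp_all add: mod_Suc div_Suc)
  then show ?thesis by (simp add: triangle_wave_def algebra_simps)
qed

lemma sum_shift_periodic:
  fixes f :: "nat \<Rightarrow> 'a::cancel_comm_monoid_add"
  assumes "\<And>k. f (k + M) = f k"
  shows "(\<Sum>k<M. f (k + p)) = (\<Sum>k<M. f k)"
proof (induction p)
  case (Suc p)
  have "(\<Sum>k<M. f (Suc k + p)) + f p = (\<Sum>k<M. f (k + p)) + f (M + p)"
    using sum.lessThan_Suc_shift[of "\<lambda>k. f (k + p)" M] by (simp add: add.commute)
  then show ?case using Suc assms[of p] by (simp add: add.commute)
qed simp

text \<open>A translation by \<open>p\<close> multiplies the wave by -1 and the exponential of
  frequency \<open>m\<close> by \<open>cis (pi * m / n)\<close>, and it preserves sums over a full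
  period. So the sum equals \<open>- cis (pi * m / n)\<close> times itself, and this factor is not 1
  because \<open>m < n\<close> keeps the angle below \<open>pi\<close>.\<close>

lemma triangle_wave_orthogonal:
  assumes n: "n > 0" "p > 0" and m: "m < n"
  shows "(\<Sum>k<2*n*p. triangle_wave p k * cos (real m * (2 * pi * real k / real (2*n*p)) + a)) = 0"
proof -
  let ?M = "2*n*p"
  let ?t = "2 * pi * real m / real ?M"
  define f where "f k = of_real (triangle_wave p k) * cis (?t * real k + a)" for k
  have M0: "real ?M > 0" using n by simp
  have periodic: "triangle_wave p (k + 2 * j * p) = triangle_wave p k" for j k
    using n by (simp add: triangle_wave_def power_add)
  have per: "f (k + ?M) = f k" for k
  proof -
    have "?t * real (k + ?M) + a = ?t * real k + a + 2 * pi * real m"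
    proof -
      have "?t * real ?M = 2 * pi * real m" using n by simp
      moreover have "?t * real (k + ?M) = ?t * real k + ?t * real ?M"
        unfolding of_nat_add by (rule distrib_left)
      ultimately show ?thesis by linarith
    qed
    then have "cis (?t * real (k + ?M) + a) = cis (?t * real k + a) * cis (2 * pi * real m)"
      by (simp only: cis_mult)
    also have "cis (2 * pi * real m) = 1" by (simp add: cis_multiple_2pi)
    finally show ?thesis unfolding f_def by (simp add: periodic)
  qed
  have shift: "f (k + p) = - cis (pi * real m / real n) * f k" for k
  proof -
    have "?t * real (k + p) + a = pi * real m / real n + (?t * real k + a)"
      using n by (simp add: field_simps)
    then have cis: "cis (?t * real (k + p) + a) = cis (pi * real m / real n) * cis (?t * real k + a)"
      by (simp only: cis_mult)
    show ?thesis unfolding f_def cis triangle_wave_shift[OF n(2)] of_real_minus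
      by (simp only: mult_minus_left mult_minus_right mult_ac)
  qed
  have "(\<Sum>k<?M. f k) = - cis (pi * real m / real n) * (\<Sum>k<?M. f k)"
    unfolding sum_distrib_left shift[symmetric] by (rule sum_shift_periodic[of f ?M p, OF per, symmetric])
  moreover have "(1 + c) * S = S - (- c * S)" for c S :: complex
    by (simp add: algebra_simps)
  ultimately have "(1 + cis (pi * real m / real n)) * (\<Sum>k<?M. f k) = 0"
    by (simp only: right_minus_eq)
  moreover have "1 + cis (pi * real m / real n) \<noteq> 0"
  proof
    assume "1 + cis (pi * real m / real n) = 0"
    then have "Re (1 + cis (pi * real m / real n)) = Re 0" by (rule arg_cong)
    then have *: "cos (pi * real m / real n) = cos pi" by simp
    have "pi * real m / real n < pi" using m n pi_gt_zero by (simp add: field_simps)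
    then have "cos pi < cos (pi * real m / real n)" by (intro cos_monotone_0_pi) auto
    with * show False by simp
  qed
  ultimately have "(\<Sum>k<?M. f k) = 0" by simp
  then have "Re (\<Sum>k<?M. f k) = 0" by simp
  then show ?thesis by (simp add: f_def mult_ac)
qed

text \<open>This locates the only sign change of a decreasing piece. The extreme values 0 and
  \<open>p\<close> of \<open>w\<close> stand for a piece that is entirely negative or entirely
  nonnegative.\<close>

lemma strict_antimono_threshold:
  fixes g :: "nat \<Rightarrow> real"
  assumes dec: "\<And>r. Suc r < p \<Longrightarrow> g (Suc r) < g r"
  shows "\<exists>w\<le>p. \<forall>r<p. 0 \<le> g r \<longleftrightarrow> r < w"
proof -
  define w where "w = (LEAST r. p \<le> r \<or> g r < 0)"
  have "w \<le> p" unfolding w_def by (rule Least_le) simp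
  have w: "p \<le> w \<or> g w < 0" unfolding w_def by (rule LeastI[of _ p]) simp
  have "0 \<le> g r \<longleftrightarrow> r < w" if r: "r < p" for r
  proof (cases "r < w")
    case True
    then show ?thesis using not_less_Least[of r "\<lambda>r. p \<le> r \<or> g r < 0"] by (simp add: w_def)
  next
    case False
    then have "w \<le> r" by simp
    then have "g r \<le> g w" using r
    proof (induction r rule: dec_induct)
      case (step k)
      then show ?case using dec[of k] by simp
    qed simp
    then show ?thesis using w False r by simp
  qed
  with \<open>w \<le> p\<close> show ?thesis by blast
qed

text \<open>
  The difference \<open>y\<close> below is strictly monotone on each of the \<open>2n\<close> monotone pieces of the triangle
  wave, so it changes its sign at most once there, between \<open>c j - 1\<close> and \<open>c j\<close> on the piece with number
  \<open>j + 1\<close>. It has no sign change on the first and on the last piece, because \<open>y 0 < 0\<close>.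
\<close>
lemma discrete_bohr:
  fixes x :: "nat \<Rightarrow> real"
  assumes n: "n > 0" and p: "p > 0"
    and orth: "\<And>m a. m < n \<Longrightarrow>
      (\<Sum>k<2*n*p. x k * cos (real m * (2 * pi * real k / real (2*n*p)) + a)) = 0"
    and step: "\<And>k. k < 2*n*p \<Longrightarrow> \<bar>x (Suc k) - x k\<bar> \<le> D"
    and per: "x (2*n*p) = x 0"
  shows "x 0 \<le> real p / 2 * D"
proof (rule ccontr)
  assume "\<not> ?thesis"
  then have x0: "x 0 > real p / 2 * D" by simp
  define M where "M = 2*n*p"
  have M0: "M > 0" using n p by (simp add: M_def)
  have D0: "D \<ge> 0" using step[of 0] n p by auto
  define d where "d = 2 * x 0 / real p"
  have d: "D < d" using x0 p by (simp add: d_def field_simps)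
  \<comment> \<open>The reciprocal of \<open>\<alpha>\<close> is the midpoint of \<open>D\<close>
    and \<open>d\<close>, so both \<open>\<alpha> * D < 1\<close> and
    \<open>\<alpha> * d > 1\<close> are strict, also for \<open>D = 0\<close>.\<close>
  define \<alpha> where "\<alpha> = 2 / (D + d)"
  have \<alpha>0: "\<alpha> > 0" using d D0 by (simp add: \<alpha>_def)
  have \<alpha>D: "\<alpha> * D < 1" using d D0 by (simp add: \<alpha>_def field_simps)
  have \<alpha>x: "real p / 2 < \<alpha> * x 0"
  proof -
    have "\<alpha> * x 0 = real p * (d / (D + d))" using p by (simp add: \<alpha>_def d_def)
    moreover have "1 / 2 < d / (D + d)" using d D0 by (simp add: field_simps)
    ultimately show ?thesis
      using mult_strict_left_mono[of "1 / 2" "d / (D + d)" "real p"] p by simp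
  qed
  define y where "y k = triangle_wave p k - \<alpha> * x k" for k
  define \<theta> where "\<theta> k = 2 * pi * real k / real M" for k
  have y0: "y 0 < 0" using \<alpha>x by (simp add: y_def triangle_wave_def)
  have yM: "y M = y 0" using p by (simp add: y_def triangle_wave_def M_def per)
  have y_orth: "(\<Sum>k<M. y k * cos (real m * \<theta> k + a)) = 0" if "m < n" for m a
  proof -
    have "(\<Sum>k<M. y k * cos (real m * \<theta> k + a)) =
        (\<Sum>k<M. triangle_wave p k * cos (real m * \<theta> k + a)) - \<alpha> * (\<Sum>k<M. x k * cos (real m * \<theta> k + a))"
      by (simp only: y_def left_diff_distrib sum_subtractf sum_distrib_left mult.assoc)
    then show ?thesis
      using triangle_wave_orthogonal[OF n p that, of a] orth[OF that, of a]
      by (simp only: M_def \<theta>_def)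
  qed
  \<comment> \<open>In each step the wave moves by exactly 1 and \<open>\<alpha> * x\<close> by less
    than 1, so the wave decides the direction of \<open>y\<close>.\<close>
  have decr: "(-1) ^ (k div p) * y (Suc k) < (-1) ^ (k div p) * y k" if "k < M" for k
  proof -
    let ?s = "(-1) ^ (k div p) :: real"
    have s: "?s * ?s = 1" by (metis power2_eq_square power_minus1_even power_mult mult.commute)
    have "\<bar>?s * (\<alpha> * (x (Suc k) - x k))\<bar> \<le> \<alpha> * D"
      using step[of k] that \<alpha>0 by (simp add: abs_mult M_def)
    then have "- (?s * (\<alpha> * (x (Suc k) - x k))) < 1" using \<alpha>D by linarith
    moreover have "?s * y (Suc k) - ?s * y k = - (?s * ?s) - ?s * (\<alpha> * (x (Suc k) - x k))"
      using p by (simp add: y_def triangle_wave_Suc algebra_simps)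
    ultimately show ?thesis using s by simp
  qed
  \<comment> \<open>The sign is flipped on the odd pieces, where the wave rises, so that every
    \<open>g J\<close> is decreasing.\<close>
  define g where "g J r = (-1) ^ J * y (J * p + r)" for J r
  have "\<exists>w\<le>p. \<forall>r<p. 0 \<le> g J r \<longleftrightarrow> r < w" if "J < 2*n" for J
  proof (rule strict_antimono_threshold)
    fix r assume r: "Suc r < p"
    have "J * p + r < M"
    proof -
      have "J * p + r < Suc J * p" using r by simp
      also have "\<dots> \<le> M" unfolding M_def using that by (intro mult_right_mono) auto
      finally show ?thesis .
    qed
    from decr[OF this] show "g J (Suc r) < g J r" using r by (simp add: g_def)
  qed
  then obtain w where w: "\<And>J. J < 2*n \<Longrightarrow> w J \<le> p"
    and gw: "\<And>J r. J < 2*n \<Longrightarrow> r < p \<Longrightarrow> 0 \<le> g J r \<longleftrightarrow> r < w J" by metis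
  \<comment> \<open>The \<open>2 * l\<close> interior pieces give as many sine factors, hence a
    trigonometric polynomial of degree \<open>l = n - 1\<close>, the largest degree up to which
    \<open>y\<close> is known to be orthogonal.\<close>
  define l where "l = n - 1"
  have ln: "2 * n = 2 * l + 2" using n by (simp add: l_def)
  define c where "c j = Suc j * p + w (Suc j)" for j
  \<comment> \<open>The zero of factor \<open>j\<close> lies halfway between the samples
    \<open>c j - 1\<close> and \<open>c j\<close>, so no factor vanishes at a sample. Because of the
    half angle, a factor changes its sign only once during a full turn.\<close>
  define z where "z j = pi * (real (c j) - 1/2) / real M" for j
  define f where "f k j = sin (\<theta> k / 2 - z j)" for k j
  have arg: "\<theta> k / 2 - z j = pi * ((real k - (real (c j) - 1/2)) / real M)" for k j
  proof -
    have "\<theta> k / 2 = pi * (real k / real M)" "z j = pi * ((real (c j) - 1/2) / real M)"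
      by (simp_all add: \<theta>_def z_def)
    then show ?thesis
      by (simp only: right_diff_distrib[symmetric] diff_divide_distrib[symmetric])
  qed
  have c_bounds: "p \<le> c j" "c j \<le> M" if "j < 2 * l" for j
  proof -
    show "p \<le> c j" by (simp add: c_def)
    have "c j \<le> Suc (Suc j) * p" using w[of "Suc j"] that ln by (simp add: c_def)
    also have "\<dots> \<le> M" unfolding M_def using that ln by (intro mult_right_mono) auto
    finally show "c j \<le> M" .
  qed
  have f_neg: "f k j < 0" if "j < 2 * l" "k < c j" for k j
  proof -
    have "pi * ((real (c j) - 1/2 - real k) / real M) > 0"
      using that M0 by (intro mult_pos_pos divide_pos_pos) auto
    moreover have "pi * ((real (c j) - 1/2 - real k) / real M) < pi * 1"
      using c_bounds[OF that(1)] M0 by (intro mult_strict_left_mono) auto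
    ultimately have "sin (pi * ((real (c j) - 1/2 - real k) / real M)) > 0"
      by (intro sin_gt_zero) auto
    moreover have "pi * ((real (c j) - 1/2 - real k) / real M) = - (\<theta> k / 2 - z j)"
      by (simp only: arg mult_minus_right[symmetric] minus_divide_left minus_diff_eq)
    ultimately have "- f k j > 0" by (simp only: f_def sin_minus)
    then show ?thesis by simp
  qed
  have f_pos: "f k j > 0" if "j < 2 * l" "c j \<le> k" "k < M" for k j
  proof -
    have "\<theta> k / 2 - z j > 0" unfolding arg
      using that M0 by (intro mult_pos_pos divide_pos_pos) auto
    moreover have "pi * ((real k - (real (c j) - 1/2)) / real M) < pi * 1"
      using c_bounds[OF that(1)] M0 p that by (intro mult_strict_left_mono) auto
    ultimately show ?thesis unfolding f_def by (intro sin_gt_zero) (auto simp: arg)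
  qed
  define P where "P k = (\<Prod>j<2*l. f k j)" for k
  \<comment> \<open>On the first piece all factors of \<open>P\<close> are negative and their number
    is even. There \<open>y\<close> decreases from \<open>y 0 < 0\<close>.\<close>
  have first: "P k > 0 \<and> y k < 0" if "k < p" for k
  proof
    have "0 \<le> g 0 0 \<longleftrightarrow> 0 < w 0" using gw[of 0 0] n p by simp
    then have "w 0 = 0" using y0 by (simp add: g_def)
    then show "y k < 0" using gw[of 0 k] n that by (simp add: g_def)
    have "(\<Prod>j<2*l. - f k j) > 0"
      using c_bounds that by (intro prod_pos) (auto intro!: f_neg intro: less_le_trans)
    then show "P k > 0" by (simp add: P_def prod_uminus)
  qed
  \<comment> \<open>On the last piece \<open>y\<close> rises towards \<open>y M = y 0 < 0\<close>,
    so the induction runs backwards from \<open>M\<close>.\<close>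
  have last: "y k < 0" if "(2*n-1)*p \<le> k" "k < M" for k
  proof -
    have "k \<le> M" using that by simp
    then have "y k \<le> y M"  using that(1)
    proof (induction k rule: inc_induct)
      case (step k)
      have "k div p = 2*n-1"
        using step.hyps step.prems p unfolding M_def
        by (intro div_nat_eqI) (auto simp: algebra_simps diff_mult_distrib)
      then have "(-1) ^ (k div p) = (-1::real)" using n by simp
      then have "y k < y (Suc k)" using decr[OF step.hyps(2)] by simp
      then show ?case using step by simp
    qed simp
    then show ?thesis using yM y0 by simp
  qed
  have le: "y k * P k \<le> 0" if k: "k < M" for k
  proof -
    define J where "J = k div p"
    define r where "r = k mod p"
    have kJr: "k = J * p + r" by (simp add: J_def r_def)
    have r: "r < p" using p by (simp add: r_def)
    have J: "J < 2*n" using k by (simp add: J_def M_def less_mult_imp_div_less)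
    consider "J = 0" | "J = 2*l+1" | J' where "J = Suc J'" "J' < 2*l"
      using J ln by (cases J) (auto simp: less_Suc_eq)
    then show ?thesis
    proof cases
      case 1
      then show ?thesis using first[of k] kJr r by (simp add: mult_nonpos_nonneg)
    next
      case 2
      then have "(2*n-1)*p \<le> k" using kJr ln by simp
      then have y: "y k < 0" using last k by blast
      have "c j \<le> k" if "j < 2*l" for j
      proof -
        have "c j \<le> Suc (Suc j) * p" using w[of "Suc j"] that ln by (simp add: c_def)
        also have "\<dots> \<le> J * p" using that 2 by (intro mult_right_mono) auto
        finally show ?thesis using kJr by simp
      qed
      then have "P k > 0" unfolding P_def using k by (intro prod_pos) (auto intro!: f_pos)
      then show ?thesis using y by (simp add: mult_nonpos_nonneg)
    next
      \<comment> \<open>The factors before \<open>J'\<close> are positive. The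
        \<open>2 * l - J\<close> factors after it are negative, so their product has the sign
        \<open>(-1) ^ J\<close>, which is the flip built into \<open>g\<close>. Factor
        \<open>J'\<close> turns positive exactly where \<open>g J\<close> turns negative.\<close>
      case 3
      have lower: "c j \<le> k" if "j < J'" for j
      proof -
        have "c j \<le> Suc (Suc j) * p" using w[of "Suc j"] that 3 ln by (simp add: c_def)
        also have "\<dots> \<le> J * p" using that 3 by (intro mult_right_mono) auto
        finally show ?thesis using kJr by simp
      qed
      have upper: "k < c j" if "J' < j" for j
      proof -
        have "k < Suc J * p" using kJr r by simp
        also have "\<dots> \<le> Suc j * p" using that 3 by (intro mult_right_mono) auto
        finally show ?thesis by (simp add: c_def)
      qed
      define A where "A = (\<Prod>j<J'. f k j)"
      define B where "B = (\<Prod>j\<in>{J'<..<2*l}. - f k j)"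
      have A: "A > 0" unfolding A_def using 3 lower k by (intro prod_pos) (auto intro!: f_pos)
      have B: "B > 0" unfolding B_def using upper by (intro prod_pos) (auto intro!: f_neg)
      have set_eq: "{..<2*l} = insert J' ({..<J'} \<union> {J'<..<2*l})" using 3 by auto
      have "even (2*l - Suc J') \<longleftrightarrow> even J" using 3 by simp
      then have sgn: "(-1::real) ^ (2*l - Suc J') = (-1) ^ J"
        by (simp add: minus_one_power_iff)
      have sgn2: "(-1::real) ^ J * (-1) ^ J = 1"
        by (simp add: power_mult_distrib[symmetric])
      have "B = (-1) ^ J * (\<Prod>j\<in>{J'<..<2*l}. f k j)"
        by (simp add: B_def prod_uminus sgn)
      then have "(\<Prod>j\<in>{J'<..<2*l}. f k j) = (-1) ^ J * B"
        using sgn2 by (simp add: mult.assoc[symmetric])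
      moreover have "P k = f k J' * (A * (\<Prod>j\<in>{J'<..<2*l}. f k j))"
        unfolding P_def set_eq A_def by (subst prod.insert) (auto intro!: prod.union_disjoint)
      ultimately have Py: "y k * P k = A * B * (f k J' * g J r)"
        by (simp add: g_def kJr mult_ac)
      have ck: "c J' \<le> k \<longleftrightarrow> w J \<le> r" using 3 kJr by (simp add: c_def)
      have "f k J' * g J r \<le> 0"
      proof (cases "r < w J")
        case True
        then have "f k J' < 0" using ck 3 by (intro f_neg) auto
        moreover have "g J r \<ge> 0" using gw J r True by blast
        ultimately show ?thesis by (simp add: mult_nonpos_nonneg)
      next
        case False
        then have "f k J' > 0" using ck 3 k by (intro f_pos) auto
        moreover have "g J r < 0" using gw[OF J r] False by simp
        ultimately show ?thesis by (simp add: mult_nonneg_nonpos)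
      qed
      then show ?thesis unfolding Py using A B by (simp add: mult_nonneg_nonpos)
    qed
  qed
  \<comment> \<open>Strictness comes from the sample 0, where \<open>first\<close> gives
    \<open>y\<close> and \<open>P\<close> strict opposite signs.\<close>
  have "(\<Sum>k<M. y k * P k) < (\<Sum>k<M. 0)"
    using le first[OF p] M0
    by (intro sum_strict_mono_ex1) (auto intro!: bexI[of _ 0] mult_neg_pos)
  moreover have "(\<Sum>k<M. y k * P k) = 0"
    unfolding P_def f_def
    by (rule sum_trig_orthogonal_prod_sin) (use y_orth n in \<open>auto simp: l_def\<close>)
  ultimately show False by simp
qed

text \<open>For vectors \<open>F\<^sub>k\<close> this is applied to \<open>q a = \<parallel>\<Sum>\<^sub>k a\<^sub>k F\<^sub>k\<parallel>\<close>.\<close>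
lemma sublinear_bohr:
  fixes q :: "(nat \<Rightarrow> real) \<Rightarrow> real"
  assumes sub: "\<And>a b. q (\<lambda>k. a k + b k) \<le> q a + q b"
    and hom: "\<And>c a. c \<ge> 0 \<Longrightarrow> q (\<lambda>k. c * a k) = c * q a"
    and n: "n > 0" and p: "p > 0" and M: "M = 2*n*p"
    and low: "\<And>m a. m < n \<Longrightarrow>
      q (\<lambda>k. if k < M then cos (real m * (2 * pi * real k / real M) + a) else 0) \<le> 0"
    and step: "\<And>k. k < M \<Longrightarrow> q (\<lambda>i. of_bool (i = Suc k mod M) - of_bool (i = k)) \<le> D"
      "\<And>k. k < M \<Longrightarrow> q (\<lambda>i. of_bool (i = k) - of_bool (i = Suc k mod M)) \<le> D"
  shows "q (\<lambda>k. of_bool (k = 0)) \<le> real p / 2 * D"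
proof -
  have M0: "M > 0" using n p M by simp
  obtain x where x0: "x 0 = q (\<lambda>k. of_bool (k = 0))"
    and x: "\<And>a. (\<And>k. k \<ge> M \<Longrightarrow> a k = 0) \<Longrightarrow> (\<Sum>k<M. a k * x k) \<le> q a"
  proof -
    have set_eq: "{..M - 1} = {..<M}" using M0 by auto
    have "k > M - 1 \<longleftrightarrow> k \<ge> M" for k using M0 by auto
    then obtain x where x0: "x 0 = q (\<lambda>k. if k = 0 then 1 else 0)"
      and x: "\<And>a. (\<And>k. k \<ge> M \<Longrightarrow> a k = 0) \<Longrightarrow> (\<Sum>k<M. a k * x k) \<le> q a"
      using finite_hahn_banach[of q "M - 1", OF sub hom] unfolding set_eq by metis
    show thesis
    proof (rule that)
      show "x 0 = q (\<lambda>k. of_bool (k = 0))" using x0 by (simp add: of_bool_def)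
    qed (rule x)
  qed
  \<comment> \<open>Only the coordinates below \<open>M\<close> are controlled by \<open>q\<close>;
    coordinate \<open>M\<close> is reset so that the sequence closes up cyclically.\<close>
  define X where "X = x(M := x 0)"
  have "X 0 \<le> real p / 2 * D"
  proof (rule discrete_bohr[OF n p])
    fix m a assume m: "m < n"
    let ?c = "\<lambda>a k. cos (real m * (2 * pi * real k / real M) + a)"
    have "(\<Sum>k<M. X k * ?c a k) \<le> 0" for a
    proof -
      have "(\<Sum>k<M. X k * ?c a k) = (\<Sum>k<M. (if k < M then ?c a k else 0) * x k)"
        by (intro sum.cong) (auto simp: X_def)
      also have "\<dots> \<le> q (\<lambda>k. if k < M then ?c a k else 0)" by (rule x) simp
      finally show ?thesis using low[OF m, of a] by simp
    qed
    \<comment> \<open>The phase \<open>a + pi\<close> negates the cosine, so the one-sided bound at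
      both phases gives equality.\<close>
    from this[of a] this[of "a + pi"] have "(\<Sum>k<M. X k * ?c a k) = 0"
      by (simp add: add.assoc[symmetric] sum_negf)
    then show "(\<Sum>k<2*n*p. X k * cos (real m * (2 * pi * real k / real (2*n*p)) + a)) = 0"
      by (simp only: M)
  next
    fix k assume "k < 2*n*p"
    then have k: "k < M" by (simp add: M)
    have sum_bool: "(\<Sum>i<M. of_bool (i = j) * x i) = x j" if "j < M" for j
      using that by (simp add: of_bool_def if_distrib[of "\<lambda>c. c * _"] sum.delta cong: if_cong)
    have X: "X k = x k" "X (Suc k) = x (Suc k mod M)"
      using k by (auto simp: X_def mod_Suc)
    have lt: "Suc k mod M < M" using M0 by simp
    have "x (Suc k mod M) - x k \<le> D"
      using x[of "\<lambda>i. of_bool (i = Suc k mod M) - of_bool (i = k)"] step(1)[OF k] k lt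
      by (simp add: left_diff_distrib sum_subtractf sum_bool)
    moreover have "x k - x (Suc k mod M) \<le> D"
      using x[of "\<lambda>i. of_bool (i = k) - of_bool (i = Suc k mod M)"] step(2)[OF k] k lt
      by (simp add: left_diff_distrib sum_subtractf sum_bool)
    ultimately show "\<bar>X (Suc k) - X k\<bar> \<le> D" unfolding X by linarith
  next
    show "X (2*n*p) = X 0" using M0 by (simp add: X_def M)
  qed
  then show ?thesis using M0 by (simp add: X_def x0)
qed

section \<open>Unitarily invariant norms and Schur multipliers\<close>

lemma mat_adjoint_eq_mat:
  fixes A :: "complex mat"
  shows "mat_adjoint A = mat (dim_col A) (dim_row A) (\<lambda>(i, j). cnj (A $$ (j, i)))"
  by (rule eq_matI) (auto simp: mat_adjoint_def mat_of_rows_def)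

lemma mat_adjoint_simps [simp]:
  fixes A :: "complex mat"
  shows "dim_row (mat_adjoint A) = dim_col A" "dim_col (mat_adjoint A) = dim_row A"
    "i < dim_col A \<Longrightarrow> j < dim_row A \<Longrightarrow> mat_adjoint A $$ (i, j) = cnj (A $$ (j, i))"
    "mat_adjoint (mat_adjoint A) = A"
    "A \<in> carrier_mat p q \<Longrightarrow> mat_adjoint A \<in> carrier_mat q p"
  by (auto simp: mat_adjoint_eq_mat intro!: eq_matI)

lemma mat_adjoint_mult:
  fixes A B :: "complex mat"
  assumes "A \<in> carrier_mat m n" "B \<in> carrier_mat n k"
  shows "mat_adjoint (A * B) = mat_adjoint B * mat_adjoint A"
  using assms by (intro eq_matI) (auto simp: scalar_prod_def cnj_sum mult.commute)

lemma mat_adjoint_one [simp]: "mat_adjoint (1\<^sub>m n :: complex mat) = 1\<^sub>m n"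
  by (rule eq_matI) auto

lemma mat_adjoint_four_block:
  fixes A B C D :: "complex mat"
  assumes "A \<in> carrier_mat m1 n1" "B \<in> carrier_mat m1 n2" "C \<in> carrier_mat m2 n1" "D \<in> carrier_mat m2 n2"
  shows "mat_adjoint (four_block_mat A B C D) =
    four_block_mat (mat_adjoint A) (mat_adjoint C) (mat_adjoint B) (mat_adjoint D)"
  using assms by (intro eq_matI) auto

lemma unitary_matI:
  "U \<in> carrier_mat n n \<Longrightarrow> mat_adjoint U * U = 1\<^sub>m n \<Longrightarrow> unitary_mat U"
  by (auto simp: unitary_mat_def)

lemma unitary_matD:
  assumes "unitary_mat U" "U \<in> carrier_mat n n"
  shows "mat_adjoint U * U = 1\<^sub>m n" "U * mat_adjoint U = 1\<^sub>m n"
proof -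
  show 1: "mat_adjoint U * U = 1\<^sub>m n" using assms by (auto simp: unitary_mat_def)
  show "U * mat_adjoint U = 1\<^sub>m n"
    by (rule mat_mult_left_right_inverse[OF _ _ 1]) (use assms in auto)
qed

lemma unitary_mat_adjoint:
  assumes "unitary_mat U" "U \<in> carrier_mat n n"
  shows "unitary_mat (mat_adjoint U)"
  using unitary_matD[OF assms] assms by (intro unitary_matI[of _ n]) auto

lemma unitary_mat_one [simp]: "unitary_mat (1\<^sub>m n)"
  by (intro unitary_matI[of _ n]) auto

lemma unitary_mat_mult:
  assumes U: "unitary_mat U" "U \<in> carrier_mat n n" and V: "unitary_mat V" "V \<in> carrier_mat n n"
  shows "unitary_mat (U * V)"
proof (rule unitary_matI)
  have "mat_adjoint (U * V) * (U * V) = mat_adjoint V * mat_adjoint U * (U * V)"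
    using mat_adjoint_mult[OF U(2) V(2)] by simp
  also have "\<dots> = mat_adjoint V * (mat_adjoint U * U * V)"
    using U V by (simp add: assoc_mult_mat[of _ n n _ n _ n])
  also have "\<dots> = 1\<^sub>m n" using unitary_matD[OF U] unitary_matD[OF V] V by simp
  finally show "mat_adjoint (U * V) * (U * V) = 1\<^sub>m n" .
qed (use U V in auto)

lemma mat_adjoint_mat_diag: "mat_adjoint (mat_diag n f) = mat_diag n (\<lambda>i. cnj (f i))"
  by (rule eq_matI) (auto simp: mat_diag_def)

lemma unitary_mat_diag_cis: "unitary_mat (mat_diag n (\<lambda>i. cis (f i)))"
  by (intro unitary_matI[of _ n]) (auto simp: mat_adjoint_mat_diag cis_cnj cis_mult)

section \<open>Invariance, diagonal contractions and continuity of a unitarily invariant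
  norm\<close>

context
  fixes N :: "complex mat \<Rightarrow> real"
  assumes ui: "unitarily_invariant_norm N"
begin

lemma ui_norm_zero [simp]: "N (0\<^sub>m p q) = 0"
  using ui unfolding unitarily_invariant_norm_def by (metis zero_carrier_mat)

lemma ui_norm_smult: "N (c \<cdot>\<^sub>m B) = cmod c * N B"
  using ui unfolding unitarily_invariant_norm_def by blast

lemma ui_norm_triangle: "B \<in> carrier_mat p q \<Longrightarrow> C \<in> carrier_mat p q \<Longrightarrow> N (B + C) \<le> N B + N C"
  using ui unfolding unitarily_invariant_norm_def by blast

lemma ui_norm_uminus: "N (- B) = N B"
proof -
  have "- B = (-1) \<cdot>\<^sub>m B" by (rule eq_matI) auto
  then show ?thesis using ui_norm_smult[of "-1" B] by simp
qed

lemma ui_norm_pad: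
  "B \<in> carrier_mat p q \<Longrightarrow> N (four_block_mat B (0\<^sub>m p l) (0\<^sub>m k q) (0\<^sub>m k l)) = N B"
  using ui unfolding unitarily_invariant_norm_def by blast

lemma ui_norm_unitary:
  assumes "B \<in> carrier_mat p q" "P \<in> carrier_mat p p" "unitary_mat P" "Q \<in> carrier_mat q q" "unitary_mat Q"
  shows "N (P * B * Q) = N B"
proof -
  have "N (mat_adjoint (mat_adjoint P) * B * Q) = N B"
    using ui assms unitary_mat_adjoint[OF assms(3,2)] mat_adjoint_simps(5)[OF assms(2)]
    unfolding unitarily_invariant_norm_def by blast
  then show ?thesis by simp
qed

lemma ui_norm_unitary_left:
  assumes "B \<in> carrier_mat p q" "P \<in> carrier_mat p p" "unitary_mat P"
  shows "N (P * B) = N B"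
  using ui_norm_unitary[OF assms one_carrier_mat unitary_mat_one] assms by simp

lemma ui_norm_unitary_right:
  assumes "B \<in> carrier_mat p q" "Q \<in> carrier_mat q q" "unitary_mat Q"
  shows "N (B * Q) = N B"
  using ui_norm_unitary[OF assms(1) one_carrier_mat unitary_mat_one assms(2,3)] assms by simp

lemma ui_norm_mat_cis:
  assumes B: "B \<in> carrier_mat p q"
  shows "N (mat p q (\<lambda>(i, j). cis (f i) * B $$ (i, j) * cis (g j))) = N B"
proof -
  let ?P = "mat_diag p (\<lambda>i. cis (f i))" and ?Q = "mat_diag q (\<lambda>i. cis (g i))"
  have "mat p q (\<lambda>(i, j). cis (f i) * B $$ (i, j) * cis (g j)) = ?P * B * ?Q"
    using B by (subst mat_diag_mult_left[OF B], subst mat_diag_mult_right[of _ p]) auto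
  then show ?thesis using ui_norm_unitary[OF B _ unitary_mat_diag_cis _ unitary_mat_diag_cis] by simp
qed

text \<open>A real diagonal contraction is the average of two unitary diagonal matrices.\<close>
lemma ui_norm_diag_mult_le:
  assumes B: "B \<in> carrier_mat p q" and "\<sigma> \<ge> 0"
    and f: "\<And>i. i < p \<Longrightarrow> \<bar>f i\<bar> \<le> \<sigma>"
  shows "N (mat_diag p (\<lambda>i. of_real (f i)) * B) \<le> \<sigma> * N B"
proof (cases "\<sigma> = 0")
  case True
  then have "mat_diag p (\<lambda>i. of_real (f i)) * B = 0\<^sub>m p q"
    using f B by (subst mat_diag_mult_left[OF B]) auto
  then show ?thesis using True by simp
next
  case False
  then have \<sigma>: "\<sigma> > 0" using assms by simp
  define \<phi> where "\<phi> i = arccos (f i / \<sigma>)" for i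
  have \<phi>: "complex_of_real (f i) = \<sigma> / 2 * (cis (\<phi> i) + cis (- \<phi> i))" if "i < p" for i
  proof -
    have "cos (\<phi> i) = f i / \<sigma>" unfolding \<phi>_def
      using f[OF that] \<sigma> by (intro cos_arccos) (auto simp: field_simps abs_le_iff)
    then show ?thesis using \<sigma> by (simp add: complex_eq_iff)
  qed
  let ?U = "mat_diag p (\<lambda>i. cis (\<phi> i))" and ?V = "mat_diag p (\<lambda>i. cis (- \<phi> i))"
  have "mat_diag p (\<lambda>i. of_real (f i)) * B =
      complex_of_real (\<sigma> / 2) \<cdot>\<^sub>m (?U * B) + complex_of_real (\<sigma> / 2) \<cdot>\<^sub>m (?V * B)"
    using B by (simp add: mat_diag_mult_left[OF B]) (rule eq_matI, auto simp: \<phi> algebra_simps)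
  also have "N \<dots> \<le> N (complex_of_real (\<sigma> / 2) \<cdot>\<^sub>m (?U * B)) + N (complex_of_real (\<sigma> / 2) \<cdot>\<^sub>m (?V * B))"
    by (intro ui_norm_triangle[of _ p q] smult_carrier_mat mult_carrier_mat[OF mat_diag_dim B])
  also have "\<dots> = \<sigma> * N B"
    using \<sigma> ui_norm_unitary_left[OF B mat_diag_dim unitary_mat_diag_cis]
    by (simp add: ui_norm_smult del: of_real_divide)
  finally show ?thesis .
qed

lemma ui_norm_mult_diag_le:
  assumes B: "B \<in> carrier_mat p q" and "\<sigma> \<ge> 0"
    and f: "\<And>i. i < q \<Longrightarrow> \<bar>f i\<bar> \<le> \<sigma>"
  shows "N (B * mat_diag q (\<lambda>i. of_real (f i))) \<le> \<sigma> * N B"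
proof (cases "\<sigma> = 0")
  case True
  then have "B * mat_diag q (\<lambda>i. of_real (f i)) = 0\<^sub>m p q"
    using f B by (subst mat_diag_mult_right[OF B]) auto
  then show ?thesis using True by simp
next
  case False
  then have \<sigma>: "\<sigma> > 0" using assms by simp
  define \<phi> where "\<phi> i = arccos (f i / \<sigma>)" for i
  have \<phi>: "complex_of_real (f i) = \<sigma> / 2 * (cis (\<phi> i) + cis (- \<phi> i))" if "i < q" for i
  proof -
    have "cos (\<phi> i) = f i / \<sigma>" unfolding \<phi>_def
      using f[OF that] \<sigma> by (intro cos_arccos) (auto simp: field_simps abs_le_iff)
    then show ?thesis using \<sigma> by (simp add: complex_eq_iff)
  qed
  let ?U = "mat_diag q (\<lambda>i. cis (\<phi> i))" and ?V = "mat_diag q (\<lambda>i. cis (- \<phi> i))"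
  have "B * mat_diag q (\<lambda>i. of_real (f i)) =
      complex_of_real (\<sigma> / 2) \<cdot>\<^sub>m (B * ?U) + complex_of_real (\<sigma> / 2) \<cdot>\<^sub>m (B * ?V)"
    using B by (simp add: mat_diag_mult_right[OF B]) (rule eq_matI, auto simp: \<phi> algebra_simps)
  also have "N \<dots> \<le> N (complex_of_real (\<sigma> / 2) \<cdot>\<^sub>m (B * ?U)) + N (complex_of_real (\<sigma> / 2) \<cdot>\<^sub>m (B * ?V))"
    by (intro ui_norm_triangle[of _ p q] smult_carrier_mat mult_carrier_mat[OF B mat_diag_dim])
  also have "\<dots> = \<sigma> * N B"
    using \<sigma> ui_norm_unitary_right[OF B mat_diag_dim unitary_mat_diag_cis]
    by (simp add: ui_norm_smult del: of_real_divide)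
  finally show ?thesis .
qed

text \<open>Expansion into matrix units. The norms of the units do not depend on \<open>f\<close>,
  so small entries force a small norm; this is the continuity that the limit in \<open>k\<close>
  requires.\<close>

lemma ui_norm_le_sum_entries:
  "N (mat p q f) \<le> (\<Sum>x\<in>{..<p} \<times> {..<q}. cmod (f x) * N (mat p q (\<lambda>y. of_bool (y = x))))"
proof -
  have *: "N (mat p q (\<lambda>y. if y \<in> I then f y else 0)) \<le>
      (\<Sum>x\<in>I. cmod (f x) * N (mat p q (\<lambda>y. of_bool (y = x))))" if "finite I" for I
    using that
  proof (induction I)
    case empty
    have "mat p q (\<lambda>y. if y \<in> {} then f y else 0) = 0\<^sub>m p q" by (rule eq_matI) auto
    then show ?case by simp
  next
    case (insert x I)
    let ?E = "mat p q (\<lambda>y. of_bool (y = x) :: complex)" and ?M = "mat p q (\<lambda>y. if y \<in> I then f y else 0)"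
    have "mat p q (\<lambda>y. if y \<in> insert x I then f y else 0) = f x \<cdot>\<^sub>m ?E + ?M"
      using insert by (intro eq_matI) auto
    then have "N (mat p q (\<lambda>y. if y \<in> insert x I then f y else 0)) \<le> N (f x \<cdot>\<^sub>m ?E) + N ?M"
      using ui_norm_triangle[of "f x \<cdot>\<^sub>m ?E" p q ?M] by simp
    then show ?case using insert by (simp add: ui_norm_smult)
  qed
  have "mat p q (\<lambda>y. if y \<in> {..<p} \<times> {..<q} then f y else 0) = mat p q f" by (rule eq_matI) auto
  then show ?thesis using *[of "{..<p} \<times> {..<q}"] by simp
qed

lemma ui_norm_tendsto:
  assumes "\<And>i j. i < p \<Longrightarrow> j < q \<Longrightarrow> ((\<lambda>k. f k (i, j)) \<longlongrightarrow> g (i, j)) F"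
  shows "((\<lambda>k. N (mat p q (f k))) \<longlongrightarrow> N (mat p q g)) F"
proof (rule tendsto_sandwich)
  let ?r = "\<lambda>k. \<Sum>x\<in>{..<p} \<times> {..<q}. cmod (f k x - g x) * N (mat p q (\<lambda>y. of_bool (y = x)))"
  have "(?r \<longlongrightarrow> (\<Sum>x\<in>{..<p} \<times> {..<q}. cmod (g x - g x) * N (mat p q (\<lambda>y. of_bool (y = x))))) F"
    by (intro tendsto_intros) (use assms in auto)
  then have r: "(?r \<longlongrightarrow> 0) F" by simp
  show "((\<lambda>k. N (mat p q g) - ?r k) \<longlongrightarrow> N (mat p q g)) F"
    "((\<lambda>k. N (mat p q g) + ?r k) \<longlongrightarrow> N (mat p q g)) F"
    using tendsto_diff[OF tendsto_const r] tendsto_add[OF tendsto_const r] by simp_all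
  have "\<bar>N (mat p q (f k)) - N (mat p q g)\<bar> \<le> ?r k" for k
  proof -
    have eq: "mat p q (f k) = mat p q g + mat p q (\<lambda>x. f k x - g x)"
      "mat p q g = mat p q (f k) + (- mat p q (\<lambda>x. f k x - g x))" by (auto intro!: eq_matI)
    have "N (mat p q (f k)) \<le> N (mat p q g) + N (mat p q (\<lambda>x. f k x - g x))"
      by (subst eq(1), rule ui_norm_triangle[of _ p q]) auto
    moreover have "N (mat p q g) \<le> N (mat p q (f k)) + N (mat p q (\<lambda>x. f k x - g x))"
      by (subst eq(2), subst ui_norm_uminus[symmetric], rule ui_norm_triangle[of _ p q]) auto
    ultimately show ?thesis using ui_norm_le_sum_entries[of p q "\<lambda>x. f k x - g x"] by linarith
  qed
  then show "\<forall>\<^sub>F k in F. N (mat p q g) - ?r k \<le> N (mat p q (f k))"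
    "\<forall>\<^sub>F k in F. N (mat p q (f k)) \<le> N (mat p q g) + ?r k"
    by (auto intro!: always_eventually simp: abs_le_iff algebra_simps)
qed

end

section \<open>Exponential sums over a cyclic group and the discrete multiplier bound\<close>

lemma cis_multiple_eq_one_iff:
  assumes "M > 0"
  shows "cis (2 * pi * real_of_int h / real M) = 1 \<longleftrightarrow> int M dvd h"
proof
  assume "cis (2 * pi * real_of_int h / real M) = 1"
  then have "Re (cis (2 * pi * real_of_int h / real M)) = Re 1" by (rule arg_cong)
  then have "cos (2 * pi * real_of_int h / real M) = 1" by simp
  then obtain n :: int where "2 * pi * real_of_int h / real M = real_of_int n * 2 * pi"
    by (auto simp: cos_one_2pi_int)
  then have "real_of_int h = real_of_int (n * int M)"
    using assms by (simp add: field_simps)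
  then have "h = n * int M" by (simp only: of_int_eq_iff)
  then show "int M dvd h" by simp
next
  assume "int M dvd h"
  then obtain n where "h = int M * n" by (rule dvdE)
  then have "2 * pi * real_of_int h / real M = 2 * pi * real_of_int n" using assms by simp
  then show "cis (2 * pi * real_of_int h / real M) = 1" by (simp add: cis_multiple_2pi)
qed

lemma sum_cis_eq_0:
  assumes "M > 0" "\<not> int M dvd h"
  shows "(\<Sum>k<M. cis (2 * pi * real_of_int h / real M) ^ k) = 0"
proof -
  let ?w = "cis (2 * pi * real_of_int h / real M)"
  have "?w \<noteq> 1" using assms by (simp add: cis_multiple_eq_one_iff)
  moreover have "?w ^ M = 1"
    using assms by (simp add: DeMoivre cis_multiple_2pi)
  ultimately show ?thesis by (simp add: sum_gp_strict)
qed

text \<open>The cosine splits the sum into the frequencies \<open>l + m\<close> and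
  \<open>l - m\<close>. The hypotheses keep both strictly between 0 and \<open>M\<close> in absolute
  value, so neither is divisible by \<open>M\<close> and both geometric sums vanish.\<close>

lemma sum_cos_cis_eq_0:
  fixes l :: int
  assumes M: "M > 0" and "int m < \<bar>l\<bar>" "\<bar>l\<bar> + int m < int M"
  shows "(\<Sum>k<M. of_real (cos (real m * (2 * pi * real k / real M) + a)) *
    cis (2 * pi * real_of_int l / real M) ^ k) = 0"
proof -
  have "\<not> int M dvd h" if "h \<noteq> 0" "\<bar>h\<bar> < int M" for h
    using dvd_imp_le_int[OF that(1), of "int M"] that by auto
  then have dvd: "\<not> int M dvd l + int m" "\<not> int M dvd l - int m"
    using assms by (simp_all add: abs_if split: if_splits)
  let ?c = "\<lambda>h. cis (2 * pi * real_of_int h / real M)"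
  have "of_real (cos (real m * (2 * pi * real k / real M) + a)) * ?c l ^ k =
      cis a / 2 * ?c (l + int m) ^ k + cis (- a) / 2 * ?c (l - int m) ^ k" for k
  proof -
    let ?x = "real m * (2 * pi * real k / real M)"
    have c: "of_real (cos y) = (cis y + cis (- y)) / 2" for y
      by (simp add: complex_eq_iff)
    have e: "?c (l + int m) ^ k = cis ?x * ?c l ^ k" "?c (l - int m) ^ k = cis (- ?x) * ?c l ^ k"
      using M by (auto simp: DeMoivre cis_mult field_simps)
    have "of_real (cos (?x + a)) = (cis ?x * cis a + cis (- ?x) * cis (- a)) / 2"
      by (simp only: c cis_mult minus_add_distrib)
    then show ?thesis unfolding e by (simp add: algebra_simps add_divide_distrib)
  qed
  then have "(\<Sum>k<M. of_real (cos (real m * (2 * pi * real k / real M) + a)) * ?c l ^ k) =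
      cis a / 2 * (\<Sum>k<M. ?c (l + int m) ^ k) + cis (- a) / 2 * (\<Sum>k<M. ?c (l - int m) ^ k)"
    by (simp only: sum.distrib sum_distrib_left)
  then show ?thesis using sum_cis_eq_0[OF M dvd(1)] sum_cis_eq_0[OF M dvd(2)] by simp
qed

text \<open>Sample \<open>k\<close> of \<open>F\<close> has the entries
  \<open>Z $$ (i, j) * w i j ^ k\<close>, so its frequencies are the differences
  \<open>a j - b i\<close>, and \<open>q' c\<close> is the norm of the combination of samples with
  coefficients \<open>c\<close>. The hypothesis \<open>gap\<close> is two-sided because on a cyclic
  group a frequency close to \<open>M\<close> is as low as one close to 0.\<close>

lemma ui_norm_discrete_multiplier_le:
  fixes a b :: "nat \<Rightarrow> int"
  assumes ui: "unitarily_invariant_norm N" and Z: "Z \<in> carrier_mat p q"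
    and n: "n > 0" and P: "P > 0" and M: "M = 2*n*P"
    and gap: "\<And>i j. i < p \<Longrightarrow> j < q \<Longrightarrow> int n \<le> \<bar>a j - b i\<bar> \<and> \<bar>a j - b i\<bar> \<le> int M - int n"
  shows "N Z \<le> real P / 2 *
    N (mat p q (\<lambda>(i, j). Z $$ (i, j) * (cis (2 * pi * real_of_int (a j - b i) / real M) - 1)))"
proof -
  define w where "w i j = cis (2 * pi * real_of_int (a j - b i) / real M)" for i j
  have M0: "M > 0" using n P M by simp
  define q' where "q' c = N (mat p q (\<lambda>(i, j). Z $$ (i, j) * (\<Sum>k<M. of_real (c k) * w i j ^ k)))"
    for c :: "nat \<Rightarrow> real"
  define R where "R = mat p q (\<lambda>(i, j). Z $$ (i, j) * (w i j - 1))"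
  have wM: "w i j ^ (k mod M) = w i j ^ k" for i j k
  proof -
    have "w i j ^ M = 1" unfolding w_def using M0 by (simp add: DeMoivre cis_multiple_2pi del: of_int_diff)
    then have "w i j ^ (M * (k div M) + k mod M) = w i j ^ (k mod M)"
      by (simp only: power_add power_mult power_one mult_1)
    then show ?thesis by simp
  qed
  have sum_bool: "(\<Sum>i<M. of_real (of_bool (i = k)) * f i) = f k" if "k < M" for k and f :: "nat \<Rightarrow> complex"
  proof -
    have "(\<Sum>i<M. of_real (of_bool (i = k)) * f i) = (\<Sum>i<M. if i = k then f i else 0)"
      by (intro sum.cong) auto
    then show ?thesis using that by simp
  qed
  have step: "q' (\<lambda>i. of_bool (i = Suc k mod M) - of_bool (i = k)) = N R" if k: "k < M" for k
  proof -
    have lt: "Suc k mod M < M" using M0 by simp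
    have sum: "(\<Sum>l<M. of_real (of_bool (l = Suc k mod M) - of_bool (l = k)) * w i j ^ l) = w i j ^ k * (w i j - 1)" for i j
      by (simp add: left_diff_distrib sum_subtractf sum_bool[OF lt] sum_bool[OF k] wM)
         (simp add: algebra_simps)
    \<comment> \<open>The exponent splits into a row phase from \<open>b i\<close> and a column
      phase from \<open>a j\<close>. Hence every difference of consecutive samples is
      \<open>R\<close> up to unitary diagonal factors and has the same norm.\<close>
    have wk: "w i j ^ k = cis (real k * (- 2 * pi * real_of_int (b i) / real M)) * cis (real k * (2 * pi * real_of_int (a j) / real M))" for i j
      unfolding w_def DeMoivre cis_mult by (simp add: algebra_simps diff_divide_distrib)
    have "mat p q (\<lambda>(i, j). Z $$ (i, j) * (w i j ^ k * (w i j - 1))) =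
        mat p q (\<lambda>(i, j). cis (real k * (- 2 * pi * real_of_int (b i) / real M)) * R $$ (i, j) *
          cis (real k * (2 * pi * real_of_int (a j) / real M)))"
      by (rule eq_matI) (auto simp: R_def wk)
    then show ?thesis unfolding q'_def sum
      using ui_norm_mat_cis[OF ui, of R p q] by (simp add: R_def)
  qed
  have "q' (\<lambda>k. of_bool (k = 0)) \<le> real P / 2 * N R"
  proof (rule sublinear_bohr[OF _ _ n P M])
    fix c d :: "nat \<Rightarrow> real"
    have "mat p q (\<lambda>(i, j). Z $$ (i, j) * (\<Sum>k<M. of_real (c k + d k) * w i j ^ k)) =
        mat p q (\<lambda>(i, j). Z $$ (i, j) * (\<Sum>k<M. of_real (c k) * w i j ^ k)) +
        mat p q (\<lambda>(i, j). Z $$ (i, j) * (\<Sum>k<M. of_real (d k) * w i j ^ k))"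
      by (rule eq_matI) (auto simp: sum.distrib algebra_simps)
    then show "q' (\<lambda>k. c k + d k) \<le> q' c + q' d"
      unfolding q'_def by (simp add: ui_norm_triangle[OF ui, of _ p q])
  next
    fix c :: real and d :: "nat \<Rightarrow> real" assume c: "0 \<le> c"
    have "mat p q (\<lambda>(i, j). Z $$ (i, j) * (\<Sum>k<M. of_real (c * d k) * w i j ^ k)) =
        of_real c \<cdot>\<^sub>m mat p q (\<lambda>(i, j). Z $$ (i, j) * (\<Sum>k<M. of_real (d k) * w i j ^ k))"
      by (rule eq_matI) (auto simp: sum_distrib_left mult_ac)
    then show "q' (\<lambda>k. c * d k) = c * q' d"
      unfolding q'_def using c by (simp add: ui_norm_smult[OF ui])
  next
    fix m x assume m: "m < n"
    have "(\<Sum>k<M. of_real (if k < M then cos (real m * (2 * pi * real k / real M) + x) else 0) * w i j ^ k) = 0"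
      if "i < p" "j < q" for i j
    proof -
      have "(\<Sum>k<M. of_real (cos (real m * (2 * pi * real k / real M) + x)) * w i j ^ k) = 0"
        unfolding w_def using gap[OF that] m by (intro sum_cos_cis_eq_0[OF M0]) auto
      then show ?thesis by simp
    qed
    then have "mat p q (\<lambda>(i, j). Z $$ (i, j) * (\<Sum>k<M. of_real
        (if k < M then cos (real m * (2 * pi * real k / real M) + x) else 0) * w i j ^ k)) = 0\<^sub>m p q"
      by (intro eq_matI) auto
    then show "q' (\<lambda>k. if k < M then cos (real m * (2 * pi * real k / real M) + x) else 0) \<le> 0"
      unfolding q'_def using ui_norm_zero[OF ui, of p q] by simp
  next
    fix k assume k: "k < M"
    show "q' (\<lambda>i. of_bool (i = Suc k mod M) - of_bool (i = k)) \<le> N R" using step[OF k] by simp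
    have "q' (\<lambda>i. of_bool (i = k) - of_bool (i = Suc k mod M)) = q' (\<lambda>i. of_bool (i = Suc k mod M) - of_bool (i = k))"
    proof -
      have "mat p q (\<lambda>(i, j). Z $$ (i, j) * (\<Sum>l<M. of_real (of_bool (l = k) - of_bool (l = Suc k mod M)) * w i j ^ l)) =
        - mat p q (\<lambda>(i, j). Z $$ (i, j) * (\<Sum>l<M. of_real (of_bool (l = Suc k mod M) - of_bool (l = k)) * w i j ^ l))"
        by (rule eq_matI) (auto simp: left_diff_distrib sum_subtractf algebra_simps)
      then show ?thesis unfolding q'_def by (simp only: ui_norm_uminus[OF ui])
    qed
    then show "q' (\<lambda>i. of_bool (i = k) - of_bool (i = Suc k mod M)) \<le> N R" using step[OF k] by simp
  qed
  moreover have "q' (\<lambda>k. of_bool (k = 0)) = N Z"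
  proof -
    have "mat p q (\<lambda>(i, j). Z $$ (i, j) * (\<Sum>k<M. of_real (of_bool (k = 0)) * w i j ^ k)) = Z"
      using Z by (intro eq_matI) (auto simp: sum_bool[OF M0])
    then show ?thesis by (simp only: q'_def)
  qed
  ultimately show ?thesis by (simp add: R_def w_def)
qed

section \<open>Passage from integer to real spectra\<close>

lemma tendsto_scaled_cis_diff:
  assumes "(x \<longlongrightarrow> y) sequentially"
  shows "((\<lambda>k. of_nat k * (cis (x k / real k) - 1)) \<longlongrightarrow> \<i> * of_real y) sequentially"
proof -
  \<comment> \<open>The difference quotient of \<open>exp\<close> at 0, completed by its limit, so
    that the composition with a sequence that may hit 0 converges.\<close>
  define \<phi> where "\<phi> z = (if z = 0 then 1 else (exp z - 1) / z)" for z :: complex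
  have "((\<lambda>h. (exp (0 + h) - exp 0) / h) \<longlongrightarrow> exp 0) (at (0::complex))"
    using DERIV_exp[of "0::complex"] unfolding DERIV_def .
  then have "(\<phi> \<longlongrightarrow> \<phi> 0) (at 0)"
    by (subst filterlim_cong[OF refl refl, of _ "\<lambda>h. (exp (0 + h) - exp 0) / h"])
       (auto simp: \<phi>_def eventually_at_filter)
  then have cont: "isCont \<phi> 0" by (simp add: isCont_def)
  have "((\<lambda>k. \<i> * of_real (x k * inverse (real k))) \<longlongrightarrow> \<i> * of_real (y * 0)) sequentially"
    by (intro tendsto_intros assms lim_inverse_n)
  then have "((\<lambda>k. \<i> * of_real (x k / real k)) \<longlongrightarrow> 0) sequentially"
    by (simp add: divide_inverse)
  from isCont_tendsto_compose[OF cont this]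
  have "((\<lambda>k. \<i> * of_real (x k) * \<phi> (\<i> * of_real (x k / real k))) \<longlongrightarrow> \<i> * of_real y * \<phi> 0) sequentially"
    by (intro tendsto_intros assms)
  then have lim: "((\<lambda>k. \<i> * of_real (x k) * \<phi> (\<i> * of_real (x k / real k))) \<longlongrightarrow> \<i> * of_real y) sequentially"
    by (simp add: \<phi>_def)
  have "\<forall>\<^sub>F k in sequentially. \<i> * of_real (x k) * \<phi> (\<i> * of_real (x k / real k)) =
      of_nat k * (cis (x k / real k) - 1)"
    using eventually_gt_at_top[of 0]
  proof eventually_elim
    case (elim k)
    then show ?case by (cases "x k = 0") (auto simp: \<phi>_def cis_conv_exp)
  qed
  from Lim_transform_eventually[OF lim this] show ?thesis .
qed

lemma ui_norm_multiplier_le: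
  fixes a b :: "nat \<Rightarrow> real"
  assumes ui: "unitarily_invariant_norm N" and Z: "Z \<in> carrier_mat p q"
    and \<delta>: "\<delta> > 0" and gap: "\<And>i j. i < p \<Longrightarrow> j < q \<Longrightarrow> \<delta> \<le> \<bar>a j - b i\<bar>"
  shows "N Z \<le> pi / 2 * (1 / \<delta>) * N (mat p q (\<lambda>(i, j). Z $$ (i, j) * of_real (a j - b i)))"
proof -
  define c where "c k j = round (real k * a j)" for k j
  define d where "d k i = round (real k * b i)" for k i
  \<comment> \<open>Rounding changes \<open>real k * a j\<close> and \<open>real k * b i\<close> by
    at most 1/2 each, so the rounded differences are at least \<open>k * \<delta> - 1\<close>. The
    subtracted 1 pays for this.\<close>
  define n where "n k = nat \<lfloor>real k * \<delta>\<rfloor> - 1" for k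
  have round: "\<bar>real_of_int (c k j - d k i) - real k * (a j - b i)\<bar> \<le> 1" for k i j
    using of_int_round_abs_le[of "real k * a j"] of_int_round_abs_le[of "real k * b i"]
    unfolding c_def d_def of_int_diff right_diff_distrib by linarith
  have k\<delta>: "filterlim (\<lambda>k. real k * \<delta>) at_top sequentially"
    using filterlim_tendsto_pos_mult_at_top[OF tendsto_const \<delta> filterlim_real_sequentially]
    by (simp add: mult.commute)
  have n_bounds: "real (n k) \<le> real k * \<delta> - 1" "real k * \<delta> - 2 \<le> real (n k)"
    if "1 \<le> real k * \<delta>" for k
    using that unfolding n_def by (simp_all add: of_nat_diff le_nat_iff nat_le_iff) linarith+
  \<comment> \<open>The choice \<open>M = 2 * n k * k\<close> turns the angle
    \<open>2 * pi / M\<close> into \<open>pi / n k / k\<close>, and the constant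
    \<open>k / 2\<close> of the discrete bound is moved into the matrix.\<close>
  define f where "f k = (\<lambda>(i, j). Z $$ (i, j) *
    (of_nat k * (cis (pi * (real_of_int (c k j - d k i) / real (n k)) / real k) - 1) / 2))" for k
  have ev: "\<forall>\<^sub>F k in sequentially. N Z \<le> N (mat p q (f k))"
  proof -
    obtain L where L: "\<And>i j. i < p \<Longrightarrow> j < q \<Longrightarrow> \<bar>a j - b i\<bar> \<le> L"
    proof
      fix i j assume ij: "i < p" "j < q"
      then show "\<bar>a j - b i\<bar> \<le> Max ((\<lambda>(i, j). \<bar>a j - b i\<bar>) ` ({..<p} \<times> {..<q}))"
        by (intro Max_ge) force+
    qed
    \<comment> \<open>As \<open>n k\<close> is at least \<open>k * \<delta> - 2\<close>, the term
      \<open>L + 4\<close> gives \<open>n k \<ge> L + 2\<close>. Then the frequencies, which are at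
      most \<open>k * L + 1\<close>, do not exceed \<open>M - n k\<close>. The 4 makes
      \<open>n k\<close> positive whatever \<open>L\<close> is.\<close>
    have "\<forall>\<^sub>F k in sequentially. real k * \<delta> \<ge> max (L + 4) 4"
      using k\<delta> unfolding filterlim_at_top by blast
    then show ?thesis using eventually_gt_at_top[of 0]
    proof eventually_elim
      case (elim k)
      define M where "M = 2 * n k * k"
      have n2: "real (n k) \<ge> L + 2" "real (n k) \<ge> 2" using n_bounds[of k] elim by auto
      have "int (n k) \<le> \<bar>c k j - d k i\<bar> \<and> \<bar>c k j - d k i\<bar> \<le> int M - int (n k)"
        if ij: "i < p" "j < q" for i j
      proof
        have "real k * \<delta> \<le> real k * \<bar>a j - b i\<bar>" using gap[OF ij] by (intro mult_left_mono) auto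
        also have "\<dots> = \<bar>real k * (a j - b i)\<bar>" by (simp add: abs_mult)
        finally have "real (n k) \<le> real_of_int \<bar>c k j - d k i\<bar>"
          using round[where k=k and i=i and j=j] n_bounds(1)[of k] elim by linarith
        then show "int (n k) \<le> \<bar>c k j - d k i\<bar>" by linarith
        have "\<bar>real k * (a j - b i)\<bar> = real k * \<bar>a j - b i\<bar>" by (simp add: abs_mult)
        also have "\<dots> \<le> real k * L" using L[OF ij] by (intro mult_left_mono) auto
        also have "\<dots> \<le> real k * (real (n k) - 2)" using n2 by (intro mult_left_mono) auto
        finally have "real_of_int \<bar>c k j - d k i\<bar> \<le> real k * (real (n k) - 2) + 1"
          using round[where k=k and i=i and j=j] by linarith
        also have "\<dots> \<le> real k * real (n k)" using elim by (simp add: algebra_simps)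
        also have "\<dots> \<le> real k * real (n k) + (real k - 1) * real (n k)" using elim by simp
        also have "\<dots> = real M - real (n k)" by (simp add: M_def algebra_simps)
        finally show "\<bar>c k j - d k i\<bar> \<le> int M - int (n k)" by linarith
      qed
      then have "N Z \<le> real k / 2 *
          N (mat p q (\<lambda>(i, j). Z $$ (i, j) * (cis (2 * pi * real_of_int (c k j - d k i) / real M) - 1)))"
        using n2 elim by (intro ui_norm_discrete_multiplier_le[OF ui Z _ _ M_def]) auto
      also have "\<dots> = N (of_real (real k / 2) \<cdot>\<^sub>m
          mat p q (\<lambda>(i, j). Z $$ (i, j) * (cis (2 * pi * real_of_int (c k j - d k i) / real M) - 1)))"
        by (simp add: ui_norm_smult[OF ui] norm_mult norm_divide del: of_int_diff)
      also have "of_real (real k / 2) \<cdot>\<^sub>m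
          mat p q (\<lambda>(i, j). Z $$ (i, j) * (cis (2 * pi * real_of_int (c k j - d k i) / real M) - 1)) = mat p q (f k)"
      proof -
        have "2 * pi * x / real M = pi * (x / real (n k)) / real k" for x :: real
          by (simp add: M_def)
        then show ?thesis by (intro eq_matI) (auto simp: f_def simp del: of_int_diff)
      qed
      finally show ?case .
    qed
  qed
  \<comment> \<open>The rounded differences grow like \<open>k * (a j - b i)\<close> and
    \<open>n k\<close> grows like \<open>k * \<delta>\<close>. The factor \<open>\<i>\<close> of the
    limit disappears in the norm.\<close>
  have lim: "((\<lambda>k. N (mat p q (f k))) \<longlongrightarrow>
      N (mat p q (\<lambda>(i, j). Z $$ (i, j) * (\<i> * of_real (pi * ((a j - b i) / \<delta>)) / 2)))) sequentially"
  proof (rule ui_norm_tendsto[OF ui])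
    fix i j assume "i < p" "j < q"
    have inv: "((\<lambda>k. 1 / real k) \<longlongrightarrow> 0) sequentially" by (rule lim_1_over_n)
    have "((\<lambda>k. real_of_int (c k j - d k i) / real k - (a j - b i)) \<longlongrightarrow> 0) sequentially"
    proof (rule tendsto_0_le[OF inv, where K = 1])
      show "\<forall>\<^sub>F k in sequentially. norm (real_of_int (c k j - d k i) / real k - (a j - b i)) \<le> norm (1 / real k) * 1"
        using eventually_gt_at_top[of 0]
      proof eventually_elim
        case (elim k)
        then have "real_of_int (c k j - d k i) / real k - (a j - b i) =
            (real_of_int (c k j - d k i) - real k * (a j - b i)) / real k" by (simp add: field_simps)
        then show ?case using round[where k=k and i=i and j=j] elim
          by (simp add: divide_right_mono)
      qed
    qed
    then have l: "((\<lambda>k. real_of_int (c k j - d k i) / real k) \<longlongrightarrow> a j - b i) sequentially"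
      by (simp only: LIM_zero_iff)
    have "((\<lambda>k. real (n k) / real k - \<delta>) \<longlongrightarrow> 0) sequentially"
    proof (rule tendsto_0_le[OF inv, where K = 2])
      have "\<forall>\<^sub>F k in sequentially. real k * \<delta> \<ge> 1"
        using k\<delta> unfolding filterlim_at_top by blast
      then show "\<forall>\<^sub>F k in sequentially. norm (real (n k) / real k - \<delta>) \<le> norm (1 / real k) * 2"
        using eventually_gt_at_top[of 0]
      proof eventually_elim
        case (elim k)
        then have eq: "real (n k) / real k - \<delta> = (real (n k) - real k * \<delta>) / real k" by (simp add: field_simps)
        have "\<bar>real (n k) - real k * \<delta>\<bar> \<le> 2" using n_bounds[of k] elim by linarith
        then have "\<bar>real (n k) - real k * \<delta>\<bar> / real k \<le> 2 / real k" by (rule divide_right_mono) simp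
        then show ?case unfolding eq by simp
      qed
    qed
    then have nl: "((\<lambda>k. real (n k) / real k) \<longlongrightarrow> \<delta>) sequentially"
      by (simp only: LIM_zero_iff)
    have "((\<lambda>k. (real_of_int (c k j - d k i) / real k) / (real (n k) / real k)) \<longlongrightarrow> (a j - b i) / \<delta>) sequentially"
      using \<delta> by (intro tendsto_divide l nl) auto
    moreover have "\<forall>\<^sub>F k in sequentially. (real_of_int (c k j - d k i) / real k) / (real (n k) / real k) =
        real_of_int (c k j - d k i) / real (n k)"
      using eventually_gt_at_top[of 0] by eventually_elim auto
    ultimately have "((\<lambda>k. real_of_int (c k j - d k i) / real (n k)) \<longlongrightarrow> (a j - b i) / \<delta>) sequentially"
      by (rule Lim_transform_eventually)
    then have "((\<lambda>k. pi * (real_of_int (c k j - d k i) / real (n k))) \<longlongrightarrow> pi * ((a j - b i) / \<delta>)) sequentially"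
      by (rule tendsto_mult_left)
    from tendsto_scaled_cis_diff[OF this]
    show "((\<lambda>k. f k (i, j)) \<longlongrightarrow> (case (i, j) of (i, j) \<Rightarrow>
        Z $$ (i, j) * (\<i> * of_real (pi * ((a j - b i) / \<delta>)) / 2))) sequentially"
      unfolding f_def prod.case by (intro tendsto_mult_left tendsto_divide tendsto_const) auto
  qed
  have "N Z \<le> N (mat p q (\<lambda>(i, j). Z $$ (i, j) * (\<i> * of_real (pi * ((a j - b i) / \<delta>)) / 2)))"
    using tendsto_lowerbound[OF lim ev] by simp
  also have "mat p q (\<lambda>(i, j). Z $$ (i, j) * (\<i> * of_real (pi * ((a j - b i) / \<delta>)) / 2)) =
      (\<i> * of_real (pi / 2 * (1 / \<delta>))) \<cdot>\<^sub>m mat p q (\<lambda>(i, j). Z $$ (i, j) * of_real (a j - b i))"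
    by (rule eq_matI) (auto simp: mult_ac)
  finally show ?thesis
    using \<delta> by (simp add: ui_norm_smult[OF ui] norm_mult norm_divide)
qed

section \<open>Diagonalization of Hermitian matrices\<close>

lemma assoc_mult_mat_dim:
  "dim_col A = dim_row B \<Longrightarrow> dim_col B = dim_row C \<Longrightarrow> A * B * C = A * (B * C :: 'a :: semiring_0 mat)"
  by (intro assoc_mult_mat[of _ "dim_row A" "dim_row B" _ "dim_row C" _ "dim_col C"]) auto

lemma mat_adjoint_mult_dim:
  fixes A B :: "complex mat"
  shows "dim_col A = dim_row B \<Longrightarrow> mat_adjoint (A * B) = mat_adjoint B * mat_adjoint A"
  by (intro mat_adjoint_mult[of _ "dim_row A" "dim_row B" _ "dim_col B"]) auto

lemma mat_diag_dims [simp]: "dim_row (mat_diag n f) = n" "dim_col (mat_diag n f) = n"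
  by (simp_all add: mat_diag_def)

lemma cscalar_prod_eq_sum:
  fixes v w :: "complex vec"
  shows "dim_vec v = dim_vec w \<Longrightarrow> v \<bullet>c w = (\<Sum>i<dim_vec v. v $ i * cnj (w $ i))"
  by (auto simp: scalar_prod_def lessThan_atLeast0 intro!: sum.cong)

lemma cscalar_prod_self:
  fixes v :: "complex vec"
  shows "v \<bullet>c v = of_real ((vec_norm2 v)\<^sup>2)"
  by (simp add: cscalar_prod_eq_sum vec_norm2_def L2_set_def sum_nonneg complex_norm_square del: of_real_power)

lemma vec_norm2_nonneg [simp]: "0 \<le> vec_norm2 v"
  by (simp add: vec_norm2_def)

lemma vec_norm2_eq_0_iff:
  assumes "v \<in> carrier_vec n"
  shows "vec_norm2 v = 0 \<longleftrightarrow> v = 0\<^sub>v n"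
  using assms by (auto simp: vec_norm2_def L2_set_eq_0_iff)

lemma cscalar_prod_adjoint:
  fixes A :: "complex mat"
  assumes A: "A \<in> carrier_mat m n" and x: "x \<in> carrier_vec n" and y: "y \<in> carrier_vec m"
  shows "(A *\<^sub>v x) \<bullet>c y = x \<bullet>c (mat_adjoint A *\<^sub>v y)"
proof -
  have "(A *\<^sub>v x) \<bullet>c y = (\<Sum>i<m. \<Sum>j<n. A $$ (i, j) * x $ j * cnj (y $ i))"
    using assms by (auto simp: cscalar_prod_eq_sum scalar_prod_def lessThan_atLeast0 sum_distrib_right intro!: sum.cong)
  also have "\<dots> = (\<Sum>j<n. \<Sum>i<m. A $$ (i, j) * x $ j * cnj (y $ i))"
    by (rule sum.swap)
  also have "\<dots> = x \<bullet>c (mat_adjoint A *\<^sub>v y)"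
    using assms by (auto simp: cscalar_prod_eq_sum scalar_prod_def lessThan_atLeast0 sum_distrib_left cnj_sum mult_ac intro!: sum.cong)
  finally show ?thesis .
qed

lemma vec_norm2_unitary:
  assumes U: "unitary_mat U" "U \<in> carrier_mat n n" and v: "v \<in> carrier_vec n"
  shows "vec_norm2 (U *\<^sub>v v) = vec_norm2 v"
proof -
  have "(U *\<^sub>v v) \<bullet>c (U *\<^sub>v v) = v \<bullet>c (mat_adjoint U *\<^sub>v (U *\<^sub>v v))"
    using U v by (intro cscalar_prod_adjoint[of _ n n]) auto
  also have "mat_adjoint U *\<^sub>v (U *\<^sub>v v) = (mat_adjoint U * U) *\<^sub>v v"
    using U v by (intro assoc_mult_mat_vec[symmetric]) auto
  also have "\<dots> = v" using unitary_matD[OF U] v by simp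
  finally have "(vec_norm2 (U *\<^sub>v v))\<^sup>2 = (vec_norm2 v)\<^sup>2"
    unfolding cscalar_prod_self of_real_eq_iff .
  then show ?thesis by simp
qed

text \<open>Gram-Schmidt keeps the first vector of a basis that starts with \<open>v\<close>, and
  only the lengths remain to be normalized. This supplies the change of basis for the deflation
  below.\<close>

lemma unitary_completion:
  assumes v: "v \<in> carrier_vec n" "v \<noteq> 0\<^sub>v n"
  shows "\<exists>U c. U \<in> carrier_mat n n \<and> unitary_mat U \<and> col U 0 = c \<cdot>\<^sub>v v"
proof -
  interpret cof_vec_space n "TYPE(complex)" .
  define b where "b = basis_completion v"
  from basis_completion[OF v, folded b_def]
  have dist_b: "distinct b" and indep: "\<not> lin_dep (set b)"
    and b: "set b \<subseteq> carrier_vec n" and hdb: "hd b = v" and len_b: "length b = n" by auto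
  have n: "n > 0" using v by (cases n) auto
  with hdb len_b obtain vs where bv: "b = v # vs" by (cases b) auto
  define ws where "ws = gram_schmidt n b"
  from gram_schmidt_result[OF b dist_b indep refl, folded ws_def]
  have ws: "set ws \<subseteq> carrier_vec n" and orth: "corthogonal ws" and len: "length ws = n"
    by (auto simp: len_b)
  from gram_schmidt_hd[OF v(1), of vs, folded bv] have "hd ws = v" unfolding ws_def .
  then have ws0: "ws ! 0 = v" using len n by (simp add: hd_conv_nth[symmetric] flip: length_greater_0_conv)
  define U where "U = mat n n (\<lambda>(i, j). of_real (1 / vec_norm2 (ws ! j)) * ws ! j $ i)"
  have U: "U \<in> carrier_mat n n" by (simp add: U_def)
  have dim: "ws ! j \<in> carrier_vec n" if "j < n" for j using ws len that by auto
  have "mat_adjoint U * U = 1\<^sub>m n"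
  proof (rule eq_matI)
    fix i j assume "i < dim_row (1\<^sub>m n)" "j < dim_col (1\<^sub>m n)"
    then have i: "i < n" and j: "j < n" by auto
    have "(mat_adjoint U * U) $$ (i, j) =
        of_real (1 / vec_norm2 (ws ! j)) * of_real (1 / vec_norm2 (ws ! i)) * (ws ! j \<bullet>c ws ! i)"
      using i j dim[OF i] dim[OF j] U
      by (auto simp: U_def scalar_prod_def cscalar_prod_eq_sum lessThan_atLeast0 sum_distrib_left mult_ac intro!: sum.cong)
    also have "\<dots> = 1\<^sub>m n $$ (i, j)"
    proof (cases "i = j")
      case True
      have "ws ! i \<bullet>c ws ! i \<noteq> 0" using corthogonalD[OF orth, of i i] i len by auto
      then have "vec_norm2 (ws ! i) \<noteq> 0" by (simp add: cscalar_prod_self)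
      then show ?thesis using True i by (simp add: cscalar_prod_self power2_eq_square)
    next
      case False
      then show ?thesis using corthogonalD[OF orth, of j i] i j len by simp
    qed
    finally show "(mat_adjoint U * U) $$ (i, j) = 1\<^sub>m n $$ (i, j)" .
  qed (use U in auto)
  then have "unitary_mat U" using U by (intro unitary_matI) auto
  moreover have "col U 0 = of_real (1 / vec_norm2 v) \<cdot>\<^sub>v v"
    using n v by (intro eq_vecI) (auto simp: U_def ws0)
  ultimately show ?thesis using U by blast
qed

lemma exists_eigenvalue_complex:
  assumes "A \<in> carrier_mat n n" "n > 0"
  shows "\<exists>e::complex. eigenvalue A e"
proof -
  have "degree (char_poly A) > 0" using degree_monic_char_poly[OF assms(1)] assms(2) by simp
  then have "\<exists>e. poly (char_poly A) e = 0" by (rule alg_closed_imp_poly_has_root)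
  then show ?thesis using eigenvalue_root_char_poly[OF assms(1)] by blast
qed

text \<open>Deflation by one eigenvector: if it spans the zeroth column of \<open>U\<close>, then
  the zeroth column of \<open>G\<close> vanishes below its diagonal entry, and so does the zeroth
  row to the right of it, because \<open>G\<close> is Hermitian. The induction hypothesis applies to
  the remaining block \<open>G3\<close>.\<close>

theorem hermitian_diagonalization:
  fixes H :: "complex mat"
  assumes "H \<in> carrier_mat n n" "mat_adjoint H = H"
  shows "\<exists>U d. U \<in> carrier_mat n n \<and> unitary_mat U \<and>
    H = U * mat_diag n (\<lambda>i. of_real (d i)) * mat_adjoint U"
  using assms
proof (induction n arbitrary: H)
  case 0
  then show ?case by (intro exI[of _ "1\<^sub>m 0"] exI[of _ "\<lambda>_. 0"]) auto
next
  case (Suc n)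
  note H = Suc.prems(1) and herm = Suc.prems(2)
  obtain e v where ev: "eigenvector H v e"
    using exists_eigenvalue_complex[OF H] by (auto simp: eigenvalue_def)
  then have v: "v \<in> carrier_vec (Suc n)" "v \<noteq> 0\<^sub>v (Suc n)" and Hv: "H *\<^sub>v v = e \<cdot>\<^sub>v v"
    using H by (auto simp: eigenvector_def)
  obtain U c where U: "U \<in> carrier_mat (Suc n) (Suc n)" and uU: "unitary_mat U"
    and col0: "col U 0 = c \<cdot>\<^sub>v v"
    using unitary_completion[OF v] by blast
  define G where "G = mat_adjoint U * H * U"
  have dims [simp]: "dim_row U = Suc n" "dim_col U = Suc n" "dim_row H = Suc n" "dim_col H = Suc n"
    using U H by auto
  have G: "G \<in> carrier_mat (Suc n) (Suc n)" by (intro carrier_matI) (simp_all add: G_def)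
  have hG: "mat_adjoint G = G"
    using U H herm unfolding G_def
    by (simp add: mat_adjoint_mult_dim assoc_mult_mat_dim)
  have "col G 0 = e \<cdot>\<^sub>v unit_vec (Suc n) 0"
  proof -
    have "col G 0 = (mat_adjoint U * H) *\<^sub>v col U 0"
      unfolding G_def using U H by (intro col_mult2[of _ "Suc n" "Suc n"]) auto
    also have "\<dots> = mat_adjoint U *\<^sub>v (H *\<^sub>v col U 0)"
      using U H by (intro assoc_mult_mat_vec[of _ "Suc n" "Suc n" _ "Suc n"]) (auto intro!: carrier_vecI)
    also have "H *\<^sub>v col U 0 = e \<cdot>\<^sub>v col U 0"
      using H v unfolding col0 by (simp add: mult_mat_vec Hv smult_smult_assoc mult.commute)
    also have "mat_adjoint U *\<^sub>v (e \<cdot>\<^sub>v col U 0) = e \<cdot>\<^sub>v (mat_adjoint U *\<^sub>v col U 0)"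
      using U by (intro mult_mat_vec[of _ "Suc n" "Suc n"]) (auto intro!: carrier_vecI)
    also have "mat_adjoint U *\<^sub>v col U 0 = col (mat_adjoint U * U) 0"
      using U by (intro col_mult2[symmetric, of _ "Suc n" "Suc n"]) auto
    also have "\<dots> = unit_vec (Suc n) 0" using unitary_matD[OF uU U] by simp
    finally show ?thesis .
  qed
  then have G0: "G $$ (i, 0) = (if i = 0 then e else 0)" if "i < Suc n" for i
    using that G by (auto simp: vec_eq_iff unit_vec_def dest!: spec[of _ i])
  have G0': "G $$ (0, i) = (if i = 0 then e else 0)" if "i < Suc n" for i
  proof -
    have sym: "G $$ (k, l) = cnj (G $$ (l, k))" if "k < Suc n" "l < Suc n" for k l
      using mat_adjoint_simps(3)[of k G l] that G hG by simp
    then have "e = cnj e" using G0[of 0] by (metis zero_less_Suc)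
    then show ?thesis using sym[of 0 i] G0[OF that] that by auto
  qed
  then have e: "e = of_real (Re e)"
  proof -
    have "cnj (G $$ (0, 0)) = G $$ (0, 0)"
      using mat_adjoint_simps(3)[of 0 G 0] G hG by simp
    then show ?thesis using G0[of 0] by (simp add: complex_eq_iff)
  qed
  define G3 where "G3 = mat n n (\<lambda>(i, j). G $$ (Suc i, Suc j))"
  have G3: "G3 \<in> carrier_mat n n" by (simp add: G3_def)
  have "mat_adjoint G3 = G3"
  proof (rule eq_matI)
    fix i j assume "i < dim_row G3" "j < dim_col G3"
    then show "mat_adjoint G3 $$ (i, j) = G3 $$ (i, j)"
      using mat_adjoint_simps(3)[of "Suc i" G "Suc j"] G hG by (simp add: G3_def)
  qed (use G3 in auto)
  from Suc.IH[OF G3 this] obtain V d where V: "V \<in> carrier_mat n n" and uV: "unitary_mat V"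
    and G3_eq: "G3 = V * mat_diag n (\<lambda>i. of_real (d i)) * mat_adjoint V" by blast
  define E where "E = mat 1 1 (\<lambda>_. e)"
  define V' where "V' = four_block_mat (1\<^sub>m 1) (0\<^sub>m 1 n) (0\<^sub>m n 1) V"
  define d' where "d' i = (case i of 0 \<Rightarrow> Re e | Suc i \<Rightarrow> d i)" for i
  have V': "V' \<in> carrier_mat (Suc n) (Suc n)" using V unfolding V'_def by auto
  have adjV': "mat_adjoint V' = four_block_mat (1\<^sub>m 1) (0\<^sub>m 1 n) (0\<^sub>m n 1) (mat_adjoint V)"
    unfolding V'_def using V by (subst mat_adjoint_four_block[of _ 1 1 _ n _ n]) (auto intro!: cong_four_block_mat eq_matI)
  have "mat_adjoint V' * V' = four_block_mat (1\<^sub>m 1) (0\<^sub>m 1 n) (0\<^sub>m n 1) (1\<^sub>m n)"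
    unfolding adjV' unfolding V'_def
    using V unitary_matD[OF uV V] by (subst mult_four_block_mat[of _ 1 1 _ n _ n]) auto
  then have uV': "unitary_mat V'" using V' by (intro unitary_matI[of _ "Suc n"]) simp_all
  have dims' [simp]: "dim_row V' = Suc n" "dim_col V' = Suc n" using V' by auto
  have E: "E \<in> carrier_mat 1 1" by (simp add: E_def)
  have diag: "mat_diag (Suc n) (\<lambda>i. of_real (d' i)) = four_block_mat E (0\<^sub>m 1 n) (0\<^sub>m n 1) (mat_diag n (\<lambda>i. of_real (d i)))"
    using e by (intro eq_matI) (auto simp: mat_diag_def E_def d'_def split: nat.split)
  have "G = four_block_mat E (0\<^sub>m 1 n) (0\<^sub>m n 1) G3"
    using G by (intro eq_matI) (auto simp: E_def G3_def G0 G0')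
  also have "\<dots> = V' * mat_diag (Suc n) (\<lambda>i. of_real (d' i)) * mat_adjoint V'"
  proof -
    have "V' * mat_diag (Suc n) (\<lambda>i. of_real (d' i)) = four_block_mat E (0\<^sub>m 1 n) (0\<^sub>m n 1) (V * mat_diag n (\<lambda>i. of_real (d i)))"
      unfolding diag unfolding V'_def using V E
      by (subst mult_four_block_mat[of _ 1 1 _ n _ n]) auto
    then show ?thesis unfolding adjV' using V E G3
      by (simp add: G3_eq[symmetric] mult_four_block_mat[of _ 1 1 _ n _ n _ _ 1 _ n])
  qed
  finally have G_eq: "G = V' * mat_diag (Suc n) (\<lambda>i. of_real (d' i)) * mat_adjoint V'" .
  let ?W = "U * V'" and ?D = "mat_diag (Suc n) (\<lambda>i. complex_of_real (d' i))"
  have "?W * ?D * mat_adjoint ?W = U * (V' * ?D * mat_adjoint V') * mat_adjoint U"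
    using U V' by (simp add: mat_adjoint_mult_dim assoc_mult_mat_dim)
  also have "\<dots> = (U * mat_adjoint U) * H * (U * mat_adjoint U)"
    unfolding G_eq[symmetric] G_def using U H
    by (simp add: assoc_mult_mat_dim)
  also have "\<dots> = H" using unitary_matD[OF uU U] H by simp
  finally have "H = ?W * ?D * mat_adjoint ?W" ..
  moreover have "?W \<in> carrier_mat (Suc n) (Suc n)" using U V' by (rule mult_carrier_mat)
  ultimately show ?case using unitary_mat_mult[OF uU U uV' V']
    by (intro exI[of _ ?W] exI[of _ d'] conjI)
qed

text \<open>The theorem above yields \<open>d\<close> without interpreting it. The columns of
  \<open>U\<close> serve as eigenvectors here, which later ties \<open>d\<close> to singular
  values.\<close>

lemma eigenvalue_of_diagonalization:
  assumes U: "U \<in> carrier_mat n n" "unitary_mat U" and i: "i < n"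
    and H: "H = U * mat_diag n (\<lambda>i. of_real (d i)) * mat_adjoint U"
  shows "eigenvalue H (of_real (d i))"
proof -
  let ?D = "mat_diag n (\<lambda>i. complex_of_real (d i))"
  have [simp]: "dim_row U = n" "dim_col U = n" using U by auto
  have "H * U = U * ?D * (mat_adjoint U * U)"
    unfolding H using U by (simp add: assoc_mult_mat_dim)
  then have HU: "H * U = U * ?D" using unitary_matD[OF U(2,1)] U by simp
  have Hc: "H \<in> carrier_mat n n" unfolding H by (intro carrier_matI) simp_all
  have "H *\<^sub>v col U i = col (U * ?D) i"
    using HU col_mult2[OF Hc U(1) i] by simp
  also have "\<dots> = of_real (d i) \<cdot>\<^sub>v col U i"
    using U i by (subst mat_diag_mult_right[OF U(1)]) (auto intro!: eq_vecI)
  finally have ev: "H *\<^sub>v col U i = of_real (d i) \<cdot>\<^sub>v col U i" .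
  have "col U i \<noteq> 0\<^sub>v n"
  proof
    assume "col U i = 0\<^sub>v n"
    then have "mat_adjoint U *\<^sub>v col U i = 0\<^sub>v n" by (intro eq_vecI) (auto simp: scalar_prod_def)
    moreover have "mat_adjoint U *\<^sub>v col U i = col (mat_adjoint U * U) i"
      using U i by (intro col_mult2[symmetric, of _ n n]) auto
    ultimately have "unit_vec n i = (0\<^sub>v n :: complex vec)" using unitary_matD[OF U(2,1)] i by simp
    then show False using i by (metis index_unit_vec(2) index_zero_vec(1) zero_neq_one)
  qed
  then show ?thesis using ev Hc U i by (auto simp: eigenvalue_def eigenvector_def intro!: exI[of _ "col U i"])
qed

section \<open>Singular values and the Hermitian dilation\<close>

definition dilation :: "complex mat \<Rightarrow> complex mat" where
  "dilation B = four_block_mat (0\<^sub>m (dim_row B) (dim_row B)) B (mat_adjoint B) (0\<^sub>m (dim_col B) (dim_col B))"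

lemma dilation_carrier: "B \<in> carrier_mat s t \<Longrightarrow> dilation B \<in> carrier_mat (s + t) (s + t)"
  by (auto simp: dilation_def)

lemma mat_adjoint_dilation: "mat_adjoint (dilation B) = dilation B"
  unfolding dilation_def
  by (subst mat_adjoint_four_block[of _ "dim_row B" "dim_row B" _ "dim_col B" _ "dim_col B"])
     (auto intro!: cong_four_block_mat eq_matI)

lemma sqrt_in_sv:
  fixes B :: "complex mat" and z :: complex
  assumes "eigenvalue (if dim_col B \<le> dim_row B then mat_adjoint B * B else B * mat_adjoint B) z"
  shows "sqrt (Re z) \<in># sv B"
proof -
  let ?G = "if dim_col B \<le> dim_row B then mat_adjoint B * B else B * mat_adjoint B"
  define n where "n = dim_row ?G"
  have G: "?G \<in> carrier_mat n n" unfolding n_def by (auto intro!: carrier_matI)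
  have "char_poly ?G \<noteq> 0" using degree_monic_char_poly[OF G] by auto
  then have "z \<in># proots (char_poly ?G)"
    using assms eigenvalue_root_char_poly[OF G] by (simp add: set_count_proots)
  then show ?thesis unfolding sv_def by auto
qed

text \<open>The matrix \<open>C\<close> covers both branches of the definition of \<open>sv\<close>,
  so that an argument about the Gram matrix is given only once.\<close>

lemma sv_obtain_eigenvector:
  fixes B :: "complex mat"
  assumes "x \<in># sv B"
  obtains C z v where "C = B \<or> C = mat_adjoint B" "eigenvector (mat_adjoint C * C) v z" "x = sqrt (Re z)"
proof -
  define C where "C = (if dim_col B \<le> dim_row B then B else mat_adjoint B)"
  have eq: "(if dim_col B \<le> dim_row B then mat_adjoint B * B else B * mat_adjoint B) = mat_adjoint C * C"
    by (simp add: C_def)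
  have G: "mat_adjoint C * C \<in> carrier_mat (dim_col C) (dim_col C)" by (auto intro!: carrier_matI)
  have "char_poly (mat_adjoint C * C) \<noteq> 0" using degree_monic_char_poly[OF G] by auto
  with assms obtain z where "poly (char_poly (mat_adjoint C * C)) z = 0" and x: "x = sqrt (Re z)"
    unfolding sv_def eq by (auto simp: set_count_proots)
  then obtain v where "eigenvector (mat_adjoint C * C) v z"
    using eigenvalue_root_char_poly[OF G] by (auto simp: eigenvalue_def)
  then show thesis using x by (intro that[of C]) (auto simp: C_def)
qed

text \<open>For an eigenvector \<open>v\<close>, \<open>Re z\<close> times its squared length is the
  squared length of \<open>C *\<^sub>v v\<close>. A proof is required since \<open>sqrt\<close> of a
  negative real is negative. The result makes \<open>sigma_max B\<close> nonnegative in (b).\<close>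

lemma sv_nonneg:
  assumes "x \<in># sv B"
  shows "0 \<le> x"
proof -
  obtain C z v where ev: "eigenvector (mat_adjoint C * C) v z" and x: "x = sqrt (Re z)"
    using sv_obtain_eigenvector[OF assms] by metis
  let ?n = "dim_col C"
  have v: "v \<in> carrier_vec ?n" "v \<noteq> 0\<^sub>v ?n" and eq: "(mat_adjoint C * C) *\<^sub>v v = z \<cdot>\<^sub>v v"
    using ev by (auto simp: eigenvector_def)
  have C: "C \<in> carrier_mat (dim_row C) ?n" by simp
  have Cv: "C *\<^sub>v v \<in> carrier_vec (dim_row C)" by (auto intro!: carrier_vecI)
  have "(C *\<^sub>v v) \<bullet>c (C *\<^sub>v v) = v \<bullet>c (mat_adjoint C *\<^sub>v (C *\<^sub>v v))"
    by (rule cscalar_prod_adjoint[OF C v(1) Cv])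
  also have "mat_adjoint C *\<^sub>v (C *\<^sub>v v) = z \<cdot>\<^sub>v v"
    using eq assoc_mult_mat_vec[OF mat_adjoint_simps(5)[OF C] C v(1)] by simp
  also have "v \<bullet>c (z \<cdot>\<^sub>v v) = cnj z * (v \<bullet>c v)"
    using v by (simp add: conjugate_smult_vec)
  finally have "complex_of_real ((vec_norm2 (C *\<^sub>v v))\<^sup>2) = cnj z * of_real ((vec_norm2 v)\<^sup>2)"
    unfolding cscalar_prod_self .
  then have "(vec_norm2 (C *\<^sub>v v))\<^sup>2 = Re z * (vec_norm2 v)\<^sup>2"
    by (simp add: complex_eq_iff del: of_real_power)
  then have "0 \<le> Re z * (vec_norm2 v)\<^sup>2" by (metis zero_le_power2)
  moreover have "(vec_norm2 v)\<^sup>2 > 0" using vec_norm2_eq_0_iff[OF v(1)] v by simp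
  ultimately have "0 \<le> Re z" by (simp add: zero_le_mult_iff)
  then show ?thesis using x by simp
qed

lemma sv_nonempty:
  assumes "dim_row B > 0" "dim_col B > 0"
  shows "sv B \<noteq> {#}"
proof -
  let ?G = "if dim_col B \<le> dim_row B then mat_adjoint B * B else B * mat_adjoint B"
  have G: "?G \<in> carrier_mat (dim_row ?G) (dim_row ?G)" by (auto intro!: carrier_matI)
  have "dim_row ?G > 0" using assms by simp
  then obtain e where "eigenvalue ?G e" using exists_eigenvalue_complex[OF G] by blast
  then show ?thesis using sqrt_in_sv by fastforce
qed

text \<open>The two halves of an eigenvector are a pair of singular vectors, except that they are
  not normalized, \<open>\<mu>\<close> has either sign, and one of them may vanish.\<close>

lemma dilation_eigenvector:
  assumes B: "B \<in> carrier_mat s t" and ev: "eigenvalue (dilation B) (of_real \<mu>)"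
  obtains u w where "u \<in> carrier_vec s" "w \<in> carrier_vec t" "u \<noteq> 0\<^sub>v s \<or> w \<noteq> 0\<^sub>v t"
    "B *\<^sub>v w = of_real \<mu> \<cdot>\<^sub>v u" "mat_adjoint B *\<^sub>v u = of_real \<mu> \<cdot>\<^sub>v w"
proof -
  from ev obtain v where v: "v \<in> carrier_vec (s + t)" "v \<noteq> 0\<^sub>v (s + t)"
    and Hv: "dilation B *\<^sub>v v = of_real \<mu> \<cdot>\<^sub>v v"
    using dilation_carrier[OF B] by (auto simp: eigenvalue_def eigenvector_def)
  define u where "u = vec_first v s"
  define w where "w = vec_last v t"
  have uw: "u \<in> carrier_vec s" "w \<in> carrier_vec t" by (simp_all add: u_def w_def)
  have v_eq: "v = u @\<^sub>v w" using v by (simp add: u_def w_def)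
  have z: "0\<^sub>m s s *\<^sub>v u = 0\<^sub>v s" "0\<^sub>m t t *\<^sub>v w = 0\<^sub>v t"
    using uw by (auto intro!: eq_vecI simp: scalar_prod_def)
  have "dilation B *\<^sub>v v = (0\<^sub>m s s *\<^sub>v u + B *\<^sub>v w) @\<^sub>v (mat_adjoint B *\<^sub>v u + 0\<^sub>m t t *\<^sub>v w)"
    unfolding dilation_def v_eq using B uw by (subst four_block_mat_mult_vec[of _ s s _ t _ t]) auto
  also have "\<dots> = (B *\<^sub>v w) @\<^sub>v (mat_adjoint B *\<^sub>v u)"
    unfolding z using B uw by (auto intro!: eq_vecI)
  finally have prod: "dilation B *\<^sub>v v = (B *\<^sub>v w) @\<^sub>v (mat_adjoint B *\<^sub>v u)" .
  have sm: "of_real \<mu> \<cdot>\<^sub>v (u @\<^sub>v w) = (of_real \<mu> \<cdot>\<^sub>v u) @\<^sub>v (of_real \<mu> \<cdot>\<^sub>v w)"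
    by (intro eq_vecI) auto
  have "(B *\<^sub>v w) @\<^sub>v (mat_adjoint B *\<^sub>v u) = (of_real \<mu> \<cdot>\<^sub>v u) @\<^sub>v (of_real \<mu> \<cdot>\<^sub>v w)"
    using prod Hv sm by (simp only: v_eq)
  moreover have "B *\<^sub>v w \<in> carrier_vec s" "of_real \<mu> \<cdot>\<^sub>v u \<in> carrier_vec s"
    using B uw by (auto intro!: carrier_vecI)
  ultimately have "B *\<^sub>v w = of_real \<mu> \<cdot>\<^sub>v u" "mat_adjoint B *\<^sub>v u = of_real \<mu> \<cdot>\<^sub>v w"
    using append_vec_eq[of "B *\<^sub>v w" s] by auto
  moreover have "u \<noteq> 0\<^sub>v s \<or> w \<noteq> 0\<^sub>v t"
    using v(2) unfolding v_eq by (auto intro!: eq_vecI)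
  ultimately show thesis using uw that by blast
qed

lemma gram_eigenvalue:
  fixes C :: "complex mat"
  assumes C: "C \<in> carrier_mat m n" and u: "u \<in> carrier_vec m" and w: "w \<in> carrier_vec n" "w \<noteq> 0\<^sub>v n"
    and eq: "C *\<^sub>v w = of_real \<mu> \<cdot>\<^sub>v u" "mat_adjoint C *\<^sub>v u = of_real \<mu> \<cdot>\<^sub>v w"
  shows "eigenvalue (mat_adjoint C * C) (of_real (\<mu>\<^sup>2))"
proof -
  have "(mat_adjoint C * C) *\<^sub>v w = mat_adjoint C *\<^sub>v (C *\<^sub>v w)"
    using C w by (intro assoc_mult_mat_vec) auto
  also have "\<dots> = of_real \<mu> \<cdot>\<^sub>v (mat_adjoint C *\<^sub>v u)"
    unfolding eq(1) by (rule mult_mat_vec[OF mat_adjoint_simps(5)[OF C] u])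
  also have "\<dots> = of_real (\<mu>\<^sup>2) \<cdot>\<^sub>v w"
    unfolding eq(2) by (simp add: smult_smult_assoc power2_eq_square)
  finally show ?thesis using C w
    by (auto simp: eigenvalue_def eigenvector_def)
qed

text \<open>The half of the eigenvector that belongs to the smaller Gram matrix is a witness for
  \<open>\<mu>\<^sup>2\<close>, unless it vanishes. In that case \<open>\<mu> = 0\<close>, and 0 is
  in \<open>sv_ext B\<close> by padding if \<open>s \<noteq> t\<close> and by singularity of the
  Gram matrix if \<open>s = t\<close>.\<close>

lemma abs_in_sv_ext:
  assumes B: "B \<in> carrier_mat s t" and ev: "eigenvalue (dilation B) (of_real \<mu>)"
  shows "\<bar>\<mu>\<bar> \<in># sv_ext B"
proof -
  have dims: "dim_row B = s" "dim_col B = t" using B by auto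
  from dilation_eigenvector[OF B ev] obtain u w where u: "u \<in> carrier_vec s" and w: "w \<in> carrier_vec t"
    and nz: "u \<noteq> 0\<^sub>v s \<or> w \<noteq> 0\<^sub>v t"
    and eq: "B *\<^sub>v w = of_real \<mu> \<cdot>\<^sub>v u" "mat_adjoint B *\<^sub>v u = of_real \<mu> \<cdot>\<^sub>v w" .
  have B': "mat_adjoint B \<in> carrier_mat t s" using B by simp
  consider "t \<le> s" "w \<noteq> 0\<^sub>v t" | "s < t" "u \<noteq> 0\<^sub>v s" | "s \<noteq> t" "\<mu> = 0" | "s = t" "\<mu> = 0"
  proof -
    have "\<mu> = 0" if "w = 0\<^sub>v t" "u \<noteq> 0\<^sub>v s"
    proof -
      have "B *\<^sub>v 0\<^sub>v t = 0\<^sub>v s" using B by (intro eq_vecI) (auto simp: scalar_prod_def)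
      then have "of_real \<mu> * u $ i = 0" if "i < s" for i
        using eq(1) that u \<open>w = 0\<^sub>v t\<close> by (metis carrier_vecD index_smult_vec(1) index_zero_vec(1))
      moreover obtain i where "i < s" "u $ i \<noteq> 0"
        using \<open>u \<noteq> 0\<^sub>v s\<close> u by (metis carrier_vecD eq_vecI index_zero_vec)
      ultimately show ?thesis by auto
    qed
    moreover have "\<mu> = 0" if "u = 0\<^sub>v s" "w \<noteq> 0\<^sub>v t"
    proof -
      have "mat_adjoint B *\<^sub>v 0\<^sub>v s = 0\<^sub>v t" using B by (intro eq_vecI) (auto simp: scalar_prod_def)
      then have "of_real \<mu> * w $ i = 0" if "i < t" for i
        using eq(2) that w \<open>u = 0\<^sub>v s\<close> by (metis carrier_vecD index_smult_vec(1) index_zero_vec(1))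
      moreover obtain i where "i < t" "w $ i \<noteq> 0"
        using \<open>w \<noteq> 0\<^sub>v t\<close> w by (metis carrier_vecD eq_vecI index_zero_vec)
      ultimately show ?thesis by auto
    qed
    ultimately show thesis using nz that by fastforce
  qed
  then show ?thesis
  proof cases
    case 1
    then have "eigenvalue (mat_adjoint B * B) (of_real (\<mu>\<^sup>2))" using gram_eigenvalue[OF B u w _ eq] by simp
    then have "sqrt (Re (of_real (\<mu>\<^sup>2))) \<in># sv B" using 1 by (intro sqrt_in_sv) (simp add: dims)
    then show ?thesis by (simp add: sv_ext_def)
  next
    case 2
    then have "eigenvalue (B * mat_adjoint B) (of_real (\<mu>\<^sup>2))"
      using gram_eigenvalue[OF B' w u] eq by simp
    then have "sqrt (Re (of_real (\<mu>\<^sup>2))) \<in># sv B" using 2 by (intro sqrt_in_sv) (simp add: dims)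
    then show ?thesis by (simp add: sv_ext_def)
  next
    case 3
    then show ?thesis by (auto simp: sv_ext_def dims in_replicate_mset)
  next
    \<comment> \<open>The kernel vector may belong to \<open>mat_adjoint B\<close>, while
      \<open>sv\<close> looks at \<open>mat_adjoint B * B\<close>. Determinants transfer the
      singularity.\<close>
    case 4
    have G: "mat_adjoint B * B \<in> carrier_mat t t" using B by auto
    have Bt: "B \<in> carrier_mat t t" "mat_adjoint B \<in> carrier_mat t t" using 4 B B' by auto
    have "det B = 0 \<or> det (mat_adjoint B) = 0"
    proof (cases "w = 0\<^sub>v t")
      case True
      have "mat_adjoint B *\<^sub>v u = 0\<^sub>v t" unfolding eq(2) using 4 w by (auto intro!: eq_vecI)
      then show ?thesis using True nz u 4 det_0_iff_vec_prod_zero[OF Bt(2)] by auto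
    next
      case False
      have "B *\<^sub>v w = 0\<^sub>v t" unfolding eq(1) using 4 u by (auto intro!: eq_vecI)
      then show ?thesis using False w 4 det_0_iff_vec_prod_zero[OF Bt(1)] by auto
    qed
    then have "det (mat_adjoint B * B) = 0" using det_mult[OF Bt(2,1)] by auto
    then obtain v where "v \<in> carrier_vec t" "v \<noteq> 0\<^sub>v t" "(mat_adjoint B * B) *\<^sub>v v = 0\<^sub>v t"
      using det_0_iff_vec_prod_zero[OF G] by blast
    then have "eigenvalue (mat_adjoint B * B) 0"
      using G by (auto simp: eigenvalue_def eigenvector_def intro!: exI[of _ v])
    then have "sqrt (Re 0) \<in># sv B" using 4 by (intro sqrt_in_sv) (simp add: dims)
    then show ?thesis using 4 by (simp add: sv_ext_def)
  qed
qed

section \<open>Spectral and Frobenius norms\<close>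

lemma vec_norm2_triangle:
  "v \<in> carrier_vec n \<Longrightarrow> w \<in> carrier_vec n \<Longrightarrow> vec_norm2 (v + w) \<le> vec_norm2 v + vec_norm2 w"
proof -
  assume v: "v \<in> carrier_vec n" and w: "w \<in> carrier_vec n"
  have "vec_norm2 (v + w) \<le> L2_set (\<lambda>i. cmod (v $ i) + cmod (w $ i)) {..<n}"
    unfolding vec_norm2_def using v w by (auto intro!: L2_set_mono norm_triangle_ineq)
  also have "\<dots> \<le> vec_norm2 v + vec_norm2 w"
    unfolding vec_norm2_def using v w by (metis L2_set_triangle_ineq carrier_vecD)
  finally show ?thesis .
qed

lemma vec_norm2_smult: "vec_norm2 (c \<cdot>\<^sub>v v) = cmod c * vec_norm2 v"
proof -
  have "vec_norm2 (c \<cdot>\<^sub>v v) = L2_set (\<lambda>i. cmod c * cmod (v $ i)) {..<dim_vec v}"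
    unfolding vec_norm2_def by (intro L2_set_cong) (auto simp: norm_mult)
  then show ?thesis by (simp add: vec_norm2_def L2_set_right_distrib)
qed

lemma vec_norm2_zero [simp]: "vec_norm2 (0\<^sub>v n) = 0"
  by (simp add: vec_norm2_eq_0_iff[OF zero_carrier_vec])

lemma sum_lessThan_add:
  fixes f :: "nat \<Rightarrow> 'a::comm_monoid_add"
  shows "(\<Sum>i<m + n. f i) = (\<Sum>i<m. f i) + (\<Sum>i<n. f (m + i))"
  by (induction n) (simp_all add: add.assoc)

lemma vec_norm2_append: "(vec_norm2 (v @\<^sub>v w))\<^sup>2 = (vec_norm2 v)\<^sup>2 + (vec_norm2 w)\<^sup>2"
  by (simp add: vec_norm2_def L2_set_def sum_nonneg sum_lessThan_add)

text \<open>Cauchy-Schwarz, row by row. The supremum in the definition of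
  \<open>spectral_norm\<close> becomes an upper bound only once its set is known to be
  bounded.\<close>

lemma mult_mat_vec_bounded: "\<exists>K\<ge>0. \<forall>v\<in>carrier_vec (dim_col B). vec_norm2 (B *\<^sub>v v) \<le> K * vec_norm2 v"
proof -
  let ?K = "L2_set (\<lambda>i. vec_norm2 (row B i)) {..<dim_row B}"
  have "vec_norm2 (B *\<^sub>v v) \<le> ?K * vec_norm2 v" if v: "v \<in> carrier_vec (dim_col B)" for v
  proof -
    have "cmod ((B *\<^sub>v v) $ i) \<le> vec_norm2 (row B i) * vec_norm2 v" if i: "i < dim_row B" for i
    proof -
      have "cmod ((B *\<^sub>v v) $ i) \<le> (\<Sum>j<dim_col B. \<bar>cmod (row B i $ j)\<bar> * \<bar>cmod (v $ j)\<bar>)"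
        using i v by (auto simp: scalar_prod_def lessThan_atLeast0 norm_mult intro!: sum_norm_le)
      also have "\<dots> \<le> vec_norm2 (row B i) * vec_norm2 v"
        unfolding vec_norm2_def using v L2_set_mult_ineq[of "\<lambda>j. cmod (row B i $ j)" "\<lambda>j. cmod (v $ j)" "{..<dim_col B}"] by simp
      finally show ?thesis .
    qed
    then have "vec_norm2 (B *\<^sub>v v) \<le> L2_set (\<lambda>i. vec_norm2 (row B i) * vec_norm2 v) {..<dim_row B}"
      unfolding vec_norm2_def[of "B *\<^sub>v v"] by (auto intro!: L2_set_mono)
    then show ?thesis by (simp add: L2_set_left_distrib)
  qed
  then show ?thesis by (intro exI[of _ ?K]) simp
qed

lemma vec_norm2_mult_le:
  assumes B: "B \<in> carrier_mat p q" and v: "v \<in> carrier_vec q"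
  shows "vec_norm2 (B *\<^sub>v v) \<le> spectral_norm B * vec_norm2 v"
proof (cases "v = 0\<^sub>v q")
  case True
  then have "B *\<^sub>v v = 0\<^sub>v p" using B by (intro eq_vecI) (auto simp: scalar_prod_def)
  then show ?thesis using True by simp
next
  case False
  then have pos: "vec_norm2 v > 0" using vec_norm2_eq_0_iff[OF v] vec_norm2_nonneg[of v] by linarith
  obtain K where K: "K \<ge> 0" "\<And>v. v \<in> carrier_vec (dim_col B) \<Longrightarrow> vec_norm2 (B *\<^sub>v v) \<le> K * vec_norm2 v"
    using mult_mat_vec_bounded[of B] by blast
  let ?S = "{v \<in> carrier_vec (dim_col B). vec_norm2 v \<le> 1}"
  have bdd: "bdd_above ((\<lambda>v. vec_norm2 (B *\<^sub>v v)) ` ?S)"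
  proof (rule bdd_aboveI2)
    fix v assume "v \<in> ?S"
    then show "vec_norm2 (B *\<^sub>v v) \<le> K"
      using K(2)[of v] mult_left_mono[of "vec_norm2 v" 1 K] K(1) by auto
  qed
  define c where "c = complex_of_real (1 / vec_norm2 v)"
  have nc: "cmod c = 1 / vec_norm2 v" unfolding c_def norm_of_real using pos by simp
  have "c \<cdot>\<^sub>v v \<in> ?S" using B v pos by (auto simp: vec_norm2_smult nc)
  from cSUP_upper[OF this bdd] have "vec_norm2 (B *\<^sub>v (c \<cdot>\<^sub>v v)) \<le> spectral_norm B"
    by (simp add: spectral_norm_def)
  then have "vec_norm2 (B *\<^sub>v v) / vec_norm2 v \<le> spectral_norm B"
    using B v by (simp add: mult_mat_vec vec_norm2_smult nc)
  then show ?thesis using pos by (simp add: field_simps)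
qed

lemma spectral_norm_le:
  assumes B: "B \<in> carrier_mat p q" and "c \<ge> 0"
    and le: "\<And>v. v \<in> carrier_vec q \<Longrightarrow> vec_norm2 (B *\<^sub>v v) \<le> c * vec_norm2 v"
  shows "spectral_norm B \<le> c"
  unfolding spectral_norm_def
proof (rule cSUP_least)
  have "0\<^sub>v q \<in> {v \<in> carrier_vec (dim_col B). vec_norm2 v \<le> 1}" using B by simp
  then show "{v \<in> carrier_vec (dim_col B). vec_norm2 v \<le> 1} \<noteq> {}" by blast
next
  fix v assume "v \<in> {v \<in> carrier_vec (dim_col B). vec_norm2 v \<le> 1}"
  then have v: "v \<in> carrier_vec q" "vec_norm2 v \<le> 1" using B by auto
  then show "vec_norm2 (B *\<^sub>v v) \<le> c"
    using le[OF v(1)] mult_left_mono[OF v(2) \<open>c \<ge> 0\<close>] by simp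
qed

lemma spectral_norm_nonneg: "0 \<le> spectral_norm B"
proof (cases "\<exists>v\<in>carrier_vec (dim_col B). vec_norm2 v > 0")
  case True
  then obtain v where v: "v \<in> carrier_vec (dim_col B)" "vec_norm2 v > 0" by blast
  have "0 \<le> spectral_norm B * vec_norm2 v"
    using vec_norm2_mult_le[OF _ v(1), of B "dim_row B"] vec_norm2_nonneg[of "B *\<^sub>v v"] by (simp del: vec_norm2_nonneg)
  then show ?thesis using v by (simp add: zero_le_mult_iff)
next
  \<comment> \<open>This is the case of a matrix without columns, where the supremum runs over the
    empty vector alone.\<close>
  case False
  have z: "vec_norm2 (B *\<^sub>v v) = 0" if "v \<in> carrier_vec (dim_col B)" for v
  proof -
    have "vec_norm2 v = 0" using False that vec_norm2_nonneg[of v] by (auto simp: not_less order_antisym)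
    moreover have "vec_norm2 (B *\<^sub>v v) \<le> spectral_norm B * vec_norm2 v"
      using that by (intro vec_norm2_mult_le[of _ "dim_row B"]) auto
    ultimately show ?thesis using vec_norm2_nonneg[of "B *\<^sub>v v"] by (simp del: vec_norm2_nonneg)
  qed
  let ?S = "{v \<in> carrier_vec (dim_col B). vec_norm2 v \<le> 1}"
  have "(\<lambda>v. vec_norm2 (B *\<^sub>v v)) ` ?S = {0}" using z by (auto intro!: image_eqI[of _ _ "0\<^sub>v (dim_col B)"])
  then show ?thesis by (simp add: spectral_norm_def)
qed

lemma spectral_norm_eq_0_iff:
  assumes B: "B \<in> carrier_mat p q"
  shows "spectral_norm B = 0 \<longleftrightarrow> B = 0\<^sub>m p q"
proof
  assume 0: "spectral_norm B = 0"
  show "B = 0\<^sub>m p q"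
  proof (rule eq_matI)
    fix i j assume "i < dim_row (0\<^sub>m p q)" "j < dim_col (0\<^sub>m p q)"
    then have i: "i < p" and j: "j < q" by auto
    have "vec_norm2 (B *\<^sub>v unit_vec q j) \<le> 0"
      using vec_norm2_mult_le[OF B, of "unit_vec q j"] 0 by simp
    then have "vec_norm2 (B *\<^sub>v unit_vec q j) = 0" by (simp add: order_antisym)
    moreover have "B *\<^sub>v unit_vec q j \<in> carrier_vec p" using B by (auto intro!: carrier_vecI)
    ultimately have "B *\<^sub>v unit_vec q j = 0\<^sub>v p" using vec_norm2_eq_0_iff by blast
    moreover have "(B *\<^sub>v unit_vec q j) $ i = B $$ (i, j)"
      using B i j by (simp add: scalar_prod_right_unit)
    ultimately show "B $$ (i, j) = 0\<^sub>m p q $$ (i, j)" using i j by simp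
  qed (use B in auto)
next
  assume B0: "B = 0\<^sub>m p q"
  have "spectral_norm B \<le> 0"
  proof (rule spectral_norm_le[OF B])
    fix v :: "complex vec" assume "v \<in> carrier_vec q"
    then have "B *\<^sub>v v = 0\<^sub>v p" unfolding B0 by (intro eq_vecI) (auto simp: scalar_prod_def)
    then show "vec_norm2 (B *\<^sub>v v) \<le> 0 * vec_norm2 v" by simp
  qed simp
  then show "spectral_norm B = 0" using spectral_norm_nonneg[of B] by simp
qed

lemma spectral_norm_zero [simp]: "spectral_norm (0\<^sub>m p q) = 0"
  by (simp add: spectral_norm_eq_0_iff[OF zero_carrier_mat])

lemma spectral_norm_smult_le:
  "spectral_norm (c \<cdot>\<^sub>m B) \<le> cmod c * spectral_norm B"
proof (rule spectral_norm_le[of _ "dim_row B" "dim_col B"])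
  fix v :: "complex vec" assume v: "v \<in> carrier_vec (dim_col B)"
  have "(c \<cdot>\<^sub>m B) *\<^sub>v v = c \<cdot>\<^sub>v (B *\<^sub>v v)"
    using v by (intro eq_vecI) (auto simp: scalar_prod_def sum_distrib_left mult_ac)
  then show "vec_norm2 ((c \<cdot>\<^sub>m B) *\<^sub>v v) \<le> cmod c * spectral_norm B * vec_norm2 v"
    using vec_norm2_mult_le[OF _ v, of B "dim_row B"] by (simp add: vec_norm2_smult mult_left_mono mult.assoc)
qed (simp_all add: spectral_norm_nonneg)

lemma spectral_norm_smult: "spectral_norm (c \<cdot>\<^sub>m B) = cmod c * spectral_norm B"
proof (cases "c = 0")
  case True
  then have "c \<cdot>\<^sub>m B = 0\<^sub>m (dim_row B) (dim_col B)" by (intro eq_matI) auto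
  then show ?thesis using True by simp
next
  case False
  have "inverse c \<cdot>\<^sub>m (c \<cdot>\<^sub>m B) = B" using False by (intro eq_matI) auto
  then have "spectral_norm B \<le> inverse (cmod c) * spectral_norm (c \<cdot>\<^sub>m B)"
    using spectral_norm_smult_le[of "inverse c" "c \<cdot>\<^sub>m B"] by (simp add: norm_inverse)
  then have "cmod c * spectral_norm B \<le> spectral_norm (c \<cdot>\<^sub>m B)"
    using False by (simp add: field_simps)
  then show ?thesis using spectral_norm_smult_le[of c B] by simp
qed

lemma spectral_norm_triangle:
  assumes B: "B \<in> carrier_mat p q" and C: "C \<in> carrier_mat p q"
  shows "spectral_norm (B + C) \<le> spectral_norm B + spectral_norm C"
proof (rule spectral_norm_le[of _ p q])
  fix v :: "complex vec" assume v: "v \<in> carrier_vec q"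
  have "(B + C) *\<^sub>v v = B *\<^sub>v v + C *\<^sub>v v" using B C v by (rule add_mult_distrib_mat_vec)
  also have "vec_norm2 \<dots> \<le> vec_norm2 (B *\<^sub>v v) + vec_norm2 (C *\<^sub>v v)"
    using B C by (intro vec_norm2_triangle[of _ p]) (auto intro!: carrier_vecI)
  also have "\<dots> \<le> (spectral_norm B + spectral_norm C) * vec_norm2 v"
    using vec_norm2_mult_le[OF B v] vec_norm2_mult_le[OF C v] by (simp add: distrib_right)
  finally show "vec_norm2 ((B + C) *\<^sub>v v) \<le> (spectral_norm B + spectral_norm C) * vec_norm2 v" .
qed (use B C in \<open>auto simp: spectral_norm_nonneg\<close>)

lemma spectral_norm_unitary_le:
  assumes B: "B \<in> carrier_mat p q" and P: "P \<in> carrier_mat p p" "unitary_mat P"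
    and Q: "Q \<in> carrier_mat q q" "unitary_mat Q"
  shows "spectral_norm (P * B * Q) \<le> spectral_norm B"
proof (rule spectral_norm_le[of _ p q])
  fix v :: "complex vec" assume v: "v \<in> carrier_vec q"
  have Qv: "Q *\<^sub>v v \<in> carrier_vec q" using Q by (auto intro!: carrier_vecI)
  have "P * B * Q *\<^sub>v v = P *\<^sub>v (B *\<^sub>v (Q *\<^sub>v v))"
    using P B Q v Qv by (simp add: assoc_mult_mat_vec[of _ p q _ q] assoc_mult_mat_vec[of _ p p _ q])
  moreover have "B *\<^sub>v (Q *\<^sub>v v) \<in> carrier_vec p" using B by (auto intro!: carrier_vecI)
  ultimately have "vec_norm2 (P * B * Q *\<^sub>v v) = vec_norm2 (B *\<^sub>v (Q *\<^sub>v v))"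
    using vec_norm2_unitary[OF P(2,1)] by simp
  also have "\<dots> \<le> spectral_norm B * vec_norm2 v"
    using vec_norm2_mult_le[OF B Qv] vec_norm2_unitary[OF Q(2,1) v] by simp
  finally show "vec_norm2 (P * B * Q *\<^sub>v v) \<le> spectral_norm B * vec_norm2 v" .
qed (use B P Q in \<open>auto simp: spectral_norm_nonneg intro!: carrier_matI\<close>)

lemma spectral_norm_unitary:
  assumes B: "B \<in> carrier_mat p q" and P: "P \<in> carrier_mat p p" "unitary_mat P"
    and Q: "Q \<in> carrier_mat q q" "unitary_mat Q"
  shows "spectral_norm (P * B * Q) = spectral_norm B"
proof (rule antisym[OF spectral_norm_unitary_le[OF assms]])
  have [simp]: "dim_row P = p" "dim_col P = p" "dim_row Q = q" "dim_col Q = q" "dim_row B = p" "dim_col B = q"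
    using assms by auto
  have PBQ: "P * B * Q \<in> carrier_mat p q" by (intro carrier_matI) simp_all
  have "mat_adjoint P * (P * B * Q) * mat_adjoint Q = (mat_adjoint P * P) * B * (Q * mat_adjoint Q)"
    by (simp add: assoc_mult_mat_dim)
  also have "\<dots> = B" using unitary_matD[OF P(2,1)] unitary_matD[OF Q(2,1)] B by simp
  finally have eq: "mat_adjoint P * (P * B * Q) * mat_adjoint Q = B" .
  have "spectral_norm (mat_adjoint P * (P * B * Q) * mat_adjoint Q) \<le> spectral_norm (P * B * Q)"
    using P Q PBQ unitary_mat_adjoint[OF P(2,1)] unitary_mat_adjoint[OF Q(2,1)]
    by (intro spectral_norm_unitary_le[of _ p q]) auto
  then show "spectral_norm B \<le> spectral_norm (P * B * Q)" unfolding eq .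
qed

text \<open>The two halves of the image are orthogonal, so squared lengths add and the larger factor
  bounds both. For a general unitarily invariant norm the proof has only the sum of the block norms;
  the maximum preserves the constant \<open>pi / 2\<close> for the spectral norm in (c).\<close>

lemma spectral_norm_diag_block_le:
  assumes B: "B \<in> carrier_mat p q" and C: "C \<in> carrier_mat k l"
  shows "spectral_norm (four_block_mat B (0\<^sub>m p l) (0\<^sub>m k q) C) \<le> max (spectral_norm B) (spectral_norm C)"
    (is "spectral_norm ?M \<le> ?c")
proof (rule spectral_norm_le[of _ "p + k" "q + l"])
  have c: "0 \<le> ?c" using spectral_norm_nonneg[of B] by simp
  then show "0 \<le> ?c" .
  fix v :: "complex vec" assume v: "v \<in> carrier_vec (q + l)"
  define x where "x = vec_first v q"
  define y where "y = vec_last v l"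
  have x: "x \<in> carrier_vec q" and y: "y \<in> carrier_vec l" by (simp_all add: x_def y_def)
  have v_eq: "v = x @\<^sub>v y" using v by (simp add: x_def y_def)
  have z: "0\<^sub>m p l *\<^sub>v y = 0\<^sub>v p" "0\<^sub>m k q *\<^sub>v x = 0\<^sub>v k"
    using x y by (auto intro!: eq_vecI simp: scalar_prod_def)
  have "?M *\<^sub>v v = (B *\<^sub>v x) @\<^sub>v (C *\<^sub>v y)"
    unfolding v_eq using B C x y by (subst four_block_mat_mult_vec[of _ p q _ l _ k]) (auto simp: z)
  then have "(vec_norm2 (?M *\<^sub>v v))\<^sup>2 = (vec_norm2 (B *\<^sub>v x))\<^sup>2 + (vec_norm2 (C *\<^sub>v y))\<^sup>2"
    by (simp add: vec_norm2_append)
  also have "\<dots> \<le> (?c * vec_norm2 x)\<^sup>2 + (?c * vec_norm2 y)\<^sup>2"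
  proof (intro add_mono power_mono)
    have "spectral_norm B * vec_norm2 x \<le> ?c * vec_norm2 x" "spectral_norm C * vec_norm2 y \<le> ?c * vec_norm2 y"
      by (intro mult_right_mono; simp)+
    then show "vec_norm2 (B *\<^sub>v x) \<le> ?c * vec_norm2 x" "vec_norm2 (C *\<^sub>v y) \<le> ?c * vec_norm2 y"
      using vec_norm2_mult_le[OF B x] vec_norm2_mult_le[OF C y] by linarith+
  qed simp_all
  also have "\<dots> = (?c * vec_norm2 v)\<^sup>2"
    unfolding v_eq by (simp only: power_mult_distrib vec_norm2_append distrib_left)
  finally show "vec_norm2 (?M *\<^sub>v v) \<le> ?c * vec_norm2 v"
    by (rule power2_le_imp_le) (intro mult_nonneg_nonneg c vec_norm2_nonneg)
qed (use B C in auto)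

lemma spectral_norm_pad:
  assumes B: "B \<in> carrier_mat p q"
  shows "spectral_norm (four_block_mat B (0\<^sub>m p l) (0\<^sub>m k q) (0\<^sub>m k l)) = spectral_norm B"
    (is "spectral_norm ?M = _")
proof (rule antisym)
  show "spectral_norm ?M \<le> spectral_norm B"
    using spectral_norm_diag_block_le[OF B zero_carrier_mat[of k l]] spectral_norm_nonneg[of B] by simp
  have M: "?M \<in> carrier_mat (p + k) (q + l)" using B by simp
  show "spectral_norm B \<le> spectral_norm ?M"
  proof (rule spectral_norm_le[OF B spectral_norm_nonneg])
    fix v :: "complex vec" assume v: "v \<in> carrier_vec q"
    have "?M *\<^sub>v (v @\<^sub>v 0\<^sub>v l) = (B *\<^sub>v v) @\<^sub>v 0\<^sub>v k"
    proof -
      have "0\<^sub>m p l *\<^sub>v 0\<^sub>v l = (0\<^sub>v p :: complex vec)" "0\<^sub>m k q *\<^sub>v v = 0\<^sub>v k" "0\<^sub>m k l *\<^sub>v 0\<^sub>v l = (0\<^sub>v k :: complex vec)"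
        using v by (auto intro!: eq_vecI simp: scalar_prod_def)
      then show ?thesis using B v by (subst four_block_mat_mult_vec[of _ p q _ l _ k]) auto
    qed
    moreover have "vec_norm2 (w @\<^sub>v 0\<^sub>v m) = vec_norm2 w" for w m
    proof -
      have "(vec_norm2 (w @\<^sub>v 0\<^sub>v m))\<^sup>2 = (vec_norm2 w)\<^sup>2"
        by (simp add: vec_norm2_append)
      then show ?thesis by simp
    qed
    ultimately show "vec_norm2 (B *\<^sub>v v) \<le> spectral_norm ?M * vec_norm2 v"
      using vec_norm2_mult_le[OF M, of "v @\<^sub>v 0\<^sub>v l"] v by simp
  qed
qed

lemma unitarily_invariant_spectral_norm: "unitarily_invariant_norm spectral_norm"
  unfolding unitarily_invariant_norm_def
proof (intro conjI allI ballI impI)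
  fix p q :: nat and B P Q :: "complex mat"
  assume "B \<in> carrier_mat p q" "P \<in> carrier_mat p p" "Q \<in> carrier_mat q q" "unitary_mat P" "unitary_mat Q"
  then show "spectral_norm (mat_adjoint P * B * Q) = spectral_norm B"
    by (intro spectral_norm_unitary unitary_mat_adjoint) auto
qed (auto simp: spectral_norm_nonneg spectral_norm_eq_0_iff spectral_norm_smult
    intro: spectral_norm_triangle spectral_norm_pad)

text \<open>A unitary factor on the left acts on each column as an isometry. A factor on the right
  is reduced to this case by passing to the adjoint.\<close>

lemma frobenius_norm_sq_cols:
  "(frobenius_norm B)\<^sup>2 = (\<Sum>j<dim_col B. (vec_norm2 (col B j))\<^sup>2)"
proof -
  have "(frobenius_norm B)\<^sup>2 = (\<Sum>i<dim_row B. \<Sum>j<dim_col B. (cmod (B $$ (i, j)))\<^sup>2)"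
    by (simp add: frobenius_norm_def sum_nonneg)
  also have "\<dots> = (\<Sum>j<dim_col B. \<Sum>i<dim_row B. (cmod (B $$ (i, j)))\<^sup>2)" by (rule sum.swap)
  also have "\<dots> = (\<Sum>j<dim_col B. (vec_norm2 (col B j))\<^sup>2)"
    by (auto simp: vec_norm2_def L2_set_def sum_nonneg intro!: sum.cong)
  finally show ?thesis .
qed

lemma frobenius_norm_nonneg: "0 \<le> frobenius_norm B"
  by (simp add: frobenius_norm_def sum_nonneg)

lemma frobenius_norm_adjoint: "frobenius_norm (mat_adjoint B) = frobenius_norm B"
proof -
  have "(\<Sum>i<dim_col B. \<Sum>j<dim_row B. (cmod (B $$ (j, i)))\<^sup>2) = (\<Sum>j<dim_row B. \<Sum>i<dim_col B. (cmod (B $$ (j, i)))\<^sup>2)"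
    by (rule sum.swap)
  then show ?thesis by (simp add: frobenius_norm_def)
qed

lemma frobenius_norm_unitary_left:
  assumes B: "B \<in> carrier_mat p q" and P: "P \<in> carrier_mat p p" "unitary_mat P"
  shows "frobenius_norm (P * B) = frobenius_norm B"
proof -
  have "(frobenius_norm (P * B))\<^sup>2 = (\<Sum>j<dim_col (P * B). (vec_norm2 (col (P * B) j))\<^sup>2)"
    by (rule frobenius_norm_sq_cols)
  also have "dim_col (P * B) = q" using B by simp
  also have "(\<Sum>j<q. (vec_norm2 (col (P * B) j))\<^sup>2) = (\<Sum>j<q. (vec_norm2 (P *\<^sub>v col B j))\<^sup>2)"
    by (rule sum.cong) (simp_all only: lessThan_iff col_mult2[OF P(1) B])
  also have "\<dots> = (frobenius_norm B)\<^sup>2"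
    unfolding frobenius_norm_sq_cols using B vec_norm2_unitary[OF P(2,1)] by (auto intro!: sum.cong carrier_vecI)
  finally show ?thesis using frobenius_norm_nonneg by (simp add: frobenius_norm_nonneg)
qed

lemma frobenius_norm_unitary:
  assumes B: "B \<in> carrier_mat p q" and P: "P \<in> carrier_mat p p" "unitary_mat P"
    and Q: "Q \<in> carrier_mat q q" "unitary_mat Q"
  shows "frobenius_norm (P * B * Q) = frobenius_norm B"
proof -
  have [simp]: "dim_row P = p" "dim_col P = p" "dim_row Q = q" "dim_col Q = q" "dim_row B = p" "dim_col B = q"
    using assms by auto
  have PB: "mat_adjoint (P * B) \<in> carrier_mat q p" by (intro carrier_matI) simp_all
  have "frobenius_norm (P * B * Q) = frobenius_norm (mat_adjoint Q * mat_adjoint (P * B))"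
    by (subst frobenius_norm_adjoint[symmetric]) (simp add: mat_adjoint_mult_dim)
  also have "\<dots> = frobenius_norm (mat_adjoint (P * B))"
    using Q by (intro frobenius_norm_unitary_left[OF PB] unitary_mat_adjoint) auto
  also have "\<dots> = frobenius_norm B"
    unfolding frobenius_norm_adjoint by (rule frobenius_norm_unitary_left[OF B P])
  finally show ?thesis .
qed

lemma frobenius_norm_four_block:
  assumes "A \<in> carrier_mat m1 n1" "B \<in> carrier_mat m1 n2" "C \<in> carrier_mat m2 n1" "D \<in> carrier_mat m2 n2"
  shows "(frobenius_norm (four_block_mat A B C D))\<^sup>2 =
    (frobenius_norm A)\<^sup>2 + (frobenius_norm B)\<^sup>2 + (frobenius_norm C)\<^sup>2 + (frobenius_norm D)\<^sup>2"
  using assms by (simp add: frobenius_norm_def sum_nonneg sum_lessThan_add sum.distrib)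

section \<open>Sylvester equations\<close>

lemma unitary_cancel_left:
  assumes "unitary_mat U" "U \<in> carrier_mat n n" "dim_row X = n"
  shows "mat_adjoint U * (U * X) = X" "U * (mat_adjoint U * X) = X"
proof -
  have X: "X \<in> carrier_mat n (dim_col X)" using assms by auto
  have [simp]: "dim_row U = n" "dim_col U = n" using assms by auto
  have "mat_adjoint U * (U * X) = (mat_adjoint U * U) * X" "U * (mat_adjoint U * X) = (U * mat_adjoint U) * X"
    using assms(3) by (simp_all add: assoc_mult_mat_dim)
  then show "mat_adjoint U * (U * X) = X" "U * (mat_adjoint U * X) = X"
    using unitary_matD[OF assms(1,2)] X by simp_all
qed

section \<open>The Sylvester operator in eigenbases\<close>

context
  fixes U W H K :: "complex mat" and a b :: "nat \<Rightarrow> real" and p q :: nat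
  assumes U: "U \<in> carrier_mat q q" "unitary_mat U" and W: "W \<in> carrier_mat p p" "unitary_mat W"
    and H: "H = U * mat_diag q (\<lambda>i. of_real (a i)) * mat_adjoint U"
    and K: "K = W * mat_diag p (\<lambda>i. of_real (b i)) * mat_adjoint W"
begin

lemma dims_diagonalized [simp]:
  "dim_row U = q" "dim_col U = q" "dim_row W = p" "dim_col W = p"
  "dim_row H = q" "dim_col H = q" "dim_row K = p" "dim_col K = p"
  using U W by (auto simp: H K)

text \<open>In the two eigenbases the map \<open>Z \<mapsto> Z * H - K * Z\<close> is the Schur
  multiplier with symbol \<open>a j - b i\<close>. Existence, uniqueness, (a) and (c) all rest on
  this identity.\<close>

lemma sylvester_diagonalized:
  assumes Z: "Z \<in> carrier_mat p q"
  shows "mat_adjoint W * (Z * H - K * Z) * U =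
    mat p q (\<lambda>(i, j). (mat_adjoint W * Z * U) $$ (i, j) * of_real (a j - b i))"
proof -
  let ?Da = "mat_diag q (\<lambda>i. complex_of_real (a i))" and ?Db = "mat_diag p (\<lambda>i. complex_of_real (b i))"
  let ?Z = "mat_adjoint W * Z * U"
  have [simp]: "dim_row Z = p" "dim_col Z = q" using Z by auto
  have c: "mat_adjoint W \<in> carrier_mat p p" "Z * H \<in> carrier_mat p q" "K * Z \<in> carrier_mat p q"
    "mat_adjoint W * (Z * H) \<in> carrier_mat p q" "mat_adjoint W * (K * Z) \<in> carrier_mat p q"
    "?Z \<in> carrier_mat p q"
    by (auto intro!: carrier_matI)
  have "mat_adjoint W * (Z * H - K * Z) * U = mat_adjoint W * (Z * H) * U - mat_adjoint W * (K * Z) * U"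
    using mult_minus_distrib_mat[OF c(1-3)] minus_mult_distrib_mat[OF c(4,5) U(1)] by simp
  also have "mat_adjoint W * (Z * H) * U = ?Z * ?Da"
    using unitary_matD[OF U(2,1)] unfolding H
    by (simp add: assoc_mult_mat_dim)
  also have "mat_adjoint W * (K * Z) * U = ?Db * ?Z"
    unfolding K by (simp add: assoc_mult_mat_dim unitary_cancel_left[OF W(2,1)])
  also have "?Z * ?Da - ?Db * ?Z = mat p q (\<lambda>(i, j). ?Z $$ (i, j) * of_real (a j - b i))"
    unfolding mat_diag_mult_left[OF c(6)] mat_diag_mult_right[OF c(6)]
    by (intro eq_matI) (auto simp: algebra_simps)
  finally show ?thesis .
qed

lemma unitary_transform_cancel:
  assumes M: "M \<in> carrier_mat p q"
  shows "W * (mat_adjoint W * M * U) * mat_adjoint U = M" "mat_adjoint W * (W * M * mat_adjoint U) * U = M"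
proof -
  have [simp]: "dim_row M = p" "dim_col M = q" using M by auto
  show "W * (mat_adjoint W * M * U) * mat_adjoint U = M"
    using M by (simp add: assoc_mult_mat_dim unitary_matD[OF U(2,1)] unitary_cancel_left[OF W(2,1)])
  show "mat_adjoint W * (W * M * mat_adjoint U) * U = M"
    using M by (simp add: assoc_mult_mat_dim unitary_matD[OF U(2,1)] unitary_cancel_left[OF W(2,1)])
qed

lemma sylvester_exists:
  assumes R: "R \<in> carrier_mat p q" and gap: "\<And>i j. i < p \<Longrightarrow> j < q \<Longrightarrow> a j \<noteq> b i"
  shows "\<exists>Z\<in>carrier_mat p q. Z * H - K * Z = R"
proof
  define Z' where "Z' = mat p q (\<lambda>(i, j). (mat_adjoint W * R * U) $$ (i, j) / of_real (a j - b i))"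
  define Z where "Z = W * Z' * mat_adjoint U"
  have Z': "Z' \<in> carrier_mat p q" by (simp add: Z'_def)
  then have [simp]: "dim_row Z' = p" "dim_col Z' = q" by auto
  show Z: "Z \<in> carrier_mat p q" by (auto simp: Z_def intro!: carrier_matI)
  have [simp]: "dim_row R = p" "dim_col R = q" "dim_row Z = p" "dim_col Z = q" using R Z by auto
  have ZHK: "Z * H - K * Z \<in> carrier_mat p q" by (auto intro!: carrier_matI)
  have "mat_adjoint W * (Z * H - K * Z) * U = mat p q (\<lambda>(i, j). Z' $$ (i, j) * of_real (a j - b i))"
    unfolding sylvester_diagonalized[OF Z] by (simp only: Z_def unitary_transform_cancel(2)[OF Z'])
  also have "\<dots> = mat_adjoint W * R * U"
    using gap by (intro eq_matI) (auto simp: Z'_def)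
  finally have eq: "mat_adjoint W * (Z * H - K * Z) * U = mat_adjoint W * R * U" .
  have "Z * H - K * Z = W * (mat_adjoint W * (Z * H - K * Z) * U) * mat_adjoint U"
    by (rule unitary_transform_cancel(1)[OF ZHK, symmetric])
  also have "\<dots> = R" unfolding eq by (rule unitary_transform_cancel(1)[OF R])
  finally show "Z * H - K * Z = R" .
qed

lemma sylvester_unique:
  assumes Z: "Z \<in> carrier_mat p q" and Z': "Z' \<in> carrier_mat p q"
    and gap: "\<And>i j. i < p \<Longrightarrow> j < q \<Longrightarrow> a j \<noteq> b i"
    and eq: "Z * H - K * Z = Z' * H - K * Z'"
  shows "Z = Z'"
proof -
  let ?M = "mat_adjoint W * Z * U" and ?M' = "mat_adjoint W * Z' * U"
  have "?M = ?M'"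
  proof (rule eq_matI)
    fix i j assume "i < dim_row ?M'" "j < dim_col ?M'"
    then have ij: "i < p" "j < q" by simp_all
    have "mat p q (\<lambda>(i, j). ?M $$ (i, j) * of_real (a j - b i)) = mat p q (\<lambda>(i, j). ?M' $$ (i, j) * of_real (a j - b i))"
      unfolding sylvester_diagonalized[OF Z, symmetric] sylvester_diagonalized[OF Z', symmetric] eq ..
    from arg_cong[OF this, of "\<lambda>M. M $$ (i, j)"]
    have "?M $$ (i, j) * of_real (a j - b i) = ?M' $$ (i, j) * of_real (a j - b i)"
      using ij by (simp only: index_mat prod.case)
    then show "?M $$ (i, j) = ?M' $$ (i, j)" using gap[OF ij] by (simp del: of_real_diff)
  qed simp_all
  then show ?thesis
    using unitary_transform_cancel(1)[OF Z] unitary_transform_cancel(1)[OF Z'] by argo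
qed

lemma ui_norm_transform:
  assumes "unitarily_invariant_norm N" "M \<in> carrier_mat p q"
  shows "N (mat_adjoint W * M * U) = N M"
  using assms U unitary_mat_adjoint[OF W(2,1)] W by (intro ui_norm_unitary[of N _ p q]) auto

lemma ui_norm_sylvester_le:
  assumes ui: "unitarily_invariant_norm N" and Z: "Z \<in> carrier_mat p q"
    and "\<delta> > 0" and gap: "\<And>i j. i < p \<Longrightarrow> j < q \<Longrightarrow> \<delta> \<le> \<bar>a j - b i\<bar>"
  shows "N Z \<le> pi / 2 * (1 / \<delta>) * N (Z * H - K * Z)"
proof -
  have [simp]: "dim_row Z = p" "dim_col Z = q" using Z by auto
  have c: "mat_adjoint W * Z * U \<in> carrier_mat p q" "Z * H - K * Z \<in> carrier_mat p q"
    by (auto intro!: carrier_matI)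
  have "N Z = N (mat_adjoint W * Z * U)" using ui_norm_transform[OF ui Z] by simp
  also have "\<dots> \<le> pi / 2 * (1 / \<delta>) * N (mat_adjoint W * (Z * H - K * Z) * U)"
    unfolding sylvester_diagonalized[OF Z]
    by (rule ui_norm_multiplier_le[OF ui c(1) \<open>\<delta> > 0\<close> gap])
  also have "N (mat_adjoint W * (Z * H - K * Z) * U) = N (Z * H - K * Z)"
    by (rule ui_norm_transform[OF ui c(2)])
  finally show ?thesis .
qed

lemma frobenius_norm_sylvester_le:
  assumes Z: "Z \<in> carrier_mat p q"
    and "\<delta> > 0" and gap: "\<And>i j. i < p \<Longrightarrow> j < q \<Longrightarrow> \<delta> \<le> \<bar>a j - b i\<bar>"
  shows "frobenius_norm Z \<le> 1 / \<delta> * frobenius_norm (Z * H - K * Z)"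
proof -
  have [simp]: "dim_row Z = p" "dim_col Z = q" using Z by auto
  let ?Z = "mat_adjoint W * Z * U" and ?R = "mat_adjoint W * (Z * H - K * Z) * U"
  have c: "?Z \<in> carrier_mat p q" "Z * H - K * Z \<in> carrier_mat p q"
    by (auto intro!: carrier_matI)
  have fro: "frobenius_norm (mat_adjoint W * M * U) = frobenius_norm M" if "M \<in> carrier_mat p q" for M
    using that U unitary_mat_adjoint[OF W(2,1)] W by (intro frobenius_norm_unitary[of _ p q]) auto
  have "(\<delta> * frobenius_norm ?Z)\<^sup>2 = (\<Sum>i<p. \<Sum>j<q. (\<delta> * cmod (?Z $$ (i, j)))\<^sup>2)"
    unfolding power_mult_distrib frobenius_norm_def
    by (simp add: sum_nonneg sum_distrib_left)
  also have "\<dots> \<le> (\<Sum>i<p. \<Sum>j<q. (cmod (?R $$ (i, j)))\<^sup>2)"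
  proof (intro sum_mono power_mono)
    fix i j assume "i \<in> {..<p}" "j \<in> {..<q}"
    then have ij: "i < p" "j < q" by auto
    have "\<delta> * cmod (?Z $$ (i, j)) \<le> \<bar>a j - b i\<bar> * cmod (?Z $$ (i, j))"
      using gap[OF ij] by (intro mult_right_mono) auto
    also have "\<dots> = cmod (?R $$ (i, j))"
      unfolding sylvester_diagonalized[OF Z] using ij
      by (simp add: norm_mult mult.commute del: of_real_diff)
    finally show "\<delta> * cmod (?Z $$ (i, j)) \<le> cmod (?R $$ (i, j))" .
  qed (use \<open>\<delta> > 0\<close> in auto)
  also have "\<dots> = (frobenius_norm ?R)\<^sup>2"
    by (simp add: frobenius_norm_def sum_nonneg)
  finally have "\<delta> * frobenius_norm ?Z \<le> frobenius_norm ?R"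
    by (rule power2_le_imp_le) (rule frobenius_norm_nonneg)
  then show ?thesis unfolding fro[OF Z] fro[OF c(2)] using \<open>\<delta> > 0\<close> by (simp add: field_simps)
qed

lemma ui_norm_hermitian_mult_le:
  assumes ui: "unitarily_invariant_norm N" and Z: "Z \<in> carrier_mat p q"
    and "0 \<le> \<tau>" and b: "\<And>i. i < p \<Longrightarrow> \<bar>b i\<bar> \<le> \<tau>"
  shows "N (K * Z) \<le> \<tau> * N Z"
proof -
  have [simp]: "dim_row Z = p" "dim_col Z = q" using Z by auto
  let ?D = "mat_diag p (\<lambda>i. complex_of_real (b i))"
  have c: "mat_adjoint W * Z \<in> carrier_mat p q" "?D * (mat_adjoint W * Z) \<in> carrier_mat p q"
    by (auto intro!: carrier_matI)
  have "K * Z = W * (?D * (mat_adjoint W * Z))" by (simp add: K assoc_mult_mat_dim)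
  then have "N (K * Z) = N (?D * (mat_adjoint W * Z))"
    using ui_norm_unitary_left[OF ui c(2) W] by simp
  also have "\<dots> \<le> \<tau> * N (mat_adjoint W * Z)"
    by (rule ui_norm_diag_mult_le[OF ui c(1) \<open>0 \<le> \<tau>\<close> b])
  also have "N (mat_adjoint W * Z) = N Z"
    using W unitary_mat_adjoint[OF W(2,1)] by (intro ui_norm_unitary_left[OF ui Z]) auto
  finally show ?thesis .
qed

text \<open>A lower bound for multiplication by \<open>H\<close> is an upper bound for
  multiplication by its inverse, whose eigenvalues are at most \<open>1 / \<sigma>\<close> in
  absolute value.\<close>

lemma ui_norm_le_mult_hermitian:
  assumes ui: "unitarily_invariant_norm N" and Z: "Z \<in> carrier_mat p q"
    and "0 < \<sigma>" and a: "\<And>j. j < q \<Longrightarrow> \<sigma> \<le> \<bar>a j\<bar>"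
  shows "\<sigma> * N Z \<le> N (Z * H)"
proof -
  have [simp]: "dim_row Z = p" "dim_col Z = q" using Z by auto
  let ?D = "mat_diag q (\<lambda>i. complex_of_real (a i))"
  let ?E = "mat_diag q (\<lambda>i. complex_of_real (inverse (a i)))"
  have c: "Z * U * ?D \<in> carrier_mat p q" "Z * U \<in> carrier_mat p q" by (auto intro!: carrier_matI)
  have "a j \<noteq> 0" if "j < q" for j using a[OF that] \<open>0 < \<sigma>\<close> by auto
  then have "?D * ?E = 1\<^sub>m q"
    unfolding mat_diag_diag by (intro eq_matI) (auto simp: mat_diag_def)
  then have "Z * U * ?D * ?E = Z * U" using c(2) by (simp add: assoc_mult_mat_dim)
  then have "N Z = N (Z * U * ?D * ?E)"
    using ui_norm_unitary_right[OF ui Z U] by simp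
  also have "\<dots> \<le> inverse \<sigma> * N (Z * U * ?D)"
    using a \<open>0 < \<sigma>\<close> by (intro ui_norm_mult_diag_le[OF ui c(1)]) (auto simp: le_imp_inverse_le)
  also have "N (Z * U * ?D) = N (Z * U * ?D * mat_adjoint U)"
    using U unitary_mat_adjoint[OF U(2,1)] by (intro ui_norm_unitary_right[OF ui c(1), symmetric]) auto
  also have "Z * U * ?D * mat_adjoint U = Z * H" by (simp add: H assoc_mult_mat_dim)
  finally show ?thesis using \<open>0 < \<sigma>\<close> by (simp add: field_simps)
qed

end

section \<open>Norms of block matrices\<close>

definition swap_mat :: "nat \<Rightarrow> nat \<Rightarrow> complex mat" where
  "swap_mat n m = four_block_mat (0\<^sub>m m n) (1\<^sub>m m) (1\<^sub>m n) (0\<^sub>m n m)"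

lemma swap_mat_carrier: "swap_mat n m \<in> carrier_mat (n + m) (n + m)"
  by (auto simp: swap_mat_def intro!: carrier_matI)

lemma unitary_swap_mat: "unitary_mat (swap_mat n m)"
proof (rule unitary_matI[OF swap_mat_carrier])
  have "mat_adjoint (swap_mat n m) = four_block_mat (0\<^sub>m n m) (1\<^sub>m n) (1\<^sub>m m) (0\<^sub>m m n)"
    unfolding swap_mat_def by (subst mat_adjoint_four_block[of _ m n _ m _ n]) (auto intro!: cong_four_block_mat eq_matI)
  then show "mat_adjoint (swap_mat n m) * swap_mat n m = 1\<^sub>m (n + m)"
    by (simp add: swap_mat_def mult_four_block_mat[of _ n m _ n _ m _ _ n _ m])
qed

lemma ui_norm_swap_rows:
  assumes ui: "unitarily_invariant_norm N" and "A \<in> carrier_mat n k" "B \<in> carrier_mat n l"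
    and "C \<in> carrier_mat m k" "D \<in> carrier_mat m l"
  shows "N (four_block_mat C D A B) = N (four_block_mat A B C D)"
proof -
  have "swap_mat n m * four_block_mat A B C D = four_block_mat C D A B"
    unfolding swap_mat_def using assms by (subst mult_four_block_mat[of _ m n _ m _ n _ _ k _ l]) auto
  moreover have "four_block_mat A B C D \<in> carrier_mat (n + m) (k + l)" using assms by simp
  ultimately show ?thesis
    using ui_norm_unitary_left[OF ui _ swap_mat_carrier unitary_swap_mat] by metis
qed

lemma ui_norm_swap_cols:
  assumes ui: "unitarily_invariant_norm N" and "A \<in> carrier_mat n k" "B \<in> carrier_mat n l"
    and "C \<in> carrier_mat m k" "D \<in> carrier_mat m l"
  shows "N (four_block_mat B A D C) = N (four_block_mat A B C D)"
proof -
  have "four_block_mat A B C D * swap_mat l k = four_block_mat B A D C"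
    unfolding swap_mat_def using assms by (subst mult_four_block_mat[of _ n k _ l _ m _ _ l _ k]) auto
  moreover have "four_block_mat A B C D \<in> carrier_mat (n + m) (l + k)"
    using assms by (simp add: add.commute[of l k])
  ultimately show ?thesis
    using ui_norm_unitary_right[OF ui _ swap_mat_carrier unitary_swap_mat] by metis
qed

text \<open>The padding axiom speaks only of a block in the upper left corner. Exchanging block rows
  or block columns is unitary and brings every block there.\<close>

lemma ui_norm_single_block:
  assumes ui: "unitarily_invariant_norm N" and M: "M \<in> carrier_mat n k"
  shows "N (four_block_mat M (0\<^sub>m n l) (0\<^sub>m m k) (0\<^sub>m m l)) = N M"
    "N (four_block_mat (0\<^sub>m n l) M (0\<^sub>m m l) (0\<^sub>m m k)) = N M"
    "N (four_block_mat (0\<^sub>m m k) (0\<^sub>m m l) M (0\<^sub>m n l)) = N M"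
    "N (four_block_mat (0\<^sub>m m l) (0\<^sub>m m k) (0\<^sub>m n l) M) = N M"
proof -
  show 1: "N (four_block_mat M (0\<^sub>m n l) (0\<^sub>m m k) (0\<^sub>m m l)) = N M"
    by (rule ui_norm_pad[OF ui M])
  show 2: "N (four_block_mat (0\<^sub>m n l) M (0\<^sub>m m l) (0\<^sub>m m k)) = N M"
    using ui_norm_swap_cols[OF ui M, of "0\<^sub>m n l" l "0\<^sub>m m k" m "0\<^sub>m m l"] 1 by simp
  show "N (four_block_mat (0\<^sub>m m k) (0\<^sub>m m l) M (0\<^sub>m n l)) = N M"
    using ui_norm_swap_rows[OF ui M, of "0\<^sub>m n l" l "0\<^sub>m m k" m "0\<^sub>m m l"] 1 by simp
  show "N (four_block_mat (0\<^sub>m m l) (0\<^sub>m m k) (0\<^sub>m n l) M) = N M"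
    using ui_norm_swap_rows[OF ui, of "0\<^sub>m n l" n l M k "0\<^sub>m m l" m "0\<^sub>m m k"] M 2 by simp
qed

text \<open>Deleting a block row is multiplication by a diagonal projection, which is a contraction;
  this gives the first two bounds. The third is the triangle inequality and costs the factor 2
  between \<open>pi / 2\<close> and \<open>pi\<close> in (c).\<close>

lemma ui_norm_diag_blocks:
  assumes ui: "unitarily_invariant_norm N" and X: "X \<in> carrier_mat n k" and Y: "Y \<in> carrier_mat m l"
  shows "N X \<le> N (four_block_mat X (0\<^sub>m n l) (0\<^sub>m m k) Y)"
    "N Y \<le> N (four_block_mat X (0\<^sub>m n l) (0\<^sub>m m k) Y)"
    "N (four_block_mat X (0\<^sub>m n l) (0\<^sub>m m k) Y) \<le> N X + N Y"
proof -
  let ?Z = "four_block_mat X (0\<^sub>m n l) (0\<^sub>m m k) Y"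
  let ?X = "four_block_mat X (0\<^sub>m n l) (0\<^sub>m m k) (0\<^sub>m m l)" and ?Y = "four_block_mat (0\<^sub>m n k) (0\<^sub>m n l) (0\<^sub>m m k) Y"
  have Z: "?Z \<in> carrier_mat (n + m) (k + l)" using X Y by simp
  have "mat_diag (n + m) (\<lambda>i. complex_of_real (of_bool (i < n))) * ?Z = ?X"
    using X Y by (subst mat_diag_mult_left[OF Z]) (auto intro!: eq_matI)
  moreover have "N (mat_diag (n + m) (\<lambda>i. complex_of_real (of_bool (i < n))) * ?Z) \<le> 1 * N ?Z"
    by (rule ui_norm_diag_mult_le[OF ui Z]) auto
  ultimately show "N X \<le> N ?Z" using ui_norm_single_block(1)[OF ui X, where l = l and m = m] by simp
  have "mat_diag (n + m) (\<lambda>i. complex_of_real (of_bool (\<not> i < n))) * ?Z = ?Y"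
    using X Y by (subst mat_diag_mult_left[OF Z]) (auto intro!: eq_matI)
  moreover have "N (mat_diag (n + m) (\<lambda>i. complex_of_real (of_bool (\<not> i < n))) * ?Z) \<le> 1 * N ?Z"
    by (rule ui_norm_diag_mult_le[OF ui Z]) auto
  ultimately show "N Y \<le> N ?Z" using ui_norm_single_block(4)[OF ui Y, where m = n and l = k] by simp
  have "?Z = ?X + ?Y" using X Y by (intro eq_matI) auto
  then show "N ?Z \<le> N X + N Y"
    using ui_norm_triangle[OF ui, of ?X "n + m" "k + l" ?Y] X Y
      ui_norm_single_block(1)[OF ui X, where l = l and m = m] ui_norm_single_block(4)[OF ui Y, where m = n and l = k] by simp
qed

section \<open>The dilated equation\<close>

lemma mult_dilation:
  assumes "A \<in> carrier_mat r r" "X \<in> carrier_mat s r" "P \<in> carrier_mat s r"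
    and "Q \<in> carrier_mat t r" "Y \<in> carrier_mat t r"
  shows "four_block_mat X P Q Y * dilation A =
    four_block_mat (P * mat_adjoint A) (X * A) (Y * mat_adjoint A) (Q * A)"
  unfolding dilation_def using assms
  by (subst mult_four_block_mat[of _ s r _ r _ t _ _ r _ r]) (auto intro!: cong_four_block_mat)

lemma dilation_mult:
  assumes "B \<in> carrier_mat s t" "X \<in> carrier_mat s r" "P \<in> carrier_mat s r"
    and "Q \<in> carrier_mat t r" "Y \<in> carrier_mat t r"
  shows "dilation B * four_block_mat X P Q Y =
    four_block_mat (B * Q) (B * Y) (mat_adjoint B * X) (mat_adjoint B * P)"
  unfolding dilation_def using assms
  by (subst mult_four_block_mat[of _ s s _ t _ t _ _ r _ r]) (auto intro!: cong_four_block_mat)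

text \<open>\<open>X\<close> and \<open>Y\<close> occur only in the off-diagonal blocks of the
  result, \<open>P\<close> and \<open>Q\<close> only in the diagonal ones. So the system decouples,
  and every solution of the dilated equation contains a solution pair, whatever its blocks
  \<open>P\<close> and \<open>Q\<close> are.\<close>

lemma sylvester_dilation:
  assumes "A \<in> carrier_mat r r" "B \<in> carrier_mat s t" "X \<in> carrier_mat s r" "P \<in> carrier_mat s r"
    and "Q \<in> carrier_mat t r" "Y \<in> carrier_mat t r"
  shows "four_block_mat X P Q Y * dilation A - dilation B * four_block_mat X P Q Y =
    four_block_mat (P * mat_adjoint A - B * Q) (X * A - B * Y)
      (Y * mat_adjoint A - mat_adjoint B * X) (Q * A - mat_adjoint B * P)"
proof -
  have dims: "dim_row A = r" "dim_col A = r" "dim_row B = s" "dim_col B = t" "dim_row X = s" "dim_col X = r"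
    "dim_row P = s" "dim_col P = r" "dim_row Q = t" "dim_col Q = r" "dim_row Y = t" "dim_col Y = r"
    using assms by auto
  have minus: "four_block_mat A1 B1 C1 D1 - four_block_mat A2 B2 C2 D2 =
      four_block_mat (A1 - A2) (B1 - B2) (C1 - C2) (D1 - D2 :: complex mat)"
    if "A1 \<in> carrier_mat s r" "A2 \<in> carrier_mat s r" "B1 \<in> carrier_mat s r" "B2 \<in> carrier_mat s r"
      "C1 \<in> carrier_mat t r" "C2 \<in> carrier_mat t r" "D1 \<in> carrier_mat t r" "D2 \<in> carrier_mat t r"
    for A1 A2 B1 B2 C1 C2 D1 D2
    using that by (intro eq_matI) auto
  show ?thesis
    unfolding mult_dilation[OF assms(1,3-6)] dilation_mult[OF assms(2-6)]
    by (rule minus) (auto intro!: carrier_matI simp: dims)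
qed

lemma four_block_mat_inject:
  assumes "A \<in> carrier_mat n1 m1" "B \<in> carrier_mat n1 m2" "C \<in> carrier_mat n2 m1" "D \<in> carrier_mat n2 m2"
    and "A' \<in> carrier_mat n1 m1" "B' \<in> carrier_mat n1 m2" "C' \<in> carrier_mat n2 m1" "D' \<in> carrier_mat n2 m2"
    and eq: "four_block_mat A B C D = four_block_mat A' B' C' D'"
  shows "A = A' \<and> B = B' \<and> C = C' \<and> D = D'"
proof -
  have ix: "four_block_mat A B C D $$ (i, j) = four_block_mat A' B' C' D' $$ (i, j)" for i j
    by (simp only: eq)
  have "A $$ (i, j) = A' $$ (i, j)" if "i < n1" "j < m1" for i j
    using ix[of i j] assms(1-8) that by auto
  moreover have "B $$ (i, j) = B' $$ (i, j)" if "i < n1" "j < m2" for i j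
    using ix[of i "m1 + j"] assms(1-8) that by auto
  moreover have "C $$ (i, j) = C' $$ (i, j)" if "i < n2" "j < m1" for i j
    using ix[of "n1 + i" j] assms(1-8) that by auto
  moreover have "D $$ (i, j) = D' $$ (i, j)" if "i < n2" "j < m2" for i j
    using ix[of "n1 + i" "m1 + j"] assms(1-8) that by auto
  ultimately show ?thesis using assms(1-8) by (auto intro!: eq_matI)
qed

section \<open>The gap between singular values\<close>

lemma finite_sv_differences: "finite {\<bar>\<omega> - \<gamma>\<bar> | \<omega> \<gamma>. \<omega> \<in># sv A \<and> \<gamma> \<in># sv_ext B}"
proof -
  have "{\<bar>\<omega> - \<gamma>\<bar> | \<omega> \<gamma>. \<omega> \<in># sv A \<and> \<gamma> \<in># sv_ext B} =
      (\<lambda>(\<omega>, \<gamma>). \<bar>\<omega> - \<gamma>\<bar>) ` (set_mset (sv A) \<times> set_mset (sv_ext B))"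
    by auto
  then show ?thesis by simp
qed

lemma sv_gap_le: "\<omega> \<in># sv A \<Longrightarrow> \<gamma> \<in># sv_ext B \<Longrightarrow> sv_gap A B \<le> \<bar>\<omega> - \<gamma>\<bar>"
  unfolding sv_gap_def by (rule Min_le[OF finite_sv_differences]) blast

lemma sv_gap_pos:
  assumes "sv A \<noteq> {#}" "sv_ext B \<noteq> {#}" "set_mset (sv A) \<inter> set_mset (sv_ext B) = {}"
  shows "sv_gap A B > 0"
proof -
  obtain \<omega> \<gamma> where "\<omega> \<in># sv A" "\<gamma> \<in># sv_ext B"
    using assms(1,2) by (meson multiset_nonemptyE)
  then have "{\<bar>\<omega> - \<gamma>\<bar> | \<omega> \<gamma>. \<omega> \<in># sv A \<and> \<gamma> \<in># sv_ext B} \<noteq> {}" by blast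
  from Min_in[OF finite_sv_differences this]
  obtain \<omega> \<gamma> where "\<omega> \<in># sv A" "\<gamma> \<in># sv_ext B" "sv_gap A B = \<bar>\<omega> - \<gamma>\<bar>"
    unfolding sv_gap_def by blast
  then show ?thesis using assms(3) by auto
qed

theorem lemma2p3:
  fixes A B S T :: "complex mat" and r s t :: nat
  assumes "r \<ge> 1" and "s \<ge> 1" and "t \<ge> 1"
    and "A \<in> carrier_mat r r" and "B \<in> carrier_mat s t"
    and "S \<in> carrier_mat s r" and "T \<in> carrier_mat t r"
    and "set_mset (sv A) \<inter> set_mset (sv_ext B) = {}"
  shows
    "(\<exists>!Z. Z \<in> carrier_mat s r \<times> carrier_mat t r \<and>
        (case Z of (X, Y) \<Rightarrow>
          X * A - B * Y = S \<and> Y * mat_adjoint A - mat_adjoint B * X = T)) \<and>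
     (\<forall>X \<in> carrier_mat s r. \<forall>Y \<in> carrier_mat t r.
        X * A - B * Y = S \<longrightarrow> Y * mat_adjoint A - mat_adjoint B * X = T \<longrightarrow>
        (let \<delta> = sv_gap A B in
           sqrt ((frobenius_norm X)\<^sup>2 + (frobenius_norm Y)\<^sup>2)
             \<le> 1 / \<delta> * sqrt ((frobenius_norm S)\<^sup>2 + (frobenius_norm T)\<^sup>2)) \<and>
        (let \<delta> = sigma_min A - sigma_max B in \<delta> > 0 \<longrightarrow>
           (\<forall>N. unitarily_invariant_norm N \<longrightarrow>
              N (four_block_mat (0\<^sub>m s r) X Y (0\<^sub>m t r))
                \<le> 1 / \<delta> * N (four_block_mat S (0\<^sub>m s r) (0\<^sub>m t r) T) \<and>
              max (N X) (N Y) \<le> 1 / \<delta> * max (N S) (N T)) \<and>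
           max (spectral_norm X) (spectral_norm Y)
             \<le> 1 / \<delta> * max (spectral_norm S) (spectral_norm T)) \<and>
        (let \<delta> = sv_gap A B in
           (\<forall>N. unitarily_invariant_norm N \<longrightarrow>
              N (four_block_mat (0\<^sub>m s r) X Y (0\<^sub>m t r))
                \<le> pi / 2 * (1 / \<delta>) * N (four_block_mat S (0\<^sub>m s r) (0\<^sub>m t r) T) \<and>
              max (N X) (N Y) \<le> pi * (1 / \<delta>) * max (N S) (N T)) \<and>
           max (spectral_norm X) (spectral_norm Y)
             \<le> pi / 2 * (1 / \<delta>) * max (spectral_norm S) (spectral_norm T)))"
proof -
  note r = assms(1) and s = assms(2) and t = assms(3)
    and A = assms(4) and B = assms(5) and S = assms(6) and T = assms(7)
  have A': "mat_adjoint A \<in> carrier_mat r r" and B': "mat_adjoint B \<in> carrier_mat t s"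
    using A B by auto
  let ?H = "dilation A" and ?K = "dilation B"
  obtain U a where U: "U \<in> carrier_mat (r + r) (r + r)" "unitary_mat U"
    and H: "?H = U * mat_diag (r + r) (\<lambda>i. of_real (a i)) * mat_adjoint U"
    using hermitian_diagonalization[OF dilation_carrier[OF A] mat_adjoint_dilation] by blast
  obtain W b where W: "W \<in> carrier_mat (s + t) (s + t)" "unitary_mat W"
    and K: "?K = W * mat_diag (s + t) (\<lambda>i. of_real (b i)) * mat_adjoint W"
    using hermitian_diagonalization[OF dilation_carrier[OF B] mat_adjoint_dilation] by blast
  note diag = U W H K
  \<comment> \<open>As \<open>A\<close> is square, no zeros are added, and the absolute value of
    every eigenvalue of \<open>?H\<close> lies in \<open>sv A\<close> itself.\<close>
  have "sv_ext A = sv A" using A by (simp add: sv_ext_def)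
  then have a: "\<bar>a j\<bar> \<in># sv A" if "j < r + r" for j
    using abs_in_sv_ext[OF A eigenvalue_of_diagonalization[OF U that H]] by simp
  have b: "\<bar>b i\<bar> \<in># sv_ext B" if "i < s + t" for i
    by (rule abs_in_sv_ext[OF B eigenvalue_of_diagonalization[OF W that K]])
  have svA: "sv A \<noteq> {#}" and svB: "sv B \<noteq> {#}"
    using sv_nonempty[of A] sv_nonempty[of B] A B r s t by auto
  then have \<delta>: "sv_gap A B > 0" using assms(8) by (intro sv_gap_pos) (auto simp: sv_ext_def)
  \<comment> \<open>The signs of \<open>a j\<close> and \<open>b i\<close> are unknown, but
    \<open>\<bar>\<bar>a j\<bar> - \<bar>b i\<bar>\<bar> \<le> \<bar>a j - b
    i\<bar>\<close>.\<close>
  have gap: "sv_gap A B \<le> \<bar>a j - b i\<bar>" if "i < s + t" "j < r + r" for i j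
    using sv_gap_le[OF a[OF that(2)] b[OF that(1)]] by linarith
  have neq: "a j \<noteq> b i" if "i < s + t" "j < r + r" for i j
    using gap[OF that] \<delta> by auto
  let ?R = "four_block_mat (0\<^sub>m s r) S T (0\<^sub>m t r)"
  have R: "?R \<in> carrier_mat (s + t) (r + r)" by (rule four_block_carrier_mat) simp_all
  let ?Z = "\<lambda>X Y. four_block_mat X (0\<^sub>m s r) (0\<^sub>m t r) Y"
  have Z: "?Z X Y \<in> carrier_mat (s + t) (r + r)" if "X \<in> carrier_mat s r" "Y \<in> carrier_mat t r" for X Y
    using that by simp
  have eqR: "?Z X Y * ?H - ?K * ?Z X Y = ?R"
    if "X \<in> carrier_mat s r" "Y \<in> carrier_mat t r"
      "X * A - B * Y = S" "Y * mat_adjoint A - mat_adjoint B * X = T" for X Y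
    using sylvester_dilation[OF A B that(1) zero_carrier_mat zero_carrier_mat that(2)] that A A' B B'
    by (simp add: minus_r_inv_mat[OF zero_carrier_mat])
  have ex: "\<exists>X\<in>carrier_mat s r. \<exists>Y\<in>carrier_mat t r.
      X * A - B * Y = S \<and> Y * mat_adjoint A - mat_adjoint B * X = T"
  proof -
    obtain M where M: "M \<in> carrier_mat (s + t) (r + r)" and eq: "M * ?H - ?K * M = ?R"
      using sylvester_exists[OF diag R neq] by blast
    obtain X P Q Y where split: "split_block M s r = (X, P, Q, Y)" by (metis prod_cases4)
    have "dim_row M = s + t" "dim_col M = r + r" using M by auto
    note blocks = split_block[OF split this]
    have dims: "dim_row X = s" "dim_col X = r" "dim_row P = s" "dim_col P = r"
      "dim_row Q = t" "dim_col Q = r" "dim_row Y = t" "dim_col Y = r"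
      "dim_row A = r" "dim_col A = r" "dim_row B = s" "dim_col B = t"
      using blocks(1-4) A B by auto
    have c: "P * mat_adjoint A - B * Q \<in> carrier_mat s r" "X * A - B * Y \<in> carrier_mat s r"
      "Y * mat_adjoint A - mat_adjoint B * X \<in> carrier_mat t r" "Q * A - mat_adjoint B * P \<in> carrier_mat t r"
      by (auto intro!: carrier_matI simp: dims)
    have "four_block_mat (P * mat_adjoint A - B * Q) (X * A - B * Y)
        (Y * mat_adjoint A - mat_adjoint B * X) (Q * A - mat_adjoint B * P) = ?R"
      using sylvester_dilation[OF A B blocks(1-4)] eq blocks(5) by simp
    then have "X * A - B * Y = S \<and> Y * mat_adjoint A - mat_adjoint B * X = T"
      using four_block_mat_inject[OF c zero_carrier_mat S T zero_carrier_mat] by blast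
    then show ?thesis using blocks by blast
  qed
  have uniq: "X = X' \<and> Y = Y'"
    if "X \<in> carrier_mat s r" "Y \<in> carrier_mat t r"
      "X * A - B * Y = S" "Y * mat_adjoint A - mat_adjoint B * X = T"
      "X' \<in> carrier_mat s r" "Y' \<in> carrier_mat t r"
      "X' * A - B * Y' = S" "Y' * mat_adjoint A - mat_adjoint B * X' = T" for X Y X' Y'
  proof -
    have "?Z X Y = ?Z X' Y'"
      using eqR[OF that(1-4)] eqR[OF that(5-8)]
      by (intro sylvester_unique[OF diag Z[OF that(1,2)] Z[OF that(5,6)] neq]) simp_all
    then show ?thesis
      using four_block_mat_inject[OF that(1) zero_carrier_mat zero_carrier_mat that(2,5) zero_carrier_mat zero_carrier_mat that(6)]
      by blast
  qed
  have unique: "\<exists>!Z. Z \<in> carrier_mat s r \<times> carrier_mat t r \<and>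
        (case Z of (X, Y) \<Rightarrow> X * A - B * Y = S \<and> Y * mat_adjoint A - mat_adjoint B * X = T)"
  proof (rule ex_ex1I)
    show "\<exists>Z. Z \<in> carrier_mat s r \<times> carrier_mat t r \<and>
        (case Z of (X, Y) \<Rightarrow> X * A - B * Y = S \<and> Y * mat_adjoint A - mat_adjoint B * X = T)"
    proof -
      from ex obtain X Y where "X \<in> carrier_mat s r" "Y \<in> carrier_mat t r"
        "X * A - B * Y = S" "Y * mat_adjoint A - mat_adjoint B * X = T" by blast
      then show ?thesis by (intro exI[of _ "(X, Y)"]) simp
    qed
    fix Z Z' assume Z: "Z \<in> carrier_mat s r \<times> carrier_mat t r \<and>
        (case Z of (X, Y) \<Rightarrow> X * A - B * Y = S \<and> Y * mat_adjoint A - mat_adjoint B * X = T)"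
      and Z': "Z' \<in> carrier_mat s r \<times> carrier_mat t r \<and>
        (case Z' of (X, Y) \<Rightarrow> X * A - B * Y = S \<and> Y * mat_adjoint A - mat_adjoint B * X = T)"
    obtain X Y X' Y' where "Z = (X, Y)" "Z' = (X', Y')" by (metis surj_pair)
    then show "Z = Z'" using uniq[of X Y X' Y'] Z Z' by simp
  qed
  have offdiag: "N (four_block_mat (0\<^sub>m s r) X Y (0\<^sub>m t r)) = N (?Z X Y)"
    if "unitarily_invariant_norm N" "X \<in> carrier_mat s r" "Y \<in> carrier_mat t r" for N X Y
    by (rule ui_norm_swap_cols[OF that(1,2) zero_carrier_mat zero_carrier_mat that(3)])
  have bounds:
    "sqrt ((frobenius_norm X)\<^sup>2 + (frobenius_norm Y)\<^sup>2)
      \<le> 1 / sv_gap A B * sqrt ((frobenius_norm S)\<^sup>2 + (frobenius_norm T)\<^sup>2)" (is ?a)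
    "\<And>N. sigma_min A - sigma_max B > 0 \<Longrightarrow> unitarily_invariant_norm N \<Longrightarrow>
      N (?Z X Y) \<le> 1 / (sigma_min A - sigma_max B) * N (?Z S T)"
    "\<And>N. sigma_min A - sigma_max B > 0 \<Longrightarrow> unitarily_invariant_norm N \<Longrightarrow>
      max (N X) (N Y) \<le> 1 / (sigma_min A - sigma_max B) * max (N S) (N T)"
    "\<And>N. unitarily_invariant_norm N \<Longrightarrow> N (?Z X Y) \<le> pi / 2 * (1 / sv_gap A B) * N (?Z S T)"
    "\<And>N. unitarily_invariant_norm N \<Longrightarrow> max (N X) (N Y) \<le> pi * (1 / sv_gap A B) * max (N S) (N T)"
    "max (spectral_norm X) (spectral_norm Y)
      \<le> pi / 2 * (1 / sv_gap A B) * max (spectral_norm S) (spectral_norm T)" (is ?c)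
    if X: "X \<in> carrier_mat s r" and Y: "Y \<in> carrier_mat t r"
      and eq1: "X * A - B * Y = S" and eq2: "Y * mat_adjoint A - mat_adjoint B * X = T" for X Y
  proof -
    note eq = eqR[OF X Y eq1 eq2]
    have fro0: "frobenius_norm (0\<^sub>m m n) = 0" for m n by (simp add: frobenius_norm_def)
    have "frobenius_norm (?Z X Y) \<le> 1 / sv_gap A B * frobenius_norm ?R"
      using frobenius_norm_sylvester_le[OF diag Z[OF X Y] \<delta> gap] unfolding eq .
    moreover have "frobenius_norm (?Z X Y) = sqrt ((frobenius_norm X)\<^sup>2 + (frobenius_norm Y)\<^sup>2)"
      using frobenius_norm_four_block[OF X zero_carrier_mat zero_carrier_mat Y]
      by (intro real_sqrt_unique[symmetric]) (simp_all add: fro0 frobenius_norm_nonneg)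
    moreover have "frobenius_norm ?R = sqrt ((frobenius_norm S)\<^sup>2 + (frobenius_norm T)\<^sup>2)"
      using frobenius_norm_four_block[OF zero_carrier_mat S T zero_carrier_mat]
      by (intro real_sqrt_unique[symmetric]) (simp_all add: fro0 frobenius_norm_nonneg)
    ultimately show ?a by simp
    have R_norm: "N ?R = N (?Z S T)" if "unitarily_invariant_norm N" for N
      by (rule offdiag[OF that S T])
    show c: "N (?Z X Y) \<le> pi / 2 * (1 / sv_gap A B) * N (?Z S T)" if ui: "unitarily_invariant_norm N" for N
      using ui_norm_sylvester_le[OF diag ui Z[OF X Y] \<delta> gap] unfolding eq R_norm[OF ui] .
    show "max (N X) (N Y) \<le> pi * (1 / sv_gap A B) * max (N S) (N T)" if ui: "unitarily_invariant_norm N" for N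
    proof -
      have "max (N X) (N Y) \<le> N (?Z X Y)" using ui_norm_diag_blocks(1,2)[OF ui X Y] by simp
      also have "\<dots> \<le> pi / 2 * (1 / sv_gap A B) * N (?Z S T)" by (rule c[OF ui])
      also have "\<dots> \<le> pi / 2 * (1 / sv_gap A B) * (2 * max (N S) (N T))"
        using ui_norm_diag_blocks(3)[OF ui S T] \<delta> by (intro mult_left_mono) auto
      finally show ?thesis by simp
    qed
    note sp = unitarily_invariant_spectral_norm
    show ?c
    proof -
      have "max (spectral_norm X) (spectral_norm Y) \<le> spectral_norm (?Z X Y)"
        using ui_norm_diag_blocks(1,2)[OF sp X Y] by simp
      also have "\<dots> \<le> pi / 2 * (1 / sv_gap A B) * spectral_norm (?Z S T)" by (rule c[OF sp])
      also have "\<dots> \<le> pi / 2 * (1 / sv_gap A B) * max (spectral_norm S) (spectral_norm T)"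
        using spectral_norm_diag_block_le[OF S T] \<delta> by (intro mult_left_mono) auto
      finally show ?thesis .
    qed
    fix N assume pos: "sigma_min A - sigma_max B > 0" and ui: "unitarily_invariant_norm N"
    let ?\<sigma> = "sigma_min A" and ?\<tau> = "sigma_max B"
    obtain x where x: "x \<in># sv B" using svB by (meson multiset_nonemptyE)
    have \<tau>0: "0 \<le> ?\<tau>" unfolding sigma_max_def using sv_nonneg[OF x] x by (intro order_trans[OF _ Max_ge]) auto
    then have \<sigma>0: "0 < ?\<sigma>" using pos by simp
    have \<sigma>: "?\<sigma> \<le> \<bar>a j\<bar>" if "j < r + r" for j
      unfolding sigma_min_def using a[OF that] by (intro Min_le) auto
    have \<tau>: "\<bar>b i\<bar> \<le> ?\<tau>" if "i < s + t" for i
    proof (cases "\<bar>b i\<bar> \<in># sv B")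
      case True
      then show ?thesis unfolding sigma_max_def by (intro Max_ge) auto
    next
      \<comment> \<open>The only members of \<open>sv_ext B\<close> outside \<open>sv B\<close> are
        padding zeros, and \<open>\<tau>0\<close> covers them.\<close>
      case False
      then have "\<bar>b i\<bar> = 0" using b[OF that] by (auto simp: sv_ext_def in_replicate_mset split: if_splits)
      then show ?thesis using \<tau>0 by simp
    qed
    have cancel: "M = (M - L) + L" if "M \<in> carrier_mat m n" "L \<in> carrier_mat m n" for M L :: "complex mat" and m n
      using that by (intro eq_matI) auto
    note lower = ui_norm_le_mult_hermitian[OF diag ui _ \<sigma>0 \<sigma>]
    note upper = ui_norm_hermitian_mult_le[OF diag ui _ \<tau>0 \<tau>]
    show "N (?Z X Y) \<le> 1 / (?\<sigma> - ?\<tau>) * N (?Z S T)"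
    proof -
      have KZ: "?K * ?Z X Y \<in> carrier_mat (s + t) (r + r)"
        using dilation_carrier[OF B] Z[OF X Y] by (rule mult_carrier_mat)
      have ZH: "?Z X Y * ?H \<in> carrier_mat (s + t) (r + r)"
        using Z[OF X Y] dilation_carrier[OF A] by (rule mult_carrier_mat)
      have "?Z X Y * ?H = ?R + ?K * ?Z X Y"
        unfolding eq[symmetric] by (rule cancel[OF ZH KZ])
      then have "N (?Z X Y * ?H) \<le> N ?R + N (?K * ?Z X Y)"
        using ui_norm_triangle[OF ui R KZ] by simp
      then have "?\<sigma> * N (?Z X Y) \<le> N (?Z S T) + ?\<tau> * N (?Z X Y)"
        using lower[OF Z[OF X Y]] upper[OF Z[OF X Y]] R_norm[OF ui] by linarith
      then show ?thesis using pos by (simp add: field_simps)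
    qed
    \<comment> \<open>Going through \<open>?Z S T\<close> would cost a factor 2, as in (c). Instead
      \<open>lower\<close> and \<open>upper\<close> are applied with one block set to 0, which
      compares \<open>X * A\<close> and \<open>mat_adjoint B * X\<close> with \<open>X\<close>
      alone, and likewise for \<open>Y\<close>.\<close>
    show "max (N X) (N Y) \<le> 1 / (?\<sigma> - ?\<tau>) * max (N S) (N T)"
    proof -
      have BY: "B * Y \<in> carrier_mat s r" and BX: "mat_adjoint B * X \<in> carrier_mat t r"
        and XA: "X * A \<in> carrier_mat s r" and YA: "Y * mat_adjoint A \<in> carrier_mat t r"
        using A A' B B' X Y by (meson mult_carrier_mat)+
      have X0: "?Z X (0\<^sub>m t r) * ?H = four_block_mat (0\<^sub>m s r) (X * A) (0\<^sub>m t r) (0\<^sub>m t r)"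
        "?K * ?Z X (0\<^sub>m t r) = four_block_mat (0\<^sub>m s r) (0\<^sub>m s r) (mat_adjoint B * X) (0\<^sub>m t r)"
        using mult_dilation[OF A X zero_carrier_mat zero_carrier_mat zero_carrier_mat]
          dilation_mult[OF B X zero_carrier_mat zero_carrier_mat zero_carrier_mat] A A' B B' by simp_all
      have Y0: "?Z (0\<^sub>m s r) Y * ?H = four_block_mat (0\<^sub>m s r) (0\<^sub>m s r) (Y * mat_adjoint A) (0\<^sub>m t r)"
        "?K * ?Z (0\<^sub>m s r) Y = four_block_mat (0\<^sub>m s r) (B * Y) (0\<^sub>m t r) (0\<^sub>m t r)"
        using mult_dilation[OF A zero_carrier_mat zero_carrier_mat zero_carrier_mat Y]
          dilation_mult[OF B zero_carrier_mat zero_carrier_mat zero_carrier_mat Y] A A' B B' by simp_all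
      note single = ui_norm_single_block[OF ui]
      have "?\<sigma> * N X \<le> N (X * A)" "N (mat_adjoint B * X) \<le> ?\<tau> * N X"
        using lower[OF Z[OF X zero_carrier_mat]] upper[OF Z[OF X zero_carrier_mat]]
        unfolding X0 single(1)[OF X] single(2)[OF XA] single(3)[OF BX] by blast+
      moreover have "?\<sigma> * N Y \<le> N (Y * mat_adjoint A)" "N (B * Y) \<le> ?\<tau> * N Y"
        using lower[OF Z[OF zero_carrier_mat Y]] upper[OF Z[OF zero_carrier_mat Y]]
        unfolding Y0 single(4)[OF Y] single(3)[OF YA] single(2)[OF BY] by blast+
      moreover have "X * A = S + B * Y" unfolding eq1[symmetric] by (rule cancel[OF XA BY])
      moreover have "Y * mat_adjoint A = T + mat_adjoint B * X"
        unfolding eq2[symmetric] by (rule cancel[OF YA BX])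
      ultimately have "?\<sigma> * N X \<le> N S + ?\<tau> * N Y" "?\<sigma> * N Y \<le> N T + ?\<tau> * N X"
        using ui_norm_triangle[OF ui S BY] ui_norm_triangle[OF ui T BX] by simp_all
      moreover have "?\<tau> * N Y \<le> ?\<tau> * max (N X) (N Y)" "?\<tau> * N X \<le> ?\<tau> * max (N X) (N Y)"
        using \<tau>0 by (auto intro: mult_left_mono)
      \<comment> \<open>Each of the two inequalities involves the norm of the other block. Replacing
        it by the maximum and taking the inequality for the larger of \<open>N X\<close> and
        \<open>N Y\<close> closes the loop.\<close>
      moreover have "?\<sigma> * max (N X) (N Y) = ?\<sigma> * N X \<or> ?\<sigma> * max (N X) (N Y) = ?\<sigma> * N Y"
        by (auto simp: max_def)
      moreover have "N S \<le> max (N S) (N T)" "N T \<le> max (N S) (N T)" by simp_all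
      ultimately have "?\<sigma> * max (N X) (N Y) \<le> max (N S) (N T) + ?\<tau> * max (N X) (N Y)" by linarith
      then have "(?\<sigma> - ?\<tau>) * max (N X) (N Y) \<le> max (N S) (N T)" by (simp only: left_diff_distrib)
      moreover have "c > 0 \<Longrightarrow> c * x \<le> y \<Longrightarrow> x \<le> 1 / c * y" for c x y :: real
        by (simp add: field_simps)
      ultimately show ?thesis using pos by blast
    qed
  qed
  show ?thesis
    unfolding Let_def
    by (intro conjI ballI impI allI unique; (subst offdiag, assumption+)?;
      (rule bounds; (assumption | rule unitarily_invariant_spectral_norm)))
qed

end
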